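(* Let $\Gamma$ be a discrete amenable group, let $1\le p<\infty$, and let $a\in\ell^1(\Gamma)$. Let $\mathrm{CV}_p(\Gamma)$ denote the subalgebra of $\mathcal{B}(\ell^p(\Gamma))$ consisting of all operators that commute with right translations. Suppose that $L_a:\ell^p(\Gamma)\to\ell^p(\Gamma)$ is injective and has complemented range. Then $L_a$ is invertible in $\mathrm{CV}_p(\Gamma)$, and in particular is surjective.
   Context: $\mathcal{B}(X)$ denotes the algebra of bounded linear operators on a Banach space $X$. For $a\in\ell^1(\Gamma)$, $L_a$ is the left convolution operator $(L_a\xi)(h)=\sum_{g\in\Gamma}a(g)\,\xi(g^{-1}h)$ for $\xi\in\ell^p(\Gamma)$, $h\in\Gamma$. Right translations on $\ell^p(\Gamma)$ are the operators $\xi\mapsto\xi(\,\cdot\,g)$, $g\in\Gamma$. "Complemented range" means that the range of $L_a$ is a closed subspace of $\ell^p(\Gamma)$ which is the range of a bounded linear projection on $\ell^p(\Gamma)$. *)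

theory Defs
  imports "HOL-Analysis.Analysis" "HOL-Algebra.Ring"
begin

text \<open>
  Functions on a group \<open>G\<close> are represented by functions on the ambient type that vanish
  outside \<open>carrier G\<close>, so that pointwise operations need no restriction.
  Operators on \<open>lp G p\<close> are extensional (\<open>undefined\<close> outside \<open>lp G p\<close>), so that equality
  of operators is equality on \<open>lp G p\<close>.
\<close>

definition lp :: "('a, 'b) monoid_scheme \<Rightarrow> real \<Rightarrow> ('a \<Rightarrow> complex) set" where
  "lp G p = {\<xi>. (\<forall>x. x \<notin> carrier G \<longrightarrow> \<xi> x = 0) \<and>
                (\<lambda>x. cmod (\<xi> x) powr p) summable_on carrier G}"

definition lp_norm :: "('a, 'b) monoid_scheme \<Rightarrow> real \<Rightarrow> ('a \<Rightarrow> complex) \<Rightarrow> real" where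
  "lp_norm G p \<xi> = (\<Sum>\<^sub>\<infinity>x\<in>carrier G. cmod (\<xi> x) powr p) powr (1 / p)"

definition linf_real :: "('a, 'b) monoid_scheme \<Rightarrow> ('a \<Rightarrow> real) set" where
  "linf_real G = {f. (\<forall>x. x \<notin> carrier G \<longrightarrow> f x = 0) \<and> bounded (f ` carrier G)}"

definition left_invariant_mean ::
    "('a, 'b) monoid_scheme \<Rightarrow> (('a \<Rightarrow> real) \<Rightarrow> real) \<Rightarrow> bool" where
  "left_invariant_mean G m \<longleftrightarrow>
     (\<forall>f\<in>linf_real G. \<forall>h\<in>linf_real G. m (\<lambda>x. f x + h x) = m f + m h) \<and>
     (\<forall>c. \<forall>f\<in>linf_real G. m (\<lambda>x. c * f x) = c * m f) \<and>
     (\<forall>f\<in>linf_real G. (\<forall>x\<in>carrier G. 0 \<le> f x) \<longrightarrow> 0 \<le> m f) \<and>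
     m (indicator (carrier G)) = 1 \<and>
     (\<forall>g\<in>carrier G. \<forall>f\<in>linf_real G.
        m (\<lambda>x. if x \<in> carrier G then f (inv\<^bsub>G\<^esub> g \<otimes>\<^bsub>G\<^esub> x) else 0) = m f)"

definition amenable :: "('a, 'b) monoid_scheme \<Rightarrow> bool" where
  "amenable G \<longleftrightarrow> (\<exists>m. left_invariant_mean G m)"

text \<open>The algebra of bounded linear operators on \<open>lp G p\<close> (scalar multiplication is not recorded).\<close>

definition bounded_ops ::
    "('a, 'b) monoid_scheme \<Rightarrow> real \<Rightarrow> (('a \<Rightarrow> complex) \<Rightarrow> ('a \<Rightarrow> complex)) ring" where
  "bounded_ops G p = \<lparr>
     carrier = {T \<in> lp G p \<rightarrow>\<^sub>E lp G p.
       (\<forall>\<xi>\<in>lp G p. \<forall>\<eta>\<in>lp G p. T (\<lambda>x. \<xi> x + \<eta> x) = (\<lambda>x. T \<xi> x + T \<eta> x)) \<and>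
       (\<forall>c. \<forall>\<xi>\<in>lp G p. T (\<lambda>x. c * \<xi> x) = (\<lambda>x. c * T \<xi> x)) \<and>
       (\<exists>C. \<forall>\<xi>\<in>lp G p. lp_norm G p (T \<xi>) \<le> C * lp_norm G p \<xi>)},
     mult = compose (lp G p),
     one = (\<lambda>\<xi>\<in>lp G p. \<xi>),
     ring.zero = (\<lambda>\<xi>\<in>lp G p. \<lambda>x. 0),
     ring.add = (\<lambda>S T. \<lambda>\<xi>\<in>lp G p. \<lambda>x. S \<xi> x + T \<xi> x)\<rparr>"

definition right_translation ::
    "('a, 'b) monoid_scheme \<Rightarrow> real \<Rightarrow> 'a \<Rightarrow> ('a \<Rightarrow> complex) \<Rightarrow> ('a \<Rightarrow> complex)" where
  "right_translation G p g =
     (\<lambda>\<xi>\<in>lp G p. \<lambda>x. if x \<in> carrier G then \<xi> (x \<otimes>\<^bsub>G\<^esub> g) else 0)"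

definition CV ::
    "('a, 'b) monoid_scheme \<Rightarrow> real \<Rightarrow> (('a \<Rightarrow> complex) \<Rightarrow> ('a \<Rightarrow> complex)) ring" where
  "CV G p = (bounded_ops G p)\<lparr>carrier :=
     {T \<in> carrier (bounded_ops G p). \<forall>g\<in>carrier G.
        T \<otimes>\<^bsub>bounded_ops G p\<^esub> right_translation G p g =
        right_translation G p g \<otimes>\<^bsub>bounded_ops G p\<^esub> T}\<rparr>"

definition left_conv ::
    "('a, 'b) monoid_scheme \<Rightarrow> real \<Rightarrow> ('a \<Rightarrow> complex) \<Rightarrow> ('a \<Rightarrow> complex) \<Rightarrow> ('a \<Rightarrow> complex)" where
  "left_conv G p a =
     (\<lambda>\<xi>\<in>lp G p. \<lambda>h. if h \<in> carrier G
        then (\<Sum>\<^sub>\<infinity>g\<in>carrier G. a g * \<xi> (inv\<^bsub>G\<^esub> g \<otimes>\<^bsub>G\<^esub> h)) else 0)"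

definition closed_subspace ::
    "('a, 'b) monoid_scheme \<Rightarrow> real \<Rightarrow> ('a \<Rightarrow> complex) set \<Rightarrow> bool" where
  "closed_subspace G p M \<longleftrightarrow>
     M \<subseteq> lp G p \<and> (\<lambda>x. 0) \<in> M \<and>
     (\<forall>\<xi>\<in>M. \<forall>\<eta>\<in>M. (\<lambda>x. \<xi> x + \<eta> x) \<in> M) \<and>
     (\<forall>c. \<forall>\<xi>\<in>M. (\<lambda>x. c * \<xi> x) \<in> M) \<and>
     (\<forall>s. \<forall>\<xi>\<in>lp G p. (\<forall>n::nat. s n \<in> M) \<and>
        (\<lambda>n. lp_norm G p (\<lambda>x. s n x - \<xi> x)) \<longlonglongrightarrow> 0 \<longrightarrow> \<xi> \<in> M)"

definition complemented ::
    "('a, 'b) monoid_scheme \<Rightarrow> real \<Rightarrow> ('a \<Rightarrow> complex) set \<Rightarrow> bool" where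
  "complemented G p M \<longleftrightarrow> closed_subspace G p M \<and>
     (\<exists>P\<in>carrier (bounded_ops G p). P \<otimes>\<^bsub>bounded_ops G p\<^esub> P = P \<and> P ` lp G p = M)"

end

theory Submission
  imports Defs "HOL-Algebra.Generated_Groups"
begin

text \<open>
  By the open mapping theorem \<open>L\<^sub>a\<close> is bounded below on \<open>\<ell>\<^sup>p\<close>. Khintchine's inequality extends the lower bound to
  \<open>\<ell>\<^sup>2\<close>-valued functions, and transference along almost invariant weights then gives a lower bound for \<open>L\<^sub>a\<close> on
  \<open>\<ell>\<^sup>2\<close>. On \<open>\<ell>\<^sup>2\<close> the trace \<open>T \<mapsto> (T \<delta>)(1)\<close> is available and yields \<open>b\<close> in \<open>\<ell>\<^sup>2\<close> with \<open>a * b = \<delta>\<close>. If \<open>2 \<le> p\<close> then \<open>b\<close>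
  lies in \<open>\<ell>\<^sup>p\<close>. If \<open>p < 2\<close>, a bounded left inverse of \<open>L\<^sub>a\<close> (which exists because the range is complemented) is
  averaged over right translations by the invariant mean, giving \<open>s\<close> in \<open>\<ell>\<^sup>p\<close> with \<open>s * a = \<delta>\<close>, and
  \<open>s = s * a * b = b\<close>. In both cases \<open>\<delta>\<close> is in the range of \<open>L\<^sub>a\<close>, which is closed and invariant under right translations.

  The weights come from a variant of Kesten's theorem: if an averaging operator over a symmetric set had norm
  below one on \<open>\<ell>\<^sup>2\<close>, its Green function would be strictly superharmonic, and the invariant mean of the increments of
  its logarithm would be both zero and negative.
\<close>

text \<open>The obstacle is to pass from a left inverse to a right inverse. For p different from 2
  there is no adjoint on the same space, hence no orthogonal projection whose trace could be tested;
  this forces the detour through l^2. Transference by itself keeps the exponent: summing |f (h j)|^p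
  over j would only return an l^p norm. Random signs replace this inner sum by a square sum, and so
  change p into 2. The constants lost on the way are harmless, because afterwards only positivity of
  the lower bound matters. The way back from l^2 is the other difficulty: for p < 2 membership in
  l^2 says nothing about membership in l^p, and there the projection supplies what the l^2 argument
  cannot. Associativity with two factors in l^2 is then not a case of Young's inequality and goes
  through the pairing of l^2 with itself. The mean is only finitely additive. The averaging of the
  left inverse is therefore carried out with \<open>a\<close> cut down to finite support, and the
  weights, which have to be honest finitely supported functions, are obtained from the mean by a
  spectral argument.\<close>

no_notation Infinite_Set_Sum.abs_summable_on (infix "abs'_summable'_on" 50)

section \<open>The spaces \<open>\<ell>\<^sup>p\<close>\<close>

text \<open>The tangent line of the convex function t^p at u. It is the source of the Jensen-type
  inequalities below: for finite sums, infinite sums, averages over signs and invariant means. The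
  cases at 0 are separate because convexity is applied on the open half-line;
  \<open>0 powr 0 = 0\<close> makes the slope vanish at u = 0 even when p = 1.\<close>

lemma powr_tangent:
  fixes p t u :: real
  assumes p: "1 \<le> p" and t: "0 \<le> t" and u: "0 \<le> u"
  shows "u powr p + p * u powr (p - 1) * (t - u) \<le> t powr p"
proof (cases "u = 0 \<or> t = 0")
  case True
  then show ?thesis
  proof
    assume "t = 0"
    have "u powr (p - 1) * u = u powr p"
      using u by (cases "u = 0") (auto simp: powr_diff)
    then have "u powr p + p * u powr (p - 1) * (t - u) = (1 - p) * u powr p"
      using \<open>t = 0\<close> by (simp add: algebra_simps)
    also have "\<dots> \<le> 0" using p by (simp add: mult_nonpos_nonneg)
    finally show ?thesis by (simp add: \<open>t = 0\<close>)
  qed auto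
next
  case False
  with t u have "0 < t" "0 < u" by auto
  have "t powr p - u powr p \<ge> p * u powr (p - 1) * (t - u)"
  proof (rule convex_on_imp_above_tangent[OF powr_convex[OF p]])
    show "((\<lambda>x. x powr p) has_real_derivative p * u powr (p - 1)) (at u within {0<..})"
      by (rule DERIV_subset[of _ _ _ UNIV]) (use \<open>0 < u\<close> in \<open>auto intro!: derivative_eq_intros\<close>)
  qed (use \<open>0 < t\<close> \<open>0 < u\<close> in \<open>auto simp: interior_open\<close>)
  then show ?thesis by simp
qed

text \<open>The linear terms of the two tangents at the convex combination cancel.\<close>

lemma powr_convex_comb:
  fixes p s t u v :: real
  assumes p: "1 \<le> p" and "0 \<le> s" "0 \<le> t" "s + t = 1" "0 \<le> u" "0 \<le> v"
  shows "(s * u + t * v) powr p \<le> s * u powr p + t * v powr p"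
proof -
  define w where "w = s * u + t * v"
  have w: "0 \<le> w" using assms by (simp add: w_def)
  have "s * (w powr p + p * w powr (p - 1) * (u - w)) + t * (w powr p + p * w powr (p - 1) * (v - w))
      \<le> s * u powr p + t * v powr p"
    using assms w by (intro add_mono mult_left_mono powr_tangent) auto
  moreover have "s * (w powr p + p * w powr (p - 1) * (u - w)) + t * (w powr p + p * w powr (p - 1) * (v - w))
      = (s + t) * w powr p + p * w powr (p - 1) * (w - (s + t) * w)"
    by (simp add: w_def algebra_simps)
  ultimately show ?thesis using \<open>s + t = 1\<close> by (simp add: w_def)
qed

lemma powr_add_le_double:
  fixes u v p :: real
  assumes "0 \<le> p" "0 \<le> u" "0 \<le> v"
  shows "(u + v) powr p \<le> 2 powr p * (u powr p + v powr p)"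
proof -
  have "(u + v) powr p \<le> (2 * max u v) powr p"
    using assms by (intro powr_mono2) auto
  also have "\<dots> = 2 powr p * (max u v) powr p"
    using assms by (simp add: powr_mult)
  also have "(max u v) powr p \<le> u powr p + v powr p"
    by (auto simp: max_def)
  finally show ?thesis by simp
qed

text \<open>Normalisation reduces this to convexity: (u i + v i) / (A + B) is the convex combination
  of u i / A and v i / B with weights A / (A + B) and B / (A + B). Upper bounds A and B in place of
  norms let finite partial sums be measured against the full norms.\<close>

lemma minkowski_sum:
  fixes u v :: "'i \<Rightarrow> real"
  assumes p: "1 \<le> p" and u: "\<And>i. 0 \<le> u i" and v: "\<And>i. 0 \<le> v i"
    and "0 \<le> A" "0 \<le> B" "finite F"
    and uA: "(\<Sum>i\<in>F. u i powr p) \<le> A powr p" and vB: "(\<Sum>i\<in>F. v i powr p) \<le> B powr p"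
  shows "(\<Sum>i\<in>F. (u i + v i) powr p) \<le> (A + B) powr p"
proof -
  have zero: "\<forall>i\<in>F. w i = 0" if "(\<Sum>i\<in>F. w i powr p) \<le> 0 powr p" for w :: "'i \<Rightarrow> real"
  proof -
    have "(\<Sum>i\<in>F. w i powr p) = 0" using that by (auto intro!: antisym sum_nonneg)
    then show ?thesis using \<open>finite F\<close> by (simp add: sum_nonneg_eq_0_iff)
  qed
  consider "A = 0" | "B = 0" | "0 < A" "0 < B" using assms by linarith
  then show ?thesis
  proof cases
    case 1 then show ?thesis using zero[of u] uA vB by simp
  next
    case 2 then show ?thesis using zero[of v] uA vB by simp
  next
    case 3
    define s t where "s = A / (A + B)" and "t = B / (A + B)"
    have st: "0 \<le> s" "0 \<le> t" "s + t = 1"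
      using 3 by (auto simp: s_def t_def simp flip: add_divide_distrib)
    have "(u i + v i) powr p \<le> (A + B) powr p * (s * (u i powr p / A powr p) + t * (v i powr p / B powr p))" for i
    proof -
      have "u i + v i = (A + B) * (s * (u i / A) + t * (v i / B))"
      proof -
        have "s * (u i / A) = u i / (A + B)" "t * (v i / B) = v i / (A + B)"
          using 3 by (simp_all add: s_def t_def)
        then show ?thesis using 3 by (simp flip: add_divide_distrib)
      qed
      then have "(u i + v i) powr p = (A + B) powr p * (s * (u i / A) + t * (v i / B)) powr p"
        using 3 u v st by (simp add: powr_mult)
      also have "\<dots> \<le> (A + B) powr p * (s * (u i / A) powr p + t * (v i / B) powr p)"
        using 3 u v st p by (intro mult_left_mono powr_convex_comb) auto
      finally show ?thesis using 3 u v by (simp add: powr_divide)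
    qed
    then have "(\<Sum>i\<in>F. (u i + v i) powr p)
        \<le> (\<Sum>i\<in>F. (A + B) powr p * (s * (u i powr p / A powr p) + t * (v i powr p / B powr p)))"
      by (intro sum_mono)
    also have "\<dots> = (A + B) powr p * (s * ((\<Sum>i\<in>F. u i powr p) / A powr p) + t * ((\<Sum>i\<in>F. v i powr p) / B powr p))"
      by (simp add: sum_distrib_left sum.distrib sum_divide_distrib algebra_simps)
    also have "\<dots> \<le> (A + B) powr p * (s * 1 + t * 1)"
      using 3 uA vB st by (intro mult_left_mono add_mono) auto
    finally show ?thesis using st by simp
  qed
qed

lemma lpI:
  assumes p: "1 \<le> p" and "\<And>x. x \<notin> carrier G \<Longrightarrow> \<xi> x = 0" and "0 \<le> B"
    and fin: "\<And>F. finite F \<Longrightarrow> F \<subseteq> carrier G \<Longrightarrow> (\<Sum>x\<in>F. cmod (\<xi> x) powr p) \<le> B powr p"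
  shows "\<xi> \<in> lp G p" and "lp_norm G p \<xi> \<le> B"
proof -
  have s: "(\<lambda>x. cmod (\<xi> x) powr p) summable_on carrier G"
    by (rule nonneg_bdd_above_summable_on) (use fin in \<open>auto simp: bdd_above_def\<close>)
  then show "\<xi> \<in> lp G p" using assms by (simp add: lp_def)
  have "(\<Sum>\<^sub>\<infinity>x\<in>carrier G. cmod (\<xi> x) powr p) \<le> B powr p"
    by (rule infsum_le_finite_sums[OF s]) (use fin in auto)
  then have "lp_norm G p \<xi> \<le> (B powr p) powr (1/p)"
    unfolding lp_norm_def using p by (intro powr_mono2) (auto intro!: infsum_nonneg)
  also have "\<dots> = B" using p \<open>0 \<le> B\<close> by (simp add: powr_powr)
  finally show "lp_norm G p \<xi> \<le> B" .
qed

lemma lp_norm_nonneg [simp]: "0 \<le> lp_norm G p \<xi>"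
  by (simp add: lp_norm_def)

lemma lp_outside: "\<xi> \<in> lp G p \<Longrightarrow> x \<notin> carrier G \<Longrightarrow> \<xi> x = 0"
  by (simp add: lp_def)

lemma lp_summable: "\<xi> \<in> lp G p \<Longrightarrow> (\<lambda>x. cmod (\<xi> x) powr p) summable_on carrier G"
  by (simp add: lp_def)

lemma lp_norm_powr:
  assumes "1 \<le> p"
  shows "lp_norm G p \<xi> powr p = (\<Sum>\<^sub>\<infinity>x\<in>carrier G. cmod (\<xi> x) powr p)"
  using assms by (simp add: lp_norm_def powr_powr infsum_nonneg)

lemma sum_le_lp_norm:
  assumes "1 \<le> p" "\<xi> \<in> lp G p" "finite F" "F \<subseteq> carrier G"
  shows "(\<Sum>x\<in>F. cmod (\<xi> x) powr p) \<le> lp_norm G p \<xi> powr p"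
  using assms by (simp add: lp_norm_powr finite_sum_le_infsum lp_summable)

lemma cmod_le_lp_norm:
  assumes p: "1 \<le> p" and \<xi>: "\<xi> \<in> lp G p"
  shows "cmod (\<xi> x) \<le> lp_norm G p \<xi>"
proof (cases "x \<in> carrier G")
  case True
  then have "cmod (\<xi> x) powr p \<le> lp_norm G p \<xi> powr p"
    using sum_le_lp_norm[OF p \<xi>, of "{x}"] by simp
  then show ?thesis using p powr_less_mono2[of p "lp_norm G p \<xi>" "cmod (\<xi> x)"] by fastforce
qed (simp add: lp_outside[OF \<xi>])

lemma lp_add:
  assumes p: "1 \<le> p" and \<xi>: "\<xi> \<in> lp G p" and \<eta>: "\<eta> \<in> lp G p"
  shows "(\<lambda>x. \<xi> x + \<eta> x) \<in> lp G p"
    and "lp_norm G p (\<lambda>x. \<xi> x + \<eta> x) \<le> lp_norm G p \<xi> + lp_norm G p \<eta>"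
proof -
  have "(\<Sum>x\<in>F. cmod (\<xi> x + \<eta> x) powr p) \<le> (lp_norm G p \<xi> + lp_norm G p \<eta>) powr p"
    if F: "finite F" "F \<subseteq> carrier G" for F
  proof -
    have "(\<Sum>x\<in>F. cmod (\<xi> x + \<eta> x) powr p) \<le> (\<Sum>x\<in>F. (cmod (\<xi> x) + cmod (\<eta> x)) powr p)"
      using p by (intro sum_mono powr_mono2 norm_triangle_ineq) auto
    also have "\<dots> \<le> (lp_norm G p \<xi> + lp_norm G p \<eta>) powr p"
      using assms F by (intro minkowski_sum sum_le_lp_norm) auto
    finally show ?thesis .
  qed
  then show "(\<lambda>x. \<xi> x + \<eta> x) \<in> lp G p"
    and "lp_norm G p (\<lambda>x. \<xi> x + \<eta> x) \<le> lp_norm G p \<xi> + lp_norm G p \<eta>"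
    using lpI[OF p, of G "\<lambda>x. \<xi> x + \<eta> x" "lp_norm G p \<xi> + lp_norm G p \<eta>"] lp_outside[OF \<xi>] lp_outside[OF \<eta>] by auto
qed

lemma lp_norm_scale:
  assumes p: "1 \<le> p"
  shows "lp_norm G p (\<lambda>x. c * \<xi> x) = cmod c * lp_norm G p \<xi>"
proof -
  have "(\<Sum>\<^sub>\<infinity>x\<in>carrier G. cmod (c * \<xi> x) powr p) = cmod c powr p * (\<Sum>\<^sub>\<infinity>x\<in>carrier G. cmod (\<xi> x) powr p)"
    by (simp add: norm_mult powr_mult infsum_cmult_right')
  then show ?thesis
    using p by (simp add: lp_norm_def powr_mult powr_powr infsum_nonneg)
qed

lemma lp_scale:
  assumes "\<xi> \<in> lp G p"
  shows "(\<lambda>x. c * \<xi> x) \<in> lp G p"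
  using assms by (auto simp: lp_def norm_mult powr_mult intro!: summable_on_cmult_right)

lemma lp_zero [simp]: "(\<lambda>x. 0) \<in> lp G p"
  by (simp add: lp_def)

lemma lp_norm_zero [simp]: "lp_norm G p (\<lambda>x. 0) = 0"
  by (simp add: lp_norm_def)

lemma lp_diff:
  assumes p: "1 \<le> p" and \<xi>: "\<xi> \<in> lp G p" and \<eta>: "\<eta> \<in> lp G p"
  shows "(\<lambda>x. \<xi> x - \<eta> x) \<in> lp G p"
    and "lp_norm G p (\<lambda>x. \<xi> x - \<eta> x) \<le> lp_norm G p \<xi> + lp_norm G p \<eta>"
  using lp_add[OF p \<xi> lp_scale[OF \<eta>, of "-1"]] lp_norm_scale[OF p, of G "-1" \<eta>] by auto

lemma lp_norm_commute: "lp_norm G p (\<lambda>x. \<xi> x - \<eta> x) = lp_norm G p (\<lambda>x. \<eta> x - \<xi> x)"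
  by (simp add: lp_norm_def norm_minus_commute)

lemma lp_norm_triangle_diff:
  assumes p: "1 \<le> p" and "\<xi> \<in> lp G p" "\<eta> \<in> lp G p" "\<zeta> \<in> lp G p"
  shows "lp_norm G p (\<lambda>x. \<xi> x - \<zeta> x) \<le> lp_norm G p (\<lambda>x. \<xi> x - \<eta> x) + lp_norm G p (\<lambda>x. \<eta> x - \<zeta> x)"
  using lp_add(2)[OF p lp_diff(1)[OF p, of \<xi> G \<eta>] lp_diff(1)[OF p, of \<eta> G \<zeta>]] assms by simp

lemma lp_norm_le_diff:
  assumes p: "1 \<le> p" and \<xi>: "\<xi> \<in> lp G p" and \<eta>: "\<eta> \<in> lp G p"
  shows "lp_norm G p \<xi> \<le> lp_norm G p \<eta> + lp_norm G p (\<lambda>x. \<xi> x - \<eta> x)"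
  using lp_add(2)[OF p \<eta> lp_diff(1)[OF p \<xi> \<eta>]] by simp

lemma lp_norm_eq_0:
  assumes "1 \<le> p" "\<xi> \<in> lp G p" "lp_norm G p \<xi> = 0"
  shows "\<xi> = (\<lambda>x. 0)"
  using cmod_le_lp_norm[OF assms(1,2)] assms(3) by auto

lemma Metric_space_lp:
  assumes p: "1 \<le> p"
  shows "Metric_space (lp G p) (\<lambda>\<xi> \<eta>. lp_norm G p (\<lambda>x. \<xi> x - \<eta> x))"
proof
  fix \<xi> \<eta> assume "\<xi> \<in> lp G p" "\<eta> \<in> lp G p"
  then show "lp_norm G p (\<lambda>x. \<xi> x - \<eta> x) = 0 \<longleftrightarrow> \<xi> = \<eta>"
    using lp_norm_eq_0[OF p lp_diff(1)[OF p, of \<xi> G \<eta>]] by (auto simp: fun_eq_iff)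
qed (rule lp_norm_nonneg lp_norm_commute lp_norm_triangle_diff[OF p]; assumption)+

lemma lp_complete:
  assumes p: "1 \<le> p" and s: "\<And>n::nat. s n \<in> lp G p"
    and cauchy: "\<And>e. 0 < e \<Longrightarrow> \<exists>N. \<forall>m\<ge>N. \<forall>n\<ge>N. lp_norm G p (\<lambda>x. s m x - s n x) < e"
  obtains \<xi> where "\<xi> \<in> lp G p" "(\<lambda>n. lp_norm G p (\<lambda>x. s n x - \<xi> x)) \<longlonglongrightarrow> 0"
proof -
  define \<xi> where "\<xi> = (\<lambda>x. lim (\<lambda>n. s n x))"
  have "Cauchy (\<lambda>n. s n x)" for x
    unfolding Cauchy_def dist_norm
    using cauchy cmod_le_lp_norm[OF p lp_diff(1)[OF p s s]] by (meson le_less_trans)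
  then have \<xi>: "(\<lambda>n. s n x) \<longlonglongrightarrow> \<xi> x" for x
    by (simp add: Cauchy_convergent_iff convergent_LIMSEQ_iff \<xi>_def)
  have out: "\<xi> x = 0" if "x \<notin> carrier G" for x
    using \<xi>[of x] lp_outside[OF s that] by (simp add: LIMSEQ_const_iff)
  \<comment> \<open>Fatou's lemma in elementary form: for a fixed finite F the bound passes to the
    pointwise limit in m, and F is arbitrary afterwards.\<close>
  have lim: "(\<lambda>x. s n x - \<xi> x) \<in> lp G p \<and> lp_norm G p (\<lambda>x. s n x - \<xi> x) \<le> e"
    if N: "\<And>m. m \<ge> N \<Longrightarrow> lp_norm G p (\<lambda>x. s n x - s m x) \<le> e" for n N e
  proof -
    have e: "0 \<le> e" using N[of N] lp_norm_nonneg order_trans by blast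
    have "(\<Sum>x\<in>F. cmod (s n x - \<xi> x) powr p) \<le> e powr p" if F: "finite F" "F \<subseteq> carrier G" for F
    proof (rule LIMSEQ_le_const2)
      show "(\<lambda>m. \<Sum>x\<in>F. cmod (s n x - s m x) powr p) \<longlonglongrightarrow> (\<Sum>x\<in>F. cmod (s n x - \<xi> x) powr p)"
        using p by (intro tendsto_sum tendsto_powr2 tendsto_norm tendsto_diff tendsto_const \<xi>) auto
      have "(\<Sum>x\<in>F. cmod (s n x - s m x) powr p) \<le> e powr p" if "m \<ge> N" for m
      proof -
        have "(\<Sum>x\<in>F. cmod (s n x - s m x) powr p) \<le> lp_norm G p (\<lambda>x. s n x - s m x) powr p"
          by (intro sum_le_lp_norm[OF p] lp_diff p s F)
        also have "\<dots> \<le> e powr p" using p N[OF that] by (intro powr_mono2) auto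
        finally show ?thesis .
      qed
      then show "\<exists>N. \<forall>m\<ge>N. (\<Sum>x\<in>F. cmod (s n x - s m x) powr p) \<le> e powr p" by blast
    qed
    then show ?thesis
      using lpI[OF p, of G "\<lambda>x. s n x - \<xi> x" e] e out lp_outside[OF s] by auto
  qed
  have lim2: "\<exists>N. \<forall>n\<ge>N. (\<lambda>x. s n x - \<xi> x) \<in> lp G p \<and> lp_norm G p (\<lambda>x. s n x - \<xi> x) \<le> e" if e: "0 < e" for e
  proof -
    obtain N where "\<forall>m\<ge>N. \<forall>n\<ge>N. lp_norm G p (\<lambda>x. s m x - s n x) < e" using cauchy[OF e] by blast
    then show ?thesis using lim[of N _ e] less_imp_le by blast
  qed
  obtain N where "(\<lambda>x. s N x - \<xi> x) \<in> lp G p" using lim2[of 1] by auto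
  from lp_diff(1)[OF p s[of N] this] have "\<xi> \<in> lp G p" by simp
  moreover have "(\<lambda>n. lp_norm G p (\<lambda>x. s n x - \<xi> x)) \<longlonglongrightarrow> 0"
    unfolding lim_sequentially
  proof (intro allI impI)
    fix r :: real assume "0 < r"
    then obtain N where "\<forall>n\<ge>N. lp_norm G p (\<lambda>x. s n x - \<xi> x) \<le> r/2" using lim2[of "r/2"] by auto
    then show "\<exists>no. \<forall>n\<ge>no. dist (lp_norm G p (\<lambda>x. s n x - \<xi> x)) 0 < r"
      using \<open>0 < r\<close> by (intro exI[of _ N]) force
  qed
  ultimately show ?thesis by (rule that)
qed


lemma mcomplete_lp:
  assumes p: "1 \<le> p"
  shows "Metric_space.mcomplete (lp G p) (\<lambda>\<xi> \<eta>. lp_norm G p (\<lambda>x. \<xi> x - \<eta> x))"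
proof -
  interpret Metric_space "lp G p" "\<lambda>\<xi> \<eta>. lp_norm G p (\<lambda>x. \<xi> x - \<eta> x)"
    by (rule Metric_space_lp[OF p])
  show ?thesis
    unfolding mcomplete_def
  proof (intro allI impI)
    fix s assume "MCauchy s"
    then have "range s \<subseteq> lp G p"
      unfolding MCauchy_def by (rule conjunct1)
    then have s: "s n \<in> lp G p" for n by blast
    have c: "\<exists>N. \<forall>m\<ge>N. \<forall>n\<ge>N. lp_norm G p (\<lambda>x. s m x - s n x) < e" if "0 < e" for e
      using conjunct2[OF \<open>MCauchy s\<close>[unfolded MCauchy_def]] that by meson
    obtain \<xi> where "\<xi> \<in> lp G p" "(\<lambda>n. lp_norm G p (\<lambda>x. s n x - \<xi> x)) \<longlonglongrightarrow> 0"
      by (rule lp_complete[OF p s c])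
    then show "\<exists>x. limitin mtopology s x sequentially"
      using s by (auto simp: limitin_metric_dist_null)
  qed
qed


lemma lp_restrict_approx:
  assumes p: "1 \<le> p" and \<xi>: "\<xi> \<in> lp G p" and e: "0 < e"
  obtains F where "finite F" "F \<subseteq> carrier G"
    "lp_norm G p (\<lambda>x. \<xi> x - (if x \<in> F then \<xi> x else 0)) \<le> e"
proof -
  obtain F where F: "finite F" "F \<subseteq> carrier G"
    and ap: "dist (\<Sum>x\<in>F. cmod (\<xi> x) powr p) (\<Sum>\<^sub>\<infinity>x\<in>carrier G. cmod (\<xi> x) powr p) \<le> e powr p"
    using infsum_finite_approximation[OF lp_summable[OF \<xi>], of "e powr p"] e by auto
  have sum_le: "(\<Sum>x\<in>E. cmod (\<xi> x - (if x \<in> F then \<xi> x else 0)) powr p) \<le> e powr p"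
    if E: "finite E" "E \<subseteq> carrier G" for E
  proof -
    have "(\<Sum>x\<in>E. cmod (\<xi> x - (if x \<in> F then \<xi> x else 0)) powr p) = (\<Sum>x\<in>E - F. cmod (\<xi> x) powr p)"
      using E by (intro sum.mono_neutral_cong_right) auto
    moreover have "(\<Sum>x\<in>E - F. cmod (\<xi> x) powr p) + (\<Sum>x\<in>F. cmod (\<xi> x) powr p)
        = (\<Sum>x\<in>E \<union> F. cmod (\<xi> x) powr p)"
      using E F sum.union_disjoint[of "E - F" F "\<lambda>x. cmod (\<xi> x) powr p"]
      by (simp add: Int_commute)
    moreover have "\<dots> \<le> (\<Sum>\<^sub>\<infinity>x\<in>carrier G. cmod (\<xi> x) powr p)"
      using E F by (intro finite_sum_le_infsum lp_summable[OF \<xi>]) auto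
    ultimately show ?thesis using ap unfolding dist_real_def by linarith
  qed
  have "lp_norm G p (\<lambda>x. \<xi> x - (if x \<in> F then \<xi> x else 0)) \<le> e"
  proof (rule lpI(2)[OF p _ less_imp_le[OF e] sum_le])
    show "\<xi> x - (if x \<in> F then \<xi> x else 0) = 0" if "x \<notin> carrier G" for x
      using lp_outside[OF \<xi> that] by simp
  qed
  from that[OF F this] show ?thesis .
qed

lemma lp_finite_support:
  assumes "finite F" "F \<subseteq> carrier G" "\<And>x. x \<notin> F \<Longrightarrow> \<xi> x = 0"
  shows "\<xi> \<in> lp G p" and "1 \<le> p \<Longrightarrow> lp_norm G p \<xi> powr p = (\<Sum>x\<in>F. cmod (\<xi> x) powr p)"
proof -
  have "(\<lambda>x. cmod (\<xi> x) powr p) summable_on carrier G \<longleftrightarrow> (\<lambda>x. cmod (\<xi> x) powr p) summable_on F"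
    by (rule summable_on_cong_neutral) (use assms(2,3) in auto)
  moreover have "\<forall>x. x \<notin> carrier G \<longrightarrow> \<xi> x = 0"
    using assms(2,3) by blast
  ultimately show "\<xi> \<in> lp G p" using assms(1) by (simp add: lp_def)
  have "(\<Sum>\<^sub>\<infinity>x\<in>carrier G. cmod (\<xi> x) powr p) = (\<Sum>\<^sub>\<infinity>x\<in>F. cmod (\<xi> x) powr p)"
    by (rule infsum_cong_neutral) (use assms(2,3) in auto)
  then show "1 \<le> p \<Longrightarrow> lp_norm G p \<xi> powr p = (\<Sum>x\<in>F. cmod (\<xi> x) powr p)"
    using assms(1) by (simp add: lp_norm_powr)
qed

text \<open>Values are bounded by the norm, so |\<xi>|^q is at most a constant times |\<xi>|^p. The
  inclusion serves both cases of the final split: l^2 into l^p for 2 \<le> p, and l^p into l^2 for p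
  < 2.\<close>

lemma lp_mono:
  assumes p: "1 \<le> p" "p \<le> q" and \<xi>: "\<xi> \<in> lp G p"
  shows "\<xi> \<in> lp G q"
proof -
  define B where "B = lp_norm G p \<xi>"
  have B: "cmod (\<xi> x) \<le> B" for x using cmod_le_lp_norm[OF p(1) \<xi>] by (simp add: B_def)
  have le: "cmod (\<xi> x) powr q \<le> B powr (q - p) * cmod (\<xi> x) powr p" for x
  proof -
    have "cmod (\<xi> x) powr q = cmod (\<xi> x) powr (q - p) * cmod (\<xi> x) powr p"
      by (simp flip: powr_add)
    also have "\<dots> \<le> B powr (q - p) * cmod (\<xi> x) powr p"
      using p B by (intro mult_right_mono powr_mono2) auto
    finally show ?thesis .
  qed
  have "(\<lambda>x. B powr (q - p) * cmod (\<xi> x) powr p) summable_on carrier G"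
    by (intro summable_on_cmult_right lp_summable[OF \<xi>])
  then have "(\<lambda>x. cmod (\<xi> x) powr q) summable_on carrier G"
    by (rule summable_on_comparison_test) (simp_all add: le)
  then show ?thesis using lp_outside[OF \<xi>] by (simp add: lp_def)
qed

section \<open>Convolution by summable functions\<close>

lemma has_sum_finite_sum:
  fixes f :: "'i \<Rightarrow> 'j \<Rightarrow> 'c::topological_comm_monoid_add"
  assumes "finite F" and "\<And>i. i \<in> F \<Longrightarrow> (f i has_sum s i) A"
  shows "((\<lambda>x. \<Sum>i\<in>F. f i x) has_sum (\<Sum>i\<in>F. s i)) A"
  using assms by (induction F rule: finite_induct) (auto intro: has_sum_add)

text \<open>The tangent at the weighted mean B / A, summed against w. The power p - 1 of the total
  mass appears because the weights are not normalised.\<close>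

lemma infsum_jensen:
  fixes w t :: "'i \<Rightarrow> real"
  assumes p: "1 \<le> p" and w: "\<And>i. i \<in> X \<Longrightarrow> 0 \<le> w i" and t: "\<And>i. i \<in> X \<Longrightarrow> 0 \<le> t i"
    and sw: "w summable_on X" and swt: "(\<lambda>i. w i * t i) summable_on X"
    and swp: "(\<lambda>i. w i * t i powr p) summable_on X"
  shows "(\<Sum>\<^sub>\<infinity>i\<in>X. w i * t i) powr p \<le> (\<Sum>\<^sub>\<infinity>i\<in>X. w i) powr (p - 1) * (\<Sum>\<^sub>\<infinity>i\<in>X. w i * t i powr p)"
proof (cases "(\<Sum>\<^sub>\<infinity>i\<in>X. w i) = 0")
  case True
  then have "w i = 0" if "i \<in> X" for i
    using nonneg_infsum_le_0D[OF _ sw w that] by auto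
  then have "(\<Sum>\<^sub>\<infinity>i\<in>X. w i * t i) = 0" by (simp add: infsum_0)
  then show ?thesis using True by simp
next
  case False
  define A where "A = (\<Sum>\<^sub>\<infinity>i\<in>X. w i)"
  define B where "B = (\<Sum>\<^sub>\<infinity>i\<in>X. w i * t i)"
  define u where "u = B / A"
  have A: "0 < A" using False w by (simp add: A_def infsum_nonneg order_less_le)
  have B: "0 \<le> B" using w t by (auto simp: B_def intro!: infsum_nonneg)
  have u: "0 \<le> u" using A B by (simp add: u_def)
  have hs: "((\<lambda>i. (u powr p - p * u powr (p - 1) * u) * w i + p * u powr (p - 1) * (w i * t i)) has_sum
      ((u powr p - p * u powr (p - 1) * u) * A + p * u powr (p - 1) * B)) X"
    unfolding A_def B_def using sw swt by (intro has_sum_add has_sum_cmult_right) auto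
  have "(u powr p - p * u powr (p - 1) * u) * A + p * u powr (p - 1) * B
      \<le> (\<Sum>\<^sub>\<infinity>i\<in>X. w i * t i powr p)"
  proof (rule has_sum_mono[OF hs])
    show "((\<lambda>i. w i * t i powr p) has_sum (\<Sum>\<^sub>\<infinity>i\<in>X. w i * t i powr p)) X" using swp by simp
    show "(u powr p - p * u powr (p - 1) * u) * w i + p * u powr (p - 1) * (w i * t i) \<le> w i * t i powr p"
      if "i \<in> X" for i
      using mult_left_mono[OF powr_tangent[OF p t[OF that] u] w[OF that]] by (simp add: algebra_simps)
  qed
  also have "(u powr p - p * u powr (p - 1) * u) * A + p * u powr (p - 1) * B = u powr p * A"
    using A by (simp add: u_def field_simps)
  finally have *: "u powr p * A \<le> (\<Sum>\<^sub>\<infinity>i\<in>X. w i * t i powr p)" .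
  have "B powr p = A powr p * u powr p"
    using A B by (simp add: u_def powr_divide)
  also have "\<dots> = A powr (p - 1) * (u powr p * A)"
    using A by (simp add: powr_diff)
  also have "\<dots> \<le> A powr (p - 1) * (\<Sum>\<^sub>\<infinity>i\<in>X. w i * t i powr p)"
    using * by (intro mult_left_mono) auto
  finally show ?thesis by (simp add: A_def B_def)
qed

text \<open>Tonelli's criterion with an explicit majorant for the inner sums; it licenses the
  exchanges of infinite sums below.\<close>

lemma abs_summable_on_TimesI:
  fixes f :: "'i \<Rightarrow> 'j \<Rightarrow> complex"
  assumes "\<And>x. x \<in> X \<Longrightarrow> f x abs_summable_on Y"
    and "\<And>x. x \<in> X \<Longrightarrow> (\<Sum>\<^sub>\<infinity>y\<in>Y. cmod (f x y)) \<le> w x" and "w summable_on X"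
  shows "(\<lambda>(x, y). f x y) summable_on X \<times> Y"
proof (rule abs_summable_summable)
  have "(\<lambda>x. norm (\<Sum>\<^sub>\<infinity>y\<in>Y. cmod (f x y))) summable_on X"
    by (rule Infinite_Sum.abs_summable_on_comparison_test'[OF assms(3)]) (use assms(2) in \<open>simp add: infsum_nonneg\<close>)
  then show "(\<lambda>(x, y). f x y) abs_summable_on X \<times> Y"
    by (subst Infinite_Sum.abs_summable_on_Sigma_iff) (use assms(1) in simp)
qed

text \<open>Left and right convolution by \<open>a\<close> are the cases \<open>\<tau> g h = g\<inverse> h\<close> and \<open>\<tau> g h = h g\<inverse>\<close>.\<close>

definition conv_along ::
    "('a, 'b) monoid_scheme \<Rightarrow> ('a \<Rightarrow> 'a \<Rightarrow> 'a) \<Rightarrow> ('a \<Rightarrow> complex) \<Rightarrow> ('a \<Rightarrow> complex) \<Rightarrow> ('a \<Rightarrow> complex)" where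
  "conv_along G \<tau> a \<xi> = (\<lambda>h. if h \<in> carrier G then (\<Sum>\<^sub>\<infinity>g\<in>carrier G. a g * \<xi> (\<tau> g h)) else 0)"

text \<open>What the norm estimates rest on: each single shift permutes the group and so preserves
  l^p norms. Relations between shifts enter only as hypotheses of \<open>conv_along_commute\<close>
  and \<open>conv_along_transpose\<close>.\<close>

definition permutes_carrier :: "('a, 'b) monoid_scheme \<Rightarrow> ('a \<Rightarrow> 'a \<Rightarrow> 'a) \<Rightarrow> bool" where
  "permutes_carrier G \<tau> \<longleftrightarrow> (\<forall>g\<in>carrier G. bij_betw (\<tau> g) (carrier G) (carrier G))"

lemma permutes_carrierD:
  assumes "permutes_carrier G \<tau>" "g \<in> carrier G"
  shows "bij_betw (\<tau> g) (carrier G) (carrier G)"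
  using assms by (simp add: permutes_carrier_def)

lemma l1_summable:
  assumes "a \<in> lp G 1"
  shows "(\<lambda>g. cmod (a g)) summable_on carrier G" "lp_norm G 1 a = (\<Sum>\<^sub>\<infinity>g\<in>carrier G. cmod (a g))"
  using assms by (auto simp: lp_def lp_norm_def infsum_nonneg)

lemma l1_mult_bounded_abs_summable:
  assumes a: "a \<in> lp G 1" and N: "\<And>g. g \<in> carrier G \<Longrightarrow> cmod (f g) \<le> N"
  shows "(\<lambda>g. a g * f g) abs_summable_on carrier G"
    and "(\<Sum>\<^sub>\<infinity>g\<in>carrier G. cmod (a g * f g)) \<le> lp_norm G 1 a * N"
proof -
  have s: "(\<lambda>g. cmod (a g) * N) summable_on carrier G"
    by (intro summable_on_cmult_left l1_summable a)
  have le: "cmod (a g * f g) \<le> cmod (a g) * N" if "g \<in> carrier G" for g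
    using N[OF that] by (simp add: norm_mult mult_left_mono)
  show 1: "(\<lambda>g. a g * f g) abs_summable_on carrier G"
    by (rule Infinite_Sum.abs_summable_on_comparison_test'[OF s le])
  have "(\<Sum>\<^sub>\<infinity>g\<in>carrier G. cmod (a g * f g)) \<le> (\<Sum>\<^sub>\<infinity>g\<in>carrier G. cmod (a g) * N)"
    by (rule infsum_mono[OF 1 s le])
  then show "(\<Sum>\<^sub>\<infinity>g\<in>carrier G. cmod (a g * f g)) \<le> lp_norm G 1 a * N"
    by (simp add: infsum_cmult_left' l1_summable[OF a])
qed

context
  fixes G :: "('a, 'b) monoid_scheme" and p :: real and \<tau> :: "'a \<Rightarrow> 'a \<Rightarrow> 'a" and a :: "'a \<Rightarrow> complex"
  assumes p: "1 \<le> p" and \<tau>: "permutes_carrier G \<tau>" and a: "a \<in> lp G 1"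
begin

lemma conv_along_abs_summable:
  assumes \<xi>: "\<xi> \<in> lp G p"
  shows "(\<lambda>g. a g * \<xi> (\<tau> g h)) abs_summable_on carrier G"
  by (rule l1_mult_bounded_abs_summable[OF a cmod_le_lp_norm[OF p \<xi>]])

text \<open>Young's inequality for l^1 acting on l^p. Jensen with weights |a g| bounds each value;
  after summing over a finite set of h every shift contributes at most N^p, and A^(p-1) * A gives
  A^p.\<close>

lemma conv_along_lp:
  assumes \<xi>: "\<xi> \<in> lp G p"
  shows "conv_along G \<tau> a \<xi> \<in> lp G p"
    and "lp_norm G p (conv_along G \<tau> a \<xi>) \<le> lp_norm G 1 a * lp_norm G p \<xi>"
proof -
  define A where "A = lp_norm G 1 a"
  define N where "N = lp_norm G p \<xi>"
  have A: "A = (\<Sum>\<^sub>\<infinity>g\<in>carrier G. cmod (a g))" by (simp add: A_def l1_summable[OF a])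
  have A0: "0 \<le> A" "0 \<le> N" by (simp_all add: A_def N_def)
  have sp: "(\<lambda>g. cmod (a g) * cmod (\<xi> (\<tau> g h)) powr p) summable_on carrier G" for h
  proof (rule summable_on_comparison_test)
    show "(\<lambda>g. cmod (a g) * N powr p) summable_on carrier G"
      by (intro summable_on_cmult_left l1_summable a)
    show "cmod (a g) * cmod (\<xi> (\<tau> g h)) powr p \<le> cmod (a g) * N powr p" for g
      using p cmod_le_lp_norm[OF p \<xi>] by (intro mult_left_mono powr_mono2) (auto simp: N_def)
  qed auto
  have pw: "cmod (conv_along G \<tau> a \<xi> h) powr p
      \<le> A powr (p - 1) * (\<Sum>\<^sub>\<infinity>g\<in>carrier G. cmod (a g) * cmod (\<xi> (\<tau> g h)) powr p)"
    if h: "h \<in> carrier G" for h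
  proof -
    have s: "(\<lambda>g. cmod (a g) * cmod (\<xi> (\<tau> g h))) summable_on carrier G"
      using conv_along_abs_summable[OF \<xi>, of h] by (simp add: norm_mult)
    have "cmod (conv_along G \<tau> a \<xi> h) \<le> (\<Sum>\<^sub>\<infinity>g\<in>carrier G. cmod (a g) * cmod (\<xi> (\<tau> g h)))"
      using norm_infsum_bound[OF conv_along_abs_summable[OF \<xi>, of h]] h
      by (simp add: conv_along_def norm_mult)
    then have "cmod (conv_along G \<tau> a \<xi> h) powr p
        \<le> (\<Sum>\<^sub>\<infinity>g\<in>carrier G. cmod (a g) * cmod (\<xi> (\<tau> g h))) powr p"
      using p by (intro powr_mono2) auto
    also have "\<dots> \<le> A powr (p - 1) * (\<Sum>\<^sub>\<infinity>g\<in>carrier G. cmod (a g) * cmod (\<xi> (\<tau> g h)) powr p)"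
      unfolding A using p s sp l1_summable[OF a] by (intro infsum_jensen) auto
    finally show ?thesis .
  qed
  have fin: "(\<Sum>h\<in>F. cmod (conv_along G \<tau> a \<xi> h) powr p) \<le> (A * N) powr p"
    if F: "finite F" "F \<subseteq> carrier G" for F
  proof -
    have hs: "((\<lambda>g. \<Sum>h\<in>F. cmod (a g) * cmod (\<xi> (\<tau> g h)) powr p) has_sum
        (\<Sum>h\<in>F. \<Sum>\<^sub>\<infinity>g\<in>carrier G. cmod (a g) * cmod (\<xi> (\<tau> g h)) powr p)) (carrier G)"
      using F sp by (intro has_sum_finite_sum) auto
    have hs2: "((\<lambda>g. cmod (a g) * N powr p) has_sum (A * N powr p)) (carrier G)"
      unfolding A using l1_summable[OF a] by (intro has_sum_cmult_left) auto
    have le: "(\<Sum>h\<in>F. cmod (a g) * cmod (\<xi> (\<tau> g h)) powr p) \<le> cmod (a g) * N powr p"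
      if g: "g \<in> carrier G" for g
    proof -
      have inj: "inj_on (\<tau> g) F" and sub: "\<tau> g ` F \<subseteq> carrier G"
        using permutes_carrierD[OF \<tau> g] F by (auto simp: bij_betw_def inj_on_subset)
      have "(\<Sum>h\<in>F. cmod (\<xi> (\<tau> g h)) powr p) = (\<Sum>k\<in>\<tau> g ` F. cmod (\<xi> k) powr p)"
        using inj by (simp add: sum.reindex)
      also have "\<dots> \<le> N powr p"
        unfolding N_def using F sub by (intro sum_le_lp_norm[OF p \<xi>]) auto
      finally show ?thesis by (simp add: mult_left_mono flip: sum_distrib_left)
    qed
    have "(\<Sum>h\<in>F. cmod (conv_along G \<tau> a \<xi> h) powr p)
        \<le> (\<Sum>h\<in>F. A powr (p - 1) * (\<Sum>\<^sub>\<infinity>g\<in>carrier G. cmod (a g) * cmod (\<xi> (\<tau> g h)) powr p))"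
      using F pw by (intro sum_mono) auto
    also have "\<dots> \<le> A powr (p - 1) * (A * N powr p)"
      unfolding sum_distrib_left[symmetric] by (intro mult_left_mono has_sum_mono[OF hs hs2 le]) auto
    also have "\<dots> = (A * N) powr p"
      using A0 by (cases "A = 0") (auto simp: powr_mult powr_diff)
    finally show ?thesis .
  qed
  show "conv_along G \<tau> a \<xi> \<in> lp G p"
    by (rule lpI(1)[OF p _ _ fin]) (use A0 in \<open>auto simp: conv_along_def\<close>)
  show "lp_norm G p (conv_along G \<tau> a \<xi>) \<le> lp_norm G 1 a * lp_norm G p \<xi>"
    unfolding A_def[symmetric] N_def[symmetric]
    by (rule lpI(2)[OF p _ _ fin]) (use A0 in \<open>auto simp: conv_along_def\<close>)
qed

lemma conv_along_add:
  assumes \<xi>: "\<xi> \<in> lp G p" and \<eta>: "\<eta> \<in> lp G p"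
  shows "conv_along G \<tau> a (\<lambda>x. \<xi> x + \<eta> x) = (\<lambda>x. conv_along G \<tau> a \<xi> x + conv_along G \<tau> a \<eta> x)"
  using abs_summable_summable[OF conv_along_abs_summable[OF \<xi>]] abs_summable_summable[OF conv_along_abs_summable[OF \<eta>]]
  by (auto simp: conv_along_def fun_eq_iff distrib_left infsum_add)

lemma conv_along_scale:
  "conv_along G \<tau> a (\<lambda>x. c * \<xi> x) = (\<lambda>x. c * conv_along G \<tau> a \<xi> x)"
proof -
  have *: "a g * (c * \<xi> y) = c * (a g * \<xi> y)" for g y by simp
  show ?thesis unfolding conv_along_def * infsum_cmult_right' by auto
qed

lemma conv_along_diff:
  assumes \<xi>: "\<xi> \<in> lp G p" and \<eta>: "\<eta> \<in> lp G p"
  shows "conv_along G \<tau> a (\<lambda>x. \<xi> x - \<eta> x) = (\<lambda>x. conv_along G \<tau> a \<xi> x - conv_along G \<tau> a \<eta> x)"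
  using conv_along_add[OF \<xi> lp_scale[OF \<eta>, of "-1"]] conv_along_scale[of "-1" \<eta>] by simp

text \<open>Associativity for convolutions acting from opposite sides. Summability of
  \<open>a\<close> and \<open>b\<close> together with boundedness of \<xi> gives the absolute double
  summability for Fubini.\<close>

lemma conv_along_commute:
  assumes \<sigma>: "permutes_carrier G \<sigma>" and b: "b \<in> lp G 1" and \<xi>: "\<xi> \<in> lp G p"
    and comm: "\<And>g k h. g \<in> carrier G \<Longrightarrow> k \<in> carrier G \<Longrightarrow> h \<in> carrier G \<Longrightarrow> \<tau> g (\<sigma> k h) = \<sigma> k (\<tau> g h)"
  shows "conv_along G \<tau> a (conv_along G \<sigma> b \<xi>) = conv_along G \<sigma> b (conv_along G \<tau> a \<xi>)"
proof
  fix h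
  show "conv_along G \<tau> a (conv_along G \<sigma> b \<xi>) h = conv_along G \<sigma> b (conv_along G \<tau> a \<xi>) h"
  proof (cases "h \<in> carrier G")
    case h: True
    have mem: "\<tau> g h \<in> carrier G" "\<sigma> g h \<in> carrier G" if "g \<in> carrier G" for g
      using permutes_carrierD[OF \<tau> that] permutes_carrierD[OF \<sigma> that] h by (auto simp: bij_betw_def)
    let ?f = "\<lambda>g k. a g * (b k * \<xi> (\<sigma> k (\<tau> g h)))"
    have sum: "(\<lambda>(g, k). ?f g k) summable_on carrier G \<times> carrier G"
    proof (rule abs_summable_on_TimesI)
      fix g
      have 1: "(\<lambda>k. b k * \<xi> (\<sigma> k (\<tau> g h))) abs_summable_on carrier G"
        and 2: "(\<Sum>\<^sub>\<infinity>k\<in>carrier G. cmod (b k * \<xi> (\<sigma> k (\<tau> g h)))) \<le> lp_norm G 1 b * lp_norm G p \<xi>"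
        by (rule l1_mult_bounded_abs_summable[OF b cmod_le_lp_norm[OF p \<xi>]])+
      show "?f g abs_summable_on carrier G"
        using summable_on_cmult_right[OF 1, of "cmod (a g)"] by (simp add: norm_mult)
      show "(\<Sum>\<^sub>\<infinity>k\<in>carrier G. cmod (?f g k)) \<le> cmod (a g) * (lp_norm G 1 b * lp_norm G p \<xi>)"
        using mult_left_mono[OF 2, of "cmod (a g)"] by (simp add: norm_mult infsum_cmult_right')
    qed (intro summable_on_cmult_left l1_summable a)
    have "conv_along G \<tau> a (conv_along G \<sigma> b \<xi>) h = (\<Sum>\<^sub>\<infinity>g\<in>carrier G. \<Sum>\<^sub>\<infinity>k\<in>carrier G. ?f g k)"
      using h mem by (auto simp: conv_along_def infsum_cmult_right' intro!: infsum_cong)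
    also have "\<dots> = (\<Sum>\<^sub>\<infinity>k\<in>carrier G. \<Sum>\<^sub>\<infinity>g\<in>carrier G. ?f g k)"
      by (rule infsum_swap_banach[OF sum])
    also have "\<dots> = (\<Sum>\<^sub>\<infinity>k\<in>carrier G. b k * (\<Sum>\<^sub>\<infinity>g\<in>carrier G. a g * \<xi> (\<tau> g (\<sigma> k h))))"
      using h mem comm by (auto simp: ac_simps simp flip: infsum_cmult_right' intro!: infsum_cong)
    also have "\<dots> = conv_along G \<sigma> b (conv_along G \<tau> a \<xi>) h"
      using h mem by (auto simp: conv_along_def intro!: infsum_cong)
    finally show ?thesis .
  qed (simp add: conv_along_def)
qed

end

section \<open>The bilinear pairing on l^2\<close>

lemma l2_norm_square: "(lp_norm G 2 \<xi>)\<^sup>2 = (\<Sum>\<^sub>\<infinity>x\<in>carrier G. (cmod (\<xi> x))\<^sup>2)"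
  using lp_norm_powr[of 2 G \<xi>] by simp

text \<open>A cheap substitute for Cauchy-Schwarz. The bound depends on the norms alone, hence is
  uniform over translates; this is what the double sum in \<open>conv_along_transpose\<close>
  requires.\<close>

lemma l2_mult_abs_summable:
  assumes \<xi>: "\<xi> \<in> lp G 2" and \<eta>: "\<eta> \<in> lp G 2"
  shows "(\<lambda>h. \<xi> h * \<eta> h) abs_summable_on carrier G"
    and "(\<Sum>\<^sub>\<infinity>h\<in>carrier G. cmod (\<xi> h * \<eta> h)) \<le> (lp_norm G 2 \<xi>)\<^sup>2 + (lp_norm G 2 \<eta>)\<^sup>2"
proof -
  have hs: "((\<lambda>h. cmod (\<zeta> h) ^ 2) has_sum (lp_norm G 2 \<zeta>)\<^sup>2) (carrier G)" if "\<zeta> \<in> lp G 2" for \<zeta>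
    using has_sum_infsum[OF lp_summable[OF that]] by (simp add: l2_norm_square)
  have hs2: "((\<lambda>h. cmod (\<xi> h) ^ 2 + cmod (\<eta> h) ^ 2) has_sum (lp_norm G 2 \<xi>)\<^sup>2 + (lp_norm G 2 \<eta>)\<^sup>2) (carrier G)"
    by (intro has_sum_add hs \<xi> \<eta>)
  have le: "cmod (\<xi> h * \<eta> h) \<le> cmod (\<xi> h) ^ 2 + cmod (\<eta> h) ^ 2" for h
  proof -
    have "2 * (cmod (\<xi> h) * cmod (\<eta> h)) \<le> cmod (\<xi> h) ^ 2 + cmod (\<eta> h) ^ 2"
      using sum_squares_bound[of "cmod (\<xi> h)" "cmod (\<eta> h)"] by simp
    moreover have "0 \<le> cmod (\<xi> h) * cmod (\<eta> h)" by simp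
    ultimately show ?thesis unfolding norm_mult by linarith
  qed
  show 1: "(\<lambda>h. \<xi> h * \<eta> h) abs_summable_on carrier G"
    by (rule Infinite_Sum.abs_summable_on_comparison_test'[OF has_sum_imp_summable[OF hs2] le])
  show "(\<Sum>\<^sub>\<infinity>h\<in>carrier G. cmod (\<xi> h * \<eta> h)) \<le> (lp_norm G 2 \<xi>)\<^sup>2 + (lp_norm G 2 \<eta>)\<^sup>2"
    by (rule has_sum_mono[OF has_sum_infsum[OF 1] hs2 le])
qed

lemma lp_reindex:
  assumes p: "1 \<le> p" and f: "bij_betw f (carrier G) (carrier G)" and \<xi>: "\<xi> \<in> lp G p"
  shows "(\<lambda>x. if x \<in> carrier G then \<xi> (f x) else 0) \<in> lp G p"
    and "lp_norm G p (\<lambda>x. if x \<in> carrier G then \<xi> (f x) else 0) = lp_norm G p \<xi>"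
proof -
  have "((\<lambda>x. cmod (if x \<in> carrier G then \<xi> (f x) else 0) powr p) summable_on carrier G) =
      ((\<lambda>x. cmod (\<xi> (f x)) powr p) summable_on carrier G)"
    by (intro summable_on_cong) auto
  also have "\<dots> = ((\<lambda>x. cmod (\<xi> x) powr p) summable_on carrier G)"
    by (rule summable_on_reindex_bij_betw[OF f])
  finally show "(\<lambda>x. if x \<in> carrier G then \<xi> (f x) else 0) \<in> lp G p"
    using lp_summable[OF \<xi>] by (simp add: lp_def)
  have "(\<Sum>\<^sub>\<infinity>x\<in>carrier G. cmod (if x \<in> carrier G then \<xi> (f x) else 0) powr p) =
      (\<Sum>\<^sub>\<infinity>x\<in>carrier G. cmod (\<xi> (f x)) powr p)"
    by (intro infsum_cong) auto
  also have "\<dots> = (\<Sum>\<^sub>\<infinity>x\<in>carrier G. cmod (\<xi> x) powr p)"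
    by (rule infsum_reindex_bij_betw[OF f])
  finally show "lp_norm G p (\<lambda>x. if x \<in> carrier G then \<xi> (f x) else 0) = lp_norm G p \<xi>"
    by (simp add: lp_norm_def)
qed

text \<open>After exchanging the sums, substitute \<sigma> g h for h, where \<sigma> g inverts
  \<tau> g. With a conjugation this yields the adjoint on l^2; with right convolution it yields
  associativity in \<open>left_right_inverse_eq\<close>.\<close>

lemma conv_along_transpose:
  assumes \<tau>: "permutes_carrier G \<tau>" and a: "a \<in> lp G 1" and \<xi>: "\<xi> \<in> lp G 2" and \<eta>: "\<eta> \<in> lp G 2"
    and inv: "\<And>g h. g \<in> carrier G \<Longrightarrow> h \<in> carrier G \<Longrightarrow> \<sigma> g h \<in> carrier G \<and> \<tau> g (\<sigma> g h) = h \<and> \<sigma> g (\<tau> g h) = h"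
  shows "(\<Sum>\<^sub>\<infinity>h\<in>carrier G. conv_along G \<tau> a \<xi> h * \<eta> h) = (\<Sum>\<^sub>\<infinity>h\<in>carrier G. \<xi> h * conv_along G \<sigma> a \<eta> h)"
proof -
  let ?f = "\<lambda>g h. a g * (\<xi> (\<tau> g h) * \<eta> h)"
  let ?h = "\<lambda>g h. a g * (\<xi> h * \<eta> (\<sigma> g h))"
  have bij: "bij_betw (\<sigma> g) (carrier G) (carrier G)" if "g \<in> carrier G" for g
  proof (rule bij_betw_byWitness[of _ "\<tau> g"])
    show "\<tau> g ` carrier G \<subseteq> carrier G" using permutes_carrierD[OF \<tau> that] by (simp add: bij_betw_def)
  qed (use inv that in auto)
  have sf: "(\<lambda>(g, h). ?f g h) summable_on carrier G \<times> carrier G"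
    and sh: "(\<lambda>(g, h). ?h g h) summable_on carrier G \<times> carrier G"
  proof -
    have *: "(\<lambda>(g, h). a g * (u g h * v g h)) summable_on carrier G \<times> carrier G"
      if u: "\<And>g. g \<in> carrier G \<Longrightarrow> u g \<in> lp G 2" "\<And>g. g \<in> carrier G \<Longrightarrow> lp_norm G 2 (u g) = N"
        and v: "\<And>g. g \<in> carrier G \<Longrightarrow> v g \<in> lp G 2" "\<And>g. g \<in> carrier G \<Longrightarrow> lp_norm G 2 (v g) = M" for u v N M
    proof (rule abs_summable_on_TimesI)
      fix g assume g: "g \<in> carrier G"
      note s = l2_mult_abs_summable[OF u(1)[OF g] v(1)[OF g]]
      show "(\<lambda>h. a g * (u g h * v g h)) abs_summable_on carrier G"
        using summable_on_cmult_right[OF s(1), of "cmod (a g)"] by (simp add: norm_mult)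
      show "(\<Sum>\<^sub>\<infinity>h\<in>carrier G. cmod (a g * (u g h * v g h))) \<le> cmod (a g) * (N\<^sup>2 + M\<^sup>2)"
        using mult_left_mono[OF s(2), of "cmod (a g)"] u(2)[OF g] v(2)[OF g] by (simp add: norm_mult infsum_cmult_right')
    qed (intro summable_on_cmult_left l1_summable a)
    have "(\<lambda>(g, h). a g * ((if h \<in> carrier G then \<xi> (\<tau> g h) else 0) * \<eta> h)) summable_on carrier G \<times> carrier G"
      by (rule *[OF lp_reindex[OF _ permutes_carrierD[OF \<tau>] \<xi>] \<eta> refl]) auto
    then show "(\<lambda>(g, h). ?f g h) summable_on carrier G \<times> carrier G"
      by (rule summable_on_cong[THEN iffD1, rotated]) auto
    have "(\<lambda>(g, h). a g * (\<xi> h * (if h \<in> carrier G then \<eta> (\<sigma> g h) else 0))) summable_on carrier G \<times> carrier G"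
      by (rule *[OF \<xi> refl lp_reindex[OF _ bij \<eta>]]) auto
    then show "(\<lambda>(g, h). ?h g h) summable_on carrier G \<times> carrier G"
      by (rule summable_on_cong[THEN iffD1, rotated]) auto
  qed
  have "(\<Sum>\<^sub>\<infinity>h\<in>carrier G. conv_along G \<tau> a \<xi> h * \<eta> h) = (\<Sum>\<^sub>\<infinity>h\<in>carrier G. \<Sum>\<^sub>\<infinity>g\<in>carrier G. ?f g h)"
    by (intro infsum_cong) (auto simp: conv_along_def ac_simps simp flip: infsum_cmult_right' intro!: infsum_cong)
  also have "\<dots> = (\<Sum>\<^sub>\<infinity>g\<in>carrier G. \<Sum>\<^sub>\<infinity>h\<in>carrier G. ?f g h)"
    by (rule infsum_swap_banach[OF sf, symmetric])
  also have "\<dots> = (\<Sum>\<^sub>\<infinity>g\<in>carrier G. \<Sum>\<^sub>\<infinity>h\<in>carrier G. ?h g h)"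
  proof (rule infsum_cong)
    fix g assume g: "g \<in> carrier G"
    have "(\<Sum>\<^sub>\<infinity>h\<in>carrier G. ?f g h) = (\<Sum>\<^sub>\<infinity>h\<in>carrier G. ?f g (\<sigma> g h))"
      by (rule infsum_reindex_bij_betw[OF bij[OF g], symmetric])
    also have "\<dots> = (\<Sum>\<^sub>\<infinity>h\<in>carrier G. ?h g h)"
      using inv g by (intro infsum_cong) auto
    finally show "(\<Sum>\<^sub>\<infinity>h\<in>carrier G. ?f g h) = (\<Sum>\<^sub>\<infinity>h\<in>carrier G. ?h g h)" .
  qed
  also have "\<dots> = (\<Sum>\<^sub>\<infinity>h\<in>carrier G. \<Sum>\<^sub>\<infinity>g\<in>carrier G. ?h g h)"
    by (rule infsum_swap_banach[OF sh])
  also have "\<dots> = (\<Sum>\<^sub>\<infinity>h\<in>carrier G. \<xi> h * conv_along G \<sigma> a \<eta> h)"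
    by (intro infsum_cong) (auto simp: conv_along_def ac_simps simp flip: infsum_cmult_right' intro!: infsum_cong)
  finally show ?thesis .
qed

section \<open>The open mapping theorem\<close>

text \<open>By Baire's theorem every \<open>y\<close> in the range is approximated, up to half its norm, by the image of a vector of
  comparable norm; summing the corrections solves \<open>T \<xi> = y\<close> with a norm bound.\<close>

lemma lp_bounded_below:
  assumes p: "1 \<le> p"
    and T: "\<And>\<xi>. \<xi> \<in> lp G p \<Longrightarrow> T \<xi> \<in> lp G p"
    and bdd: "\<And>\<xi>. \<xi> \<in> lp G p \<Longrightarrow> lp_norm G p (T \<xi>) \<le> C * lp_norm G p \<xi>"
    and add: "\<And>\<xi> \<eta>. \<xi> \<in> lp G p \<Longrightarrow> \<eta> \<in> lp G p \<Longrightarrow> T (\<lambda>x. \<xi> x + \<eta> x) = (\<lambda>x. T \<xi> x + T \<eta> x)"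
    and scale: "\<And>c \<xi>. \<xi> \<in> lp G p \<Longrightarrow> T (\<lambda>x. c * \<xi> x) = (\<lambda>x. c * T \<xi> x)"
    and inj: "inj_on T (lp G p)" and closed: "closed_subspace G p (T ` lp G p)"
  obtains c where "0 < c" "\<And>\<xi>. \<xi> \<in> lp G p \<Longrightarrow> c * lp_norm G p \<xi> \<le> lp_norm G p (T \<xi>)"
proof -
  define V where "V = lp G p"
  define N where "N = lp_norm G p"
  define M where "M = T ` V"
  have N0: "0 \<le> N \<xi>" for \<xi> by (simp add: N_def)
  have V_add: "(\<lambda>x. \<xi> x + \<eta> x) \<in> V" "N (\<lambda>x. \<xi> x + \<eta> x) \<le> N \<xi> + N \<eta>"
    and V_diff: "(\<lambda>x. \<xi> x - \<eta> x) \<in> V" "N (\<lambda>x. \<xi> x - \<eta> x) \<le> N \<xi> + N \<eta>" if "\<xi> \<in> V" "\<eta> \<in> V" for \<xi> \<eta>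
    using that lp_add[OF p] lp_diff[OF p] by (auto simp: V_def N_def)
  have V_scale: "(\<lambda>x. c * \<xi> x) \<in> V" if "\<xi> \<in> V" for c \<xi> using that lp_scale by (auto simp: V_def)
  have N_scale: "N (\<lambda>x. c * \<xi> x) = cmod c * N \<xi>" for c \<xi> by (simp add: N_def lp_norm_scale[OF p])
  have T_diff: "T (\<lambda>x. \<xi> x - \<eta> x) = (\<lambda>x. T \<xi> x - T \<eta> x)" if "\<xi> \<in> V" "\<eta> \<in> V" for \<xi> \<eta>
    using add[of \<xi> "\<lambda>x. -1 * \<eta> x"] scale[of \<eta> "-1"] lp_scale[of \<eta> G p "-1"] that by (simp add: V_def)
  have TV: "T \<xi> \<in> V" if "\<xi> \<in> V" for \<xi> using T that by (simp add: V_def)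
  have MV: "M \<subseteq> V" using TV by (auto simp: M_def)
  have M_diff: "(\<lambda>x. y x - z x) \<in> M" if yz: "y \<in> M" "z \<in> M" for y z
  proof -
    obtain u v where "u \<in> V" "v \<in> V" "y = T u" "z = T v" using yz by (auto simp: M_def)
    then have "(\<lambda>x. y x - z x) = T (\<lambda>x. u x - v x)" "(\<lambda>x. u x - v x) \<in> V"
      using T_diff[of u v] V_diff(1)[of u v] by simp_all
    then show ?thesis unfolding M_def by (rule image_eqI)
  qed
  have M_scale: "(\<lambda>x. c * y x) \<in> M" if "y \<in> M" for c y
  proof -
    obtain u where "u \<in> V" "y = T u" using \<open>y \<in> M\<close> by (auto simp: M_def)
    then have "(\<lambda>x. c * y x) = T (\<lambda>x. c * u x)" "(\<lambda>x. c * u x) \<in> V"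
      using scale[of u c] V_scale[of u c] by (simp_all add: V_def)
    then show ?thesis unfolding M_def by (rule image_eqI)
  qed
  have M_add: "(\<lambda>x. y x + z x) \<in> M" if "y \<in> M" "z \<in> M" for y z
    using M_diff[OF that(1) M_scale[OF that(2), of "-1"]] by simp
  interpret V: Metric_space V "\<lambda>\<xi> \<eta>. N (\<lambda>x. \<xi> x - \<eta> x)"
    unfolding V_def N_def by (rule Metric_space_lp[OF p])
  interpret M: Submetric V "\<lambda>\<xi> \<eta>. N (\<lambda>x. \<xi> x - \<eta> x)" M
    by unfold_locales (rule MV)
  \<comment> \<open>Closedness makes the range itself complete, so that Baire's theorem can be
    applied inside it.\<close>
  have "closedin V.mtopology M"
    unfolding V.metric_closedin_iff_sequentially_closed
  proof (intro conjI MV allI impI)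
    fix s l assume "range s \<subseteq> M \<and> limitin V.mtopology s l sequentially"
    then have "l \<in> V" "\<And>n. s n \<in> M" "(\<lambda>n. N (\<lambda>x. s n x - l x)) \<longlonglongrightarrow> 0"
      by (auto simp: V.limitin_metric_dist_null)
    then show "l \<in> M"
      using closed unfolding closed_subspace_def M_def V_def N_def by blast
  qed
  moreover have "V.mcomplete"
    using mcomplete_lp[OF p, of G] by (simp add: V_def N_def)
  ultimately have Mcomplete: "M.sub.mcomplete"
    by (simp add: M.closedin_eq_mcomplete)
  \<comment> \<open>Images of balls. Their closures cover the range, since every \<xi> has finite
    norm, so one of the closures has an interior point.\<close>
  define B where "B n = T ` {\<xi> \<in> V. N \<xi> \<le> real n}" for n
  have B_sub: "B n \<subseteq> M" for n by (auto simp: B_def M_def)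
  have zeroM: "(\<lambda>x. 0) \<in> M" using closed by (simp add: closed_subspace_def M_def V_def)
  have "(\<Union>n. M.sub.mtopology closure_of B n) = M"
  proof
    show "(\<Union>n. M.sub.mtopology closure_of B n) \<subseteq> M"
      using closure_of_subset_topspace[of M.sub.mtopology] by simp blast
    show "M \<subseteq> (\<Union>n. M.sub.mtopology closure_of B n)"
    proof
      fix y assume "y \<in> M"
      then obtain \<xi> where \<xi>: "\<xi> \<in> V" "y = T \<xi>" by (auto simp: M_def)
      obtain n where "N \<xi> \<le> real n" using real_arch_simple by blast
      then have "y \<in> B n" using \<xi> by (auto simp: B_def)
      moreover have "B n \<subseteq> M.sub.mtopology closure_of B n"
        by (rule closure_of_subset) (simp add: B_sub)
      ultimately show "y \<in> (\<Union>n. M.sub.mtopology closure_of B n)" by blast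
    qed
  qed
  then have ne: "M.sub.mtopology interior_of (\<Union>(range (\<lambda>n. M.sub.mtopology closure_of B n))) \<noteq> {}"
    using zeroM interior_of_topspace[of M.sub.mtopology] by auto
  have "\<exists>n. M.sub.mtopology interior_of (M.sub.mtopology closure_of B n) \<noteq> {}"
  proof (rule ccontr)
    assume *: "\<nexists>n. M.sub.mtopology interior_of (M.sub.mtopology closure_of B n) \<noteq> {}"
    have "M.sub.mtopology interior_of (\<Union>(range (\<lambda>n. M.sub.mtopology closure_of B n))) = {}"
      by (rule M.sub.metric_Baire_category_alt[OF Mcomplete]) (use * in auto)
    with ne show False by simp
  qed
  then obtain n where n: "M.sub.mtopology interior_of (M.sub.mtopology closure_of B n) \<noteq> {}" ..
  obtain y0 r where y0: "y0 \<in> M" and r: "0 < r"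
    and ball: "M.sub.mball y0 r \<subseteq> M.sub.mtopology closure_of B n"
  proof -
    obtain y0 where "y0 \<in> M.sub.mtopology interior_of (M.sub.mtopology closure_of B n)" using n by blast
    moreover have "openin M.sub.mtopology (M.sub.mtopology interior_of (M.sub.mtopology closure_of B n))" by simp

    ultimately obtain r where "0 < r" "M.sub.mball y0 r \<subseteq> M.sub.mtopology interior_of (M.sub.mtopology closure_of B n)" "y0 \<in> M"
      unfolding M.sub.openin_mtopology by blast
    then show ?thesis
      using subset_trans[OF _ interior_of_subset] by (intro that[of y0 r]) blast+
  qed
  have near: "\<exists>\<xi>\<in>V. N \<xi> \<le> real n \<and> N (\<lambda>x. y x - T \<xi> x) < e"
    if y: "y \<in> M" "N (\<lambda>x. y0 x - y x) < r" and e: "0 < e" for y e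
  proof -
    have "y \<in> M.sub.mtopology closure_of B n" using ball y y0 by (auto simp: M.sub.in_mball)
    then obtain b where "b \<in> B n" "N (\<lambda>x. y x - b x) < e"
      using e unfolding M.sub.metric_closure_of by (auto simp: M.sub.in_mball)
    then show ?thesis by (auto simp: B_def)
  qed
  \<comment> \<open>Scale y to length r / 2. Then y0 and y0 + t y both lie in the ball and are
    approximated within r / 8 by images of vectors of norm at most n. Subtracting and scaling back
    by 1 / t = 2 * N y / r gives norm at most 2 * n / t = K * N y and error at most (r / 4) / t = N
    y / 2.\<close>
  define K where "K = 4 * real n / r"
  have K0: "0 \<le> K" using r by (simp add: K_def)
  have half: "\<exists>\<xi>\<in>V. N \<xi> \<le> K * N y \<and> N (\<lambda>x. y x - T \<xi> x) \<le> N y / 2" if y: "y \<in> M" for y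
  proof (cases "N y = 0")
    case True
    then have "y = (\<lambda>x. 0)" using y MV lp_norm_eq_0[OF p, of y G] by (auto simp: V_def N_def)
    moreover have "T (\<lambda>x. 0) = (\<lambda>x. 0)" using scale[of "\<lambda>x. 0" 0] by simp
    ultimately show ?thesis
      using K0 by (intro bexI[of _ "\<lambda>x. 0"]) (auto simp: V_def N_def)
  next
    case False
    then have Ny: "0 < N y" using N0[of y] by simp
    define t where "t = r / (2 * N y)"
    have t: "0 < t" using r Ny by (simp add: t_def)
    then have ct: "cmod (complex_of_real (1/t)) = 1/t" unfolding norm_of_real by simp
    have "N (\<lambda>x. complex_of_real t * y x) = r / 2"
    proof -
      have "t * N y = r / 2" using Ny by (simp add: t_def)
      then show ?thesis using t by (simp only: N_scale) simp
    qed
    then have "N (\<lambda>x. y0 x - (y0 x + complex_of_real t * y x)) = r / 2"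
      using N_scale[of "-1" "\<lambda>x. complex_of_real t * y x"] by simp
    then obtain u where u: "u \<in> V" "N u \<le> real n" "N (\<lambda>x. (y0 x + complex_of_real t * y x) - T u x) < r / 8"
      using near[OF M_add[OF y0 M_scale[OF y, of "complex_of_real t"]], of "r/8"] r by auto
    obtain v where v: "v \<in> V" "N v \<le> real n" "N (\<lambda>x. y0 x - T v x) < r / 8"
      using near[OF y0, of "r/8"] r by (auto simp: N_def)
    define w where "w = (\<lambda>x. complex_of_real (1/t) * (u x - v x))"
    have wV: "w \<in> V" unfolding w_def by (intro V_scale V_diff u v)
    have "N w = (1/t) * N (\<lambda>x. u x - v x)" unfolding w_def N_scale ct ..
    also have "\<dots> \<le> (1/t) * (real n + real n)"
      using t V_diff(2)[OF u(1) v(1)] u(2) v(2) by (intro mult_left_mono) auto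
    also have "\<dots> = K * N y" using r Ny by (simp add: t_def K_def field_simps)
    finally have 1: "N w \<le> K * N y" .
    have Tw: "T w = (\<lambda>x. complex_of_real (1/t) * (T u x - T v x))"
      unfolding w_def using scale[of "\<lambda>x. u x - v x" "complex_of_real (1/t)"] V_diff(1)[OF u(1) v(1)] T_diff[OF u(1) v(1)]
      by (simp add: V_def)
    have "(\<lambda>x. y x - T w x) = (\<lambda>x. complex_of_real (1/t) * (((y0 x + complex_of_real t * y x) - T u x) - (y0 x - T v x)))"
      using t by (auto simp: Tw fun_eq_iff field_simps)
    then have "N (\<lambda>x. y x - T w x) = (1/t) * N (\<lambda>x. ((y0 x + complex_of_real t * y x) - T u x) - (y0 x - T v x))"
      by (simp only: N_scale ct)
    also have "\<dots> \<le> (1/t) * (r/8 + r/8)"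
    proof (intro mult_left_mono)
      have "(\<lambda>x. (y0 x + complex_of_real t * y x) - T u x) \<in> V" "(\<lambda>x. y0 x - T v x) \<in> V"
        using y0 y u v MV TV V_add V_diff V_scale by (auto simp: subset_iff)
      from V_diff(2)[OF this] u(3) v(3)
      show "N (\<lambda>x. ((y0 x + complex_of_real t * y x) - T u x) - (y0 x - T v x)) \<le> r/8 + r/8" by linarith
    qed (use t in auto)
    also have "\<dots> = N y / 2" using r Ny by (simp add: t_def field_simps)
    finally show ?thesis using 1 wV by blast
  qed
  then obtain S where S: "\<And>y. y \<in> M \<Longrightarrow> S y \<in> V" "\<And>y. y \<in> M \<Longrightarrow> N (S y) \<le> K * N y"
    "\<And>y. y \<in> M \<Longrightarrow> N (\<lambda>x. y x - T (S y) x) \<le> N y / 2"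
    by metis
  have main: "N \<xi> \<le> 2 * K * N (T \<xi>)" if \<xi>: "\<xi> \<in> V" for \<xi>
  proof -
    \<comment> \<open>R k is the residual T \<xi> - T (Z k) after k corrections, and Z k the sum of
      these corrections; the residuals halve, so the corrections are dominated by a geometric
      series.\<close>
    define R where "R k = ((\<lambda>y x. y x - T (S y) x) ^^ k) (T \<xi>)" for k
    define Z where "Z = rec_nat (\<lambda>x. 0) (\<lambda>k z x. z x + S (R k) x)"
    have R: "R 0 = T \<xi>" "R (Suc k) = (\<lambda>x. R k x - T (S (R k)) x)" for k by (auto simp: R_def)
    have Z: "Z 0 = (\<lambda>x. 0)" "Z (Suc k) = (\<lambda>x. Z k x + S (R k) x)" for k by (auto simp: Z_def)
    have RM: "R k \<in> M" for k
      by (induction k) (use \<xi> S(1) M_diff in \<open>auto simp: R M_def\<close>)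
    have RN: "N (R k) \<le> (1/2)^k * N (T \<xi>)" for k
    proof (induction k)
      case (Suc k) then show ?case using S(3)[OF RM[of k]] by (simp add: R)
    qed (simp add: R)
    have ZV: "Z k \<in> V" for k
      by (induction k) (use S(1)[OF RM] V_add in \<open>auto simp: Z, simp add: V_def\<close>)
    have TZ: "(\<lambda>x. T \<xi> x - T (Z k) x) = R k" for k
    proof (induction k)
      case 0
      have "T (\<lambda>x. 0) = (\<lambda>x. 0)" using scale[of "\<lambda>x. 0" 0] by simp
      then show ?case by (simp add: Z R)
    next
      case (Suc k)
      have "T (Z (Suc k)) = (\<lambda>x. T (Z k) x + T (S (R k)) x)"
        unfolding Z using add ZV[of k] S(1)[OF RM[of k]] by (simp add: V_def)
      then show ?case using Suc by (auto simp: R fun_eq_iff algebra_simps)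
    qed
    define D where "D = K * N (T \<xi>)"
    have step: "N (S (R k)) \<le> D * (1/2)^k" for k
      using S(2)[OF RM[of k]] mult_left_mono[OF RN[of k] K0] by (simp add: D_def mult_ac)
    have ZZ: "N (\<lambda>x. Z (m + j) x - Z m x) \<le> 2 * D * (1/2)^m - 2 * D * (1/2)^(m + j)" for m j
    proof (induction j)
      case (Suc j)
      have "N (\<lambda>x. Z (m + Suc j) x - Z m x) = N (\<lambda>x. (Z (m + j) x - Z m x) + S (R (m + j)) x)"
        by (simp add: Z algebra_simps)
      also have "\<dots> \<le> N (\<lambda>x. Z (m + j) x - Z m x) + N (S (R (m + j)))"
        by (intro V_add V_diff ZV S RM)
      also have "\<dots> \<le> 2 * D * (1/2)^m - 2 * D * (1/2)^(m + j) + D * (1/2)^(m + j)"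
        using Suc step[of "m + j"] by linarith
      finally show ?case by simp
    qed (simp add: N_def)
    have D0: "0 \<le> D" using K0 N0 by (simp add: D_def)
    have ZZ': "N (\<lambda>x. Z i x - Z m x) \<le> 2 * D * (1/2)^m" if "m \<le> i" for i m
      using ZZ[of m "i - m"] that D0 by (simp add: order_trans)
    have cau: "\<exists>N0. \<forall>m\<ge>N0. \<forall>k\<ge>N0. lp_norm G p (\<lambda>x. Z m x - Z k x) < e" if e: "0 < e" for e
    proof -
      have "(\<lambda>m. 2 * D * (1/2)^m) \<longlonglongrightarrow> 2 * D * 0"
        by (intro tendsto_mult tendsto_const LIMSEQ_power_zero) auto
      then have "eventually (\<lambda>m. 2 * D * (1/2)^m < e) sequentially"
        using e by (intro order_tendstoD(2)) simp_all
      then obtain N0 where N0: "\<And>m. m \<ge> N0 \<Longrightarrow> 2 * D * (1/2)^m < e"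
        unfolding eventually_sequentially by blast
      have "N (\<lambda>x. Z m x - Z k x) < e" if "m \<ge> N0" "k \<ge> N0" for m k
      proof (cases "k \<le> m")
        case True then show ?thesis using ZZ'[OF True] N0[OF that(2)] by linarith
      next
        case False
        then have "N (\<lambda>x. Z k x - Z m x) < e" using ZZ'[of m k] N0[OF that(1)] by simp
        then show ?thesis using lp_norm_commute[of G p "Z k" "Z m"] by (simp add: N_def)
      qed
      then show ?thesis unfolding N_def by blast
    qed
    obtain \<zeta> where \<zeta>: "\<zeta> \<in> lp G p" "(\<lambda>k. lp_norm G p (\<lambda>x. Z k x - \<zeta> x)) \<longlonglongrightarrow> 0"
      by (rule lp_complete[OF p ZV[unfolded V_def] cau])
    have \<zeta>V: "\<zeta> \<in> V" using \<zeta>(1) by (simp add: V_def)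
    have "N (\<lambda>x. T \<xi> x - T \<zeta> x) \<le> 0"
    proof (rule LIMSEQ_le_const)
      show "(\<lambda>k. (1/2)^k * N (T \<xi>) + C * N (\<lambda>x. Z k x - \<zeta> x)) \<longlonglongrightarrow> 0"
      proof -
        have "(\<lambda>k. (1/2)^k * N (T \<xi>) + C * N (\<lambda>x. Z k x - \<zeta> x)) \<longlonglongrightarrow> 0 * N (T \<xi>) + C * 0"
          unfolding N_def by (intro tendsto_add tendsto_mult tendsto_const LIMSEQ_power_zero \<zeta>) auto
        then show ?thesis by simp
      qed
      have "N (\<lambda>x. T \<xi> x - T \<zeta> x) \<le> (1/2)^k * N (T \<xi>) + C * N (\<lambda>x. Z k x - \<zeta> x)" for k
      proof -
        have "N (\<lambda>x. T \<xi> x - T \<zeta> x) \<le> N (\<lambda>x. T \<xi> x - T (Z k) x) + N (\<lambda>x. T (Z k) x - T \<zeta> x)"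
          using lp_norm_triangle_diff[OF p, of "T \<xi>" G "T (Z k)" "T \<zeta>"] TV \<xi> \<zeta>V ZV
          by (simp add: N_def V_def)
        also have "N (\<lambda>x. T \<xi> x - T (Z k) x) \<le> (1/2)^k * N (T \<xi>)" using RN by (simp add: TZ)
        also have "N (\<lambda>x. T (Z k) x - T \<zeta> x) \<le> C * N (\<lambda>x. Z k x - \<zeta> x)"
          using bdd[of "\<lambda>x. Z k x - \<zeta> x"] T_diff[OF ZV \<zeta>V, of k] V_diff(1)[OF ZV \<zeta>V, of k]
          by (simp add: N_def V_def)
        finally show ?thesis by simp
      qed
      then show "\<exists>N0. \<forall>k\<ge>N0. N (\<lambda>x. T \<xi> x - T \<zeta> x) \<le> (1/2)^k * N (T \<xi>) + C * N (\<lambda>x. Z k x - \<zeta> x)"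
        by blast
    qed
    then have "T \<xi> = T \<zeta>"
      using V.zero[OF TV[OF \<xi>] TV[OF \<zeta>V]] N0 by (simp add: antisym)
    \<comment> \<open>Injectivity identifies \<xi> with the limit of the Z k, so \<xi> inherits the
      bound of the geometric series.\<close>
    then have "\<xi> = \<zeta>" using inj \<xi> \<zeta>V by (auto simp: V_def inj_on_def)
    have "N \<xi> \<le> 2 * D"
    proof (rule LIMSEQ_le_const)
      show "(\<lambda>k. 2 * D + N (\<lambda>x. Z k x - \<zeta> x)) \<longlonglongrightarrow> 2 * D"
        using tendsto_add[OF tendsto_const \<zeta>(2), of "2 * D"] by (simp add: N_def)
      have "N \<xi> \<le> 2 * D + N (\<lambda>x. Z k x - \<zeta> x)" for k
        using lp_norm_le_diff[OF p, of \<xi> G "Z k"] \<xi> ZV[of k] ZZ'[of 0 k] \<open>\<xi> = \<zeta>\<close>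
          lp_norm_commute[of G p \<zeta> "Z k"]
        by (simp add: V_def N_def Z)
      then show "\<exists>N0. \<forall>k\<ge>N0. N \<xi> \<le> 2 * D + N (\<lambda>x. Z k x - \<zeta> x)" by blast
    qed
    then show ?thesis by (simp add: D_def)
  qed
  show ?thesis
  \<comment> \<open>The summand 1 guards against K = 0.\<close>
  proof (rule that[of "1 / (2 * K + 1)"])
    show "0 < 1 / (2 * K + 1)" using K0 by simp
    fix \<xi> assume "\<xi> \<in> lp G p"
    then have "N \<xi> \<le> 2 * K * N (T \<xi>)" using main by (simp add: V_def)
    also have "\<dots> \<le> (2 * K + 1) * N (T \<xi>)" using N0 by (intro mult_right_mono) auto
    finally show "1 / (2 * K + 1) * lp_norm G p \<xi> \<le> lp_norm G p (T \<xi>)"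
      using K0 by (simp add: N_def field_simps)
  qed
qed

section \<open>Amenability and almost invariant weights\<close>

lemma linf_realI:
  assumes "\<And>x. x \<notin> carrier G \<Longrightarrow> f x = 0" "\<And>x. x \<in> carrier G \<Longrightarrow> \<bar>f x\<bar> \<le> C"
  shows "f \<in> linf_real G"
  using assms by (auto simp: linf_real_def bounded_iff)

lemma linf_realE:
  assumes "f \<in> linf_real G"
  obtains C where "\<And>x. \<bar>f x\<bar> \<le> C" "0 \<le> C"
proof -
  obtain C where "\<And>x. x \<in> carrier G \<Longrightarrow> \<bar>f x\<bar> \<le> C" using assms by (auto simp: linf_real_def bounded_iff)
  moreover have "f x = 0" if "x \<notin> carrier G" for x using assms that by (auto simp: linf_real_def)
  ultimately have "\<bar>f x\<bar> \<le> max C 0" for x by (cases "x \<in> carrier G") (auto intro: max.coboundedI1)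
  then show ?thesis using that[of "max C 0"] by simp
qed

lemma linf_real_out: "f \<in> linf_real G \<Longrightarrow> x \<notin> carrier G \<Longrightarrow> f x = 0"
  by (simp add: linf_real_def)

lemma linf_real_add:
  assumes "f \<in> linf_real G" "h \<in> linf_real G"
  shows "(\<lambda>x. f x + h x) \<in> linf_real G"
proof -
  obtain C where C: "\<And>x. \<bar>f x\<bar> \<le> C" using linf_realE[OF assms(1)] by blast
  obtain D where D: "\<And>x. \<bar>h x\<bar> \<le> D" using linf_realE[OF assms(2)] by blast
  show ?thesis
  proof (rule linf_realI[where C="C + D"])
    show "\<bar>f x + h x\<bar> \<le> C + D" for x using C[of x] D[of x] by linarith
  qed (use assms in \<open>simp add: linf_real_out\<close>)
qed

lemma linf_real_scale:
  assumes "f \<in> linf_real G"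
  shows "(\<lambda>x. c * f x) \<in> linf_real G"
proof -
  obtain C where C: "\<And>x. \<bar>f x\<bar> \<le> C" using linf_realE[OF assms] by blast
  show ?thesis
  proof (rule linf_realI[where C="\<bar>c\<bar> * C"])
    show "\<bar>c * f x\<bar> \<le> \<bar>c\<bar> * C" for x using C[of x] by (simp add: abs_mult mult_left_mono)
  qed (use assms in \<open>simp add: linf_real_out\<close>)
qed

lemma linf_real_sum:
  assumes "finite I" "\<And>i. i \<in> I \<Longrightarrow> f i \<in> linf_real G"
  shows "(\<lambda>x. \<Sum>i\<in>I. f i x) \<in> linf_real G"
  using assms
proof (induction I rule: finite_induct)
  case empty then show ?case by (auto intro: linf_realI[where C=0])
qed (simp add: linf_real_add)

lemma linf_real_const: "(\<lambda>x. c * indicator (carrier G) x) \<in> linf_real G"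
  by (rule linf_real_scale, rule linf_realI[where C=1]) (auto simp: indicator_def)

context
  fixes G :: "('a, 'b) monoid_scheme" and m :: "('a \<Rightarrow> real) \<Rightarrow> real"
  assumes m: "left_invariant_mean G m"
begin

lemma mean_add: "f \<in> linf_real G \<Longrightarrow> h \<in> linf_real G \<Longrightarrow> m (\<lambda>x. f x + h x) = m f + m h"
  using m by (simp add: left_invariant_mean_def)

lemma mean_scale: "f \<in> linf_real G \<Longrightarrow> m (\<lambda>x. c * f x) = c * m f"
  using m by (simp add: left_invariant_mean_def)

lemma mean_shift: "g \<in> carrier G \<Longrightarrow> f \<in> linf_real G \<Longrightarrow>
    m (\<lambda>x. if x \<in> carrier G then f (inv\<^bsub>G\<^esub> g \<otimes>\<^bsub>G\<^esub> x) else 0) = m f"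
  using m by (simp add: left_invariant_mean_def)

lemma mean_const: "m (\<lambda>x. c * indicator (carrier G) x) = c"
  using mean_scale[OF linf_real_const[of 1 G], of c] m by (simp add: left_invariant_mean_def)

lemma mean_mono:
  assumes f: "f \<in> linf_real G" and h: "h \<in> linf_real G" and le: "\<And>x. x \<in> carrier G \<Longrightarrow> f x \<le> h x"
  shows "m f \<le> m h"
proof -
  have "0 \<le> m (\<lambda>x. h x + (-1) * f x)"
    using m linf_real_add[OF h linf_real_scale[OF f, of "-1"]] le by (simp add: left_invariant_mean_def)
  also have "\<dots> = m h - m f"
    using mean_add[OF h linf_real_scale[OF f, of "-1"]] mean_scale[OF f, of "-1"] by simp
  finally show ?thesis by simp
qed

lemma mean_le_const:
  assumes f: "f \<in> linf_real G" and le: "\<And>x. x \<in> carrier G \<Longrightarrow> f x \<le> c"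
  shows "m f \<le> c"
  using mean_mono[OF f linf_real_const[of c G]] le by (simp add: mean_const)

lemma mean_ge_const:
  assumes f: "f \<in> linf_real G" and le: "\<And>x. x \<in> carrier G \<Longrightarrow> c \<le> f x"
  shows "c \<le> m f"
  using mean_mono[OF linf_real_const[of c G] f] le by (simp add: mean_const)

lemma mean_sum:
  assumes "finite I" "\<And>i. i \<in> I \<Longrightarrow> f i \<in> linf_real G"
  shows "m (\<lambda>x. \<Sum>i\<in>I. f i x) = (\<Sum>i\<in>I. m (f i))"
  using assms
proof (induction I rule: finite_induct)
  case empty then show ?case using mean_const[of 0] by simp
next
  case (insert i I) then show ?case using mean_add[of "f i" "\<lambda>x. \<Sum>i\<in>I. f i x"] by (simp add: linf_real_sum)
qed

end

text \<open>A positive function \<open>u\<close> with average over \<open>E\<close> uniformly below \<open>u\<close> is impossible: \<open>ln u\<close> is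
  unbounded, but its increments \<open>x \<mapsto> ln u (g x) - ln u x\<close> are bounded, their means are odd in \<open>g\<close>, and so the
  means sum to zero over the symmetric set \<open>E\<close>. Outside the support of \<open>u\<close> one uses right translates of \<open>u\<close>.\<close>

lemma (in group) no_strictly_superharmonic:
  fixes u :: "'a \<Rightarrow> real" and \<kappa> :: real
  assumes m: "left_invariant_mean G m" and E: "finite E" "E \<subseteq> carrier G" and one: "\<one> \<in> E"
    and sym: "\<And>g. g \<in> E \<Longrightarrow> inv g \<in> E"
    and u0: "\<And>x. x \<in> carrier G \<Longrightarrow> 0 \<le> u x" and u1: "0 < u \<one>" and lam: "1 < \<kappa>"
    and super: "\<And>x. x \<in> carrier G \<Longrightarrow> \<kappa> * (\<Sum>g\<in>E. u (g \<otimes> x)) \<le> card E * u x"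
  shows False
proof -
  \<comment> \<open>A Harnack constant: a single term of the sum over E is at most the whole
    sum.\<close>
  define C where "C = card E / \<kappa>"
  have Ecar: "g \<in> carrier G" if "g \<in> E" for g using E that by blast
  have harnack: "u (g \<otimes> x) \<le> C * u x" if "g \<in> E" "x \<in> carrier G" for g x
  proof -
    have "u (g \<otimes> x) \<le> (\<Sum>g\<in>E. u (g \<otimes> x))"
      by (rule member_le_sum[OF that(1)]) (use E that u0 Ecar in auto)
    also have "\<dots> \<le> C * u x" using super[OF that(2)] lam by (simp add: C_def field_simps)
    finally show ?thesis .
  qed
  have harnack': "u x \<le> C * u (g \<otimes> x)" if "g \<in> E" "x \<in> carrier G" for g x
    using harnack[OF sym[OF that(1)], of "g \<otimes> x"] that Ecar[OF that(1)] by (simp add: m_assoc[symmetric])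
  have C1: "1 \<le> C"
    using harnack[OF one, of "\<one>"] u1 by simp
  have pos1: "0 < u (g \<otimes> x)" if "g \<in> E" "x \<in> carrier G" "0 < u x" for g x
    using harnack'[OF that(1,2)] that(3) C1 by (smt (verit) mult_nonneg_nonpos)
  \<comment> \<open>Harnack's inequality carries positivity from the unit along words in E, hence to
    the generated subgroup; outside it u may vanish.\<close>
  define S where "S = generate G E"
  have S: "subgroup S G" unfolding S_def by (rule generate_is_subgroup[OF E(2)])
  have SE: "E \<subseteq> S" by (auto simp: S_def intro: generate.incl)
  have pos_mult: "x \<in> carrier G \<Longrightarrow> 0 < u x \<Longrightarrow> 0 < u (k \<otimes> x)" if "k \<in> S" for k x
    using that unfolding S_def
  proof (induction k arbitrary: x rule: generate.induct)
    case (eng h1 h2)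
    have "h1 \<in> carrier G" "h2 \<in> carrier G"
      using eng.hyps generate_in_carrier[OF E(2)] by auto
    then show ?case using eng.IH eng.prems by (simp add: m_assoc)
  qed (auto intro: pos1 sym)
  have posS: "0 < u k" if "k \<in> S" for k
    using pos_mult[OF that _ u1] subgroup.mem_carrier[OF S that] by simp
  \<comment> \<open>A representative of the right coset of x modulo S. The choice depends on x only
    through the predicate, so all points of one coset get the same representative;
    \<open>t_shift\<close> rests on this.\<close>
  define t where "t x = (SOME t. t \<in> carrier G \<and> x \<otimes> inv t \<in> S)" for x
  have t: "t x \<in> carrier G \<and> x \<otimes> inv (t x) \<in> S" if "x \<in> carrier G" for x
    unfolding t_def by (rule someI[of _ x]) (use that subgroup.one_closed[OF S] in simp)
  have t_shift: "t (g \<otimes> x) = t x" if g: "g \<in> E" and x: "x \<in> carrier G" for g x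
  proof -
    have "(g \<otimes> x) \<otimes> inv s \<in> S \<longleftrightarrow> x \<otimes> inv s \<in> S" if s: "s \<in> carrier G" for s
    proof
      assume "(g \<otimes> x) \<otimes> inv s \<in> S"
      moreover have "inv g \<in> S" using g SE sym by blast
      ultimately have "inv g \<otimes> ((g \<otimes> x) \<otimes> inv s) \<in> S"
        by (simp add: subgroup.m_closed[OF S])
      then show "x \<otimes> inv s \<in> S"
        using Ecar[OF g] x s by (simp add: m_assoc[symmetric])
    next
      assume "x \<otimes> inv s \<in> S"
      then have "g \<otimes> (x \<otimes> inv s) \<in> S"
        using g SE by (auto intro: subgroup.m_closed[OF S])
      then show "(g \<otimes> x) \<otimes> inv s \<in> S"
        using Ecar[OF g] x s by (simp add: m_assoc)
    qed
    then show ?thesis unfolding t_def by (intro arg_cong[where f=Eps] ext) blast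
  qed
  define v where "v x = u (x \<otimes> inv (t x))" for x
  have v_pos: "0 < v x" if "x \<in> carrier G" for x using posS t[OF that] by (simp add: v_def)
  have v_shift: "v (g \<otimes> x) = u (g \<otimes> (x \<otimes> inv (t x)))"
    if "g \<in> E" "x \<in> carrier G" for g x
    using t[OF that(2)] Ecar[OF that(1)] that by (simp add: v_def t_shift m_assoc)
  define D where "D g x = (if x \<in> carrier G then ln (v (g \<otimes> x)) - ln (v x) else 0)" for g x
  have D: "D g \<in> linf_real G" if g: "g \<in> E" for g
  proof (rule linf_realI[where C="ln C"])
    fix x assume x: "x \<in> carrier G"
    define y where "y = x \<otimes> inv (t x)"
    have y: "y \<in> carrier G" using x t[OF x] by (simp add: y_def)
    have pos: "0 < u y" "0 < u (g \<otimes> y)"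
      using v_pos[OF x] v_pos[of "g \<otimes> x"] v_shift[OF g x] x Ecar[OF g] by (auto simp: v_def y_def)
    have "ln (u (g \<otimes> y)) \<le> ln (C * u y)" "ln (u y) \<le> ln (C * u (g \<otimes> y))"
      using harnack[OF g y] harnack'[OF g y] pos C1 by auto
    then show "\<bar>D g x\<bar> \<le> ln C"
      using pos C1 x v_shift[OF g x] by (simp add: D_def v_def ln_mult flip: y_def)
  qed (simp add: D_def)
  \<comment> \<open>D (inv g) is the negative of the left translate of D g by g, and the mean is
    left invariant.\<close>
  have odd: "m (D (inv g)) = - m (D g)" if g: "g \<in> E" for g
  proof -
    have "D (inv g) = (\<lambda>x. -1 * (if x \<in> carrier G then D g (inv g \<otimes> x) else 0))"
      using Ecar[OF g] by (auto simp: D_def fun_eq_iff m_assoc[symmetric])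
    moreover have "(\<lambda>x. if x \<in> carrier G then D g (inv g \<otimes> x) else 0) \<in> linf_real G"
    proof -
      obtain C' where "\<And>x. \<bar>D g x\<bar> \<le> C'" using linf_realE[OF D[OF g]] by blast
      then show ?thesis by (intro linf_realI[where C=C']) auto
    qed
    ultimately show ?thesis
      using mean_scale[OF m, of _ "-1"] mean_shift[OF m Ecar[OF g] D[OF g]] by simp
  qed
  have bij: "bij_betw (\<lambda>g. inv g) E E"
    by (rule bij_betw_byWitness[where f'="\<lambda>g. inv g"]) (use sym Ecar in auto)
  have "(\<Sum>g\<in>E. m (D g)) = (\<Sum>g\<in>E. m (D (inv g)))"
    by (rule sum.reindex_bij_betw[OF bij, symmetric])
  also have "\<dots> = - (\<Sum>g\<in>E. m (D g))" by (simp add: odd sum_negf)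
  finally have zero: "(\<Sum>g\<in>E. m (D g)) = 0" by simp
  have cardE: "0 < card E" using E one by (auto simp: card_gt_0_iff)
  have "m (\<lambda>x. \<Sum>g\<in>E. D g x) \<le> - (card E * ln \<kappa>)"
  proof (rule mean_le_const[OF m linf_real_sum[OF E(1) D]])
    fix x assume x: "x \<in> carrier G"
    define y where "y = x \<otimes> inv (t x)"
    have y: "y \<in> carrier G" using x t[OF x] by (simp add: y_def)
    have uy: "0 < u y" using v_pos[OF x] by (simp add: v_def y_def)
    \<comment> \<open>This is ln z \<le> z - 1 at z = \<kappa> * u (g \<otimes> y) / u y. On summing
      over E, the superharmonic bound is absorbed by the terms - 1, and - card E * ln \<kappa>
      remains.\<close>
    have "D g x \<le> \<kappa> * (u (g \<otimes> y) / u y) - 1 - ln \<kappa>" if g: "g \<in> E" for g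
    proof -
      have ugy: "0 < u (g \<otimes> y)" using pos1[OF g y uy] .
      have "ln (\<kappa> * (u (g \<otimes> y) / u y)) \<le> \<kappa> * (u (g \<otimes> y) / u y) - 1"
        using ugy uy lam by (intro ln_le_minus_one) simp
      moreover have "ln (\<kappa> * (u (g \<otimes> y) / u y)) = ln \<kappa> + D g x"
        using ugy uy lam x v_shift[OF g x] by (simp add: D_def v_def ln_mult ln_div flip: y_def)
      ultimately show ?thesis by linarith
    qed
    then have "(\<Sum>g\<in>E. D g x) \<le> (\<Sum>g\<in>E. \<kappa> * (u (g \<otimes> y) / u y) - 1 - ln \<kappa>)"
      by (rule sum_mono)
    also have "\<dots> = \<kappa> * (\<Sum>g\<in>E. u (g \<otimes> y)) / u y - card E - card E * ln \<kappa>"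
      by (simp add: sum_subtractf sum_distrib_left sum_divide_distrib)
    also have "\<kappa> * (\<Sum>g\<in>E. u (g \<otimes> y)) / u y \<le> card E"
      using super[OF y] uy by (simp add: field_simps)
    finally show "(\<Sum>g\<in>E. D g x) \<le> - (card E * ln \<kappa>)" by simp
  qed auto
  moreover have "m (\<lambda>x. \<Sum>g\<in>E. D g x) = 0" using mean_sum[OF m E(1) D] zero by simp
  ultimately have "0 < card E * ln \<kappa> \<longrightarrow> False" by simp
  then show False using cardE lam by simp
qed

lemma infsum_finite_support:
  fixes f :: "'i \<Rightarrow> 'b::{topological_comm_monoid_add, t2_space}"
  assumes "finite F" "F \<subseteq> X" "\<And>x. x \<in> X - F \<Longrightarrow> f x = 0"
  shows "infsum f X = sum f F" "f summable_on X"
proof -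
  have "infsum f X = infsum f F" by (rule infsum_cong_neutral) (use assms in auto)
  then show "infsum f X = sum f F" using assms(1) by simp
  have "f summable_on X \<longleftrightarrow> f summable_on F" by (rule summable_on_cong_neutral) (use assms in auto)
  then show "f summable_on X" using assms(1) by simp
qed

text \<open>Kesten's criterion: otherwise the resolvent of the averaging operator, applied to the point mass at the
  unit, would be strictly superharmonic.\<close>

lemma (in group) averaging_norm_one:
  fixes r :: real
  assumes am: "amenable G" and E: "finite E" "E \<subseteq> carrier G" and one: "\<one> \<in> E"
    and sym: "\<And>g. g \<in> E \<Longrightarrow> inv g \<in> E" and r: "0 < r" "r < 1"
  obtains F \<xi> where "finite F" "F \<subseteq> carrier G" "\<And>x. (0::real) \<le> \<xi> x" "\<And>x. x \<notin> F \<Longrightarrow> \<xi> x = 0"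
    "r\<^sup>2 * (\<Sum>\<^sub>\<infinity>x\<in>carrier G. (\<xi> x)\<^sup>2) < (\<Sum>\<^sub>\<infinity>x\<in>carrier G. ((\<Sum>g\<in>E. \<xi> (g \<otimes> x)) / card E)\<^sup>2)"
proof (rule ccontr)
  note thesisI = that
  assume contra: "\<not> thesis"
  obtain m where m: "left_invariant_mean G m" using am by (auto simp: amenable_def)
  have Ecar: "g \<in> carrier G" if "g \<in> E" for g using E that by blast
  have cardE: "0 < card E" using E one by (auto simp: card_gt_0_iff)
  define H where "H \<xi> x = (if x \<in> carrier G then (\<Sum>g\<in>E. \<xi> (g \<otimes> x)) / card E else 0)" for \<xi> :: "'a \<Rightarrow> real" and x
  define fs where "fs \<xi> \<longleftrightarrow> (\<exists>F. finite F \<and> F \<subseteq> carrier G \<and> (\<forall>x. x \<notin> F \<longrightarrow> \<xi> x = 0)) \<and> (\<forall>x. 0 \<le> \<xi> x)" for \<xi> :: "'a \<Rightarrow> real"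
  define Q where "Q \<xi> = (\<Sum>\<^sub>\<infinity>x\<in>carrier G. (\<xi> x)\<^sup>2)" for \<xi> :: "'a \<Rightarrow> real"
  \<comment> \<open>If the conclusion fails, H has norm at most r on nonnegative finitely supported
    functions. This class is invariant under H and contains the iterates of the point mass.\<close>
  have H_le: "Q (H \<xi>) \<le> r\<^sup>2 * Q \<xi>" if fs: "fs \<xi>" for \<xi>
  proof (rule ccontr)
    assume "\<not> ?thesis"
    moreover have "Q (H \<xi>) = (\<Sum>\<^sub>\<infinity>x\<in>carrier G. ((\<Sum>g\<in>E. \<xi> (g \<otimes> x)) / card E)\<^sup>2)"
      unfolding Q_def by (rule infsum_cong) (simp add: H_def)
    moreover obtain F where "finite F" "F \<subseteq> carrier G" "\<And>x. x \<notin> F \<Longrightarrow> \<xi> x = 0" "\<And>x. 0 \<le> \<xi> x"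
      using fs by (auto simp: fs_def)
    ultimately show False using contra thesisI[of F \<xi>] by (simp add: Q_def)
  qed
  have H_fs: "fs (H \<xi>)" if fs: "fs \<xi>" for \<xi>
  proof -
    obtain F where F: "finite F" "F \<subseteq> carrier G" "\<And>x. x \<notin> F \<Longrightarrow> \<xi> x = 0" and pos: "\<And>x. 0 \<le> \<xi> x"
      using fs by (auto simp: fs_def)
    let ?F = "(\<lambda>(g, y). inv g \<otimes> y) ` (E \<times> F)"
    have "H \<xi> x = 0" if x: "x \<notin> ?F" for x
    proof (cases "x \<in> carrier G")
      case True
      have "\<xi> (g \<otimes> x) = 0" if g: "g \<in> E" for g
      proof (rule F(3))
        have "x = inv g \<otimes> (g \<otimes> x)" using True Ecar[OF g] by (simp add: m_assoc[symmetric])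
        then show "g \<otimes> x \<notin> F" using x g by (auto simp: image_iff)
      qed
      then show ?thesis by (simp add: H_def)
    qed (simp add: H_def)
    moreover have "finite ?F" "?F \<subseteq> carrier G" using E(1) F Ecar by auto
    moreover have "0 \<le> H \<xi> x" for x using pos by (simp add: H_def sum_nonneg)
    ultimately show ?thesis unfolding fs_def by blast
  qed
  define v where "v n = (H ^^ n) (\<lambda>x. if x = \<one> then 1 else 0)" for n
  have v0: "v 0 = (\<lambda>x. if x = \<one> then 1 else 0)" and vS: "v (Suc n) = H (v n)" for n by (simp_all add: v_def)
  have v_fs: "fs (v n)" for n
  proof (induction n)
    case 0 show ?case unfolding fs_def v0 by (intro conjI exI[of _ "{\<one>}"]) auto
  qed (simp add: vS H_fs)
  have v_pos: "0 \<le> v n x" for n x using v_fs[of n] by (simp add: fs_def)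
  have vQ: "Q (v n) \<le> (r^n)\<^sup>2" for n
  proof (induction n)
    case 0
    have "Q (v 0) = (\<Sum>x\<in>{\<one>}. (v 0 x)\<^sup>2)"
      unfolding Q_def by (rule infsum_finite_support(1)) (auto simp: v0)
    then show ?case by (simp add: v0)
  next
    case (Suc n)
    have "Q (v (Suc n)) \<le> r\<^sup>2 * Q (v n)" unfolding vS by (rule H_le[OF v_fs])
    also have "\<dots> \<le> r\<^sup>2 * (r^n)\<^sup>2" using Suc by (intro mult_left_mono) auto
    finally show ?case by (simp add: power_mult_distrib)
  qed
  have v_le: "v n x \<le> r^n" if "x \<in> carrier G" for n x
  proof -
    obtain F where F: "finite F" "F \<subseteq> carrier G" "\<And>x. x \<notin> F \<Longrightarrow> v n x = 0"
      using v_fs[of n] by (auto simp: fs_def)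
    have "Q (v n) = (\<Sum>x\<in>insert x F. (v n x)\<^sup>2)"
      unfolding Q_def by (rule infsum_finite_support(1)) (use F that in auto)
    then have "(v n x)\<^sup>2 \<le> Q (v n)"
      using F(1) member_le_sum[of x "insert x F" "\<lambda>x. (v n x)\<^sup>2"] by simp
    also note vQ[of n]
    finally show ?thesis by (rule power2_le_imp_le) (use r in simp)
  qed
  \<comment> \<open>The midpoint of 1 and 1 / r: \<kappa> > 1 makes the superharmonicity strict, and
    \<kappa> * r < 1 makes the Neumann series converge.\<close>
  define \<kappa> where "\<kappa> = (1 + 1/r) / 2"
  have \<kappa>: "1 < \<kappa>" "\<kappa> * r < 1" using r by (auto simp: \<kappa>_def field_simps)
  have summ: "summable (\<lambda>n. \<kappa>^n * v n x)" if "x \<in> carrier G" for x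
  proof (rule summable_comparison_test')
    show "summable (\<lambda>n. (\<kappa> * r)^n)" using \<kappa> r by (intro summable_geometric) simp
    show "norm (\<kappa>^n * v n x) \<le> (\<kappa> * r)^n" if "0 \<le> n" for n
      using \<kappa> r v_pos[of n x] v_le[OF \<open>x \<in> carrier G\<close>, of n] by (simp add: abs_mult power_mult_distrib mult_left_mono)
  qed
  define u where "u x = (\<Sum>n. \<kappa>^n * v n x)" for x
  have u0: "0 \<le> u x" if "x \<in> carrier G" for x
    unfolding u_def using \<kappa> v_pos by (intro suminf_nonneg summ that) auto
  have u_split: "u x = v 0 x + (\<Sum>n. \<kappa>^(Suc n) * v (Suc n) x)" if "x \<in> carrier G" for x
    using suminf_split_head[OF summ[OF that]] by (simp add: u_def)
  \<comment> \<open>In operator form this is the resolvent identity \<kappa> H u = u - v 0; dropping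
    v 0, which is nonnegative, gives superharmonicity.\<close>
  have super_eq: "\<kappa> * (\<Sum>g\<in>E. u (g \<otimes> x)) = card E * (\<Sum>n. \<kappa>^(Suc n) * v (Suc n) x)"
    if x: "x \<in> carrier G" for x
  proof -
    have gx: "g \<otimes> x \<in> carrier G" if "g \<in> E" for g using Ecar[OF that] x by simp
    have "(\<Sum>g\<in>E. u (g \<otimes> x)) = (\<Sum>n. \<Sum>g\<in>E. \<kappa>^n * v n (g \<otimes> x))"
      unfolding u_def by (rule suminf_sum[symmetric]) (use summ gx in auto)
    also have "(\<lambda>n. \<Sum>g\<in>E. \<kappa>^n * v n (g \<otimes> x)) = (\<lambda>n. (card E / \<kappa>) * (\<kappa>^(Suc n) * v (Suc n) x))"
      using \<kappa> cardE x by (auto simp: vS H_def fun_eq_iff simp flip: sum_distrib_left)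
    also have "(\<Sum>n. (card E / \<kappa>) * (\<kappa>^(Suc n) * v (Suc n) x)) = (card E / \<kappa>) * (\<Sum>n. \<kappa>^(Suc n) * v (Suc n) x)"
      using summable_Suc_iff[of "\<lambda>n. \<kappa>^n * v n x"] summ[OF x] by (intro suminf_mult) simp
    finally show ?thesis using \<kappa> by simp
  qed
  have tail: "0 \<le> (\<Sum>n. \<kappa>^(Suc n) * v (Suc n) x)" if "x \<in> carrier G" for x
    using summable_Suc_iff[of "\<lambda>n. \<kappa>^n * v n x"] summ[OF that] \<kappa> v_pos by (intro suminf_nonneg) auto
  show False
  proof (rule no_strictly_superharmonic[OF m E one sym u0 _ \<kappa>(1)])
    show "0 < u \<one>" using u_split[of "\<one>"] tail[of "\<one>"] by (simp add: v0)
    fix x assume x: "x \<in> carrier G"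
    have "(\<Sum>n. \<kappa>^(Suc n) * v (Suc n) x) \<le> u x" using u_split[OF x] v_pos[of 0 x] by simp
    then show "\<kappa> * (\<Sum>g\<in>E. u (g \<otimes> x)) \<le> card E * u x"
      unfolding super_eq[OF x] by (intro mult_left_mono) auto
  qed
qed

text \<open>Reiter's condition from the spectral statement. If the average of the translates of
  \<xi> has almost the norm of \<xi>, the translates are almost equal, because their variance is a
  difference of squared norms. The normalised squares of \<xi> are then almost invariant in
  l^1.\<close>

lemma (in group) reiter_finite_support:
  fixes \<epsilon> :: real
  assumes am: "amenable G" and E: "finite E" "E \<subseteq> carrier G" and \<epsilon>: "0 < \<epsilon>"
  obtains F \<phi> where "finite F" "F \<subseteq> carrier G" "\<And>x. (0::real) \<le> \<phi> x" "\<And>x. x \<notin> F \<Longrightarrow> \<phi> x = 0"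
    "(\<Sum>\<^sub>\<infinity>x\<in>carrier G. \<phi> x) = 1"
    "\<And>g. g \<in> E \<Longrightarrow> (\<Sum>\<^sub>\<infinity>x\<in>carrier G. \<bar>\<phi> (g \<otimes> x) - \<phi> x\<bar>) \<le> \<epsilon>"
proof -
  \<comment> \<open>Symmetric as \<open>averaging_norm_one\<close> requires. With the unit included,
    \<xi> is one of its own translates and can be compared with the others through their
    average.\<close>
  define E' where "E' = insert \<one> (E \<union> (\<lambda>g. inv g) ` E)"
  have E': "finite E'" "E' \<subseteq> carrier G" "\<one> \<in> E'" "E \<subseteq> E'" using E by (auto simp: E'_def)
  have sym: "inv g \<in> E'" if "g \<in> E'" for g using that E by (auto simp: E'_def)
  have Ecar: "g \<in> carrier G" if "g \<in> E'" for g using E' that by blast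
  have cardE: "0 < card E'" using E' by (auto simp: card_gt_0_iff)
  \<comment> \<open>The parameter of the weighted inequality near the end, whose outcome is 5 * s
    \<le> \<epsilon>. Then d is chosen with 4 * card E' * d \<le> s^2, which bounds the squared l^2
    distance, relative to q, between \<xi> and a translate.\<close>
  define s where "s = \<epsilon> / 8"
  have s: "0 < s" using \<epsilon> by (simp add: s_def)
  define d where "d = min (1/2) (s\<^sup>2 / (4 * card E'))"
  have d: "0 < d" "d < 1" "4 * card E' * d \<le> s\<^sup>2"
    using s cardE by (auto simp: d_def min_def field_simps)
  obtain F \<xi> where F: "finite F" "F \<subseteq> carrier G" and pos: "\<And>x. (0::real) \<le> \<xi> x" and out: "\<And>x. x \<notin> F \<Longrightarrow> \<xi> x = 0"
    and gt: "(sqrt (1 - d))\<^sup>2 * (\<Sum>\<^sub>\<infinity>x\<in>carrier G. (\<xi> x)\<^sup>2) < (\<Sum>\<^sub>\<infinity>x\<in>carrier G. ((\<Sum>g\<in>E'. \<xi> (g \<otimes> x)) / card E')\<^sup>2)"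
    by (rule averaging_norm_one[OF am E'(1,2,3) sym, of "sqrt (1 - d)"]) (use d in auto)
  define A where "A x = (\<Sum>g\<in>E'. \<xi> (g \<otimes> x)) / card E'" for x
  \<comment> \<open>Within the group, \<xi> and its translates by E' vanish off W, which turns the
    infinite sums into sums over W.\<close>
  define W where "W = F \<union> (\<lambda>(g, y). inv g \<otimes> y) ` (E' \<times> F)"
  have W: "finite W" "W \<subseteq> carrier G" using E' F Ecar by (auto simp: W_def)
  have shift0: "\<xi> (g \<otimes> x) = 0" if "x \<in> carrier G - W" "g \<in> E'" for x g
  proof (rule out)
    have "x = inv g \<otimes> (g \<otimes> x)" using that Ecar[OF that(2)] by (simp add: m_assoc[symmetric])
    then show "g \<otimes> x \<notin> F" using that by (auto simp: W_def image_iff)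
  qed
  have \<xi>0: "\<xi> x = 0" if "x \<in> carrier G - W" for x using out that by (auto simp: W_def)
  have A0: "A x = 0" if "x \<in> carrier G - W" for x using shift0[OF that] by (simp add: A_def)
  define q where "q = (\<Sum>\<^sub>\<infinity>x\<in>carrier G. (\<xi> x)\<^sup>2)"
  have q: "q = (\<Sum>x\<in>W. (\<xi> x)\<^sup>2)"
    unfolding q_def by (rule infsum_finite_support(1)[OF W]) (simp add: \<xi>0)
  have qshift: "(\<Sum>x\<in>W. (\<xi> (g \<otimes> x))\<^sup>2) = q" if g: "g \<in> E'" for g
  proof -
    have "bij_betw (\<lambda>x. g \<otimes> x) (carrier G) (carrier G)"
      by (rule bij_betw_byWitness[where f'="\<lambda>x. inv g \<otimes> x"]) (use Ecar[OF g] in \<open>auto simp: m_assoc[symmetric]\<close>)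
    from infsum_reindex_bij_betw[OF this, of "\<lambda>x. (\<xi> x)\<^sup>2"]
    have "(\<Sum>\<^sub>\<infinity>x\<in>carrier G. (\<xi> (g \<otimes> x))\<^sup>2) = q" by (simp add: q_def)
    moreover have "(\<Sum>\<^sub>\<infinity>x\<in>carrier G. (\<xi> (g \<otimes> x))\<^sup>2) = (\<Sum>x\<in>W. (\<xi> (g \<otimes> x))\<^sup>2)"
      by (rule infsum_finite_support(1)[OF W]) (simp add: shift0 g)
    ultimately show ?thesis by simp
  qed
  have gtW: "(1 - d) * q < (\<Sum>x\<in>W. (A x)\<^sup>2)"
  proof -
    have "(\<Sum>\<^sub>\<infinity>x\<in>carrier G. (A x)\<^sup>2) = (\<Sum>x\<in>W. (A x)\<^sup>2)"
      by (rule infsum_finite_support(1)[OF W]) (simp add: A0)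
    then show ?thesis using gt d by (simp add: A_def q_def)
  qed
  \<comment> \<open>The variance identity: mean of squares minus square of the mean, multiplied by
    card E'.\<close>
  have var: "(\<Sum>g\<in>E'. (\<xi> (g \<otimes> x) - A x)\<^sup>2) = (\<Sum>g\<in>E'. (\<xi> (g \<otimes> x))\<^sup>2) - card E' * (A x)\<^sup>2" for x
  proof -
    have "(\<Sum>g\<in>E'. \<xi> (g \<otimes> x)) = card E' * A x" using cardE by (simp add: A_def)
    then show ?thesis
      by (simp add: power2_diff sum.distrib sum_subtractf sum_distrib_right[symmetric] sum_distrib_left[symmetric] power2_eq_square algebra_simps)
  qed
  \<comment> \<open>One nonnegative term is at most the whole variance, and the latter is small
    because the average A nearly keeps the norm of \<xi>.\<close>
  have dev: "(\<Sum>x\<in>W. (\<xi> (g \<otimes> x) - A x)\<^sup>2) \<le> card E' * d * q" if g: "g \<in> E'" for g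
  proof -
    have "(\<Sum>x\<in>W. (\<xi> (g \<otimes> x) - A x)\<^sup>2) \<le> (\<Sum>g\<in>E'. \<Sum>x\<in>W. (\<xi> (g \<otimes> x) - A x)\<^sup>2)"
      by (rule member_le_sum[OF g]) (auto simp: E' sum_nonneg)
    also have "\<dots> = (\<Sum>x\<in>W. \<Sum>g\<in>E'. (\<xi> (g \<otimes> x) - A x)\<^sup>2)" by (rule sum.swap)
    also have "\<dots> = (\<Sum>x\<in>W. \<Sum>g\<in>E'. (\<xi> (g \<otimes> x))\<^sup>2) - card E' * (\<Sum>x\<in>W. (A x)\<^sup>2)"
      by (simp add: var sum_subtractf sum_distrib_left)
    also have "(\<Sum>x\<in>W. \<Sum>g\<in>E'. (\<xi> (g \<otimes> x))\<^sup>2) = card E' * q"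
      by (subst sum.swap) (simp add: qshift)
    also have "card E' * q - card E' * (\<Sum>x\<in>W. (A x)\<^sup>2) \<le> card E' * q - card E' * ((1 - d) * q)"
      using gtW by (intro diff_mono mult_left_mono) auto
    finally show ?thesis by (simp add: algebra_simps)
  qed
  have q0: "0 < q"
  proof (rule ccontr)
    assume "\<not> ?thesis"
    then have "q = 0" unfolding q_def by (intro antisym infsum_nonneg) auto
    then have "\<xi> x = 0" if "x \<in> W" for x
      using q W(1) that by (simp add: sum_nonneg_eq_0_iff)
    then have "\<xi> x = 0" for x using out[of x] by (cases "x \<in> F") (auto simp: W_def)
    then have "A x = 0" for x by (simp add: A_def)
    then show False using gtW \<open>q = 0\<close> by simp
  qed
  show ?thesis
  proof (rule that[OF F, of "\<lambda>x. (\<xi> x)\<^sup>2 / q"])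
    show "(\<Sum>\<^sub>\<infinity>x\<in>carrier G. (\<xi> x)\<^sup>2 / q) = 1"
      using q0 infsum_cmult_left'[of "\<lambda>x. (\<xi> x)\<^sup>2" "inverse q" "carrier G"] by (simp add: q_def field_simps)
    fix g assume "g \<in> E"
    then have g: "g \<in> E'" using E' by blast
    have dW: "(\<Sum>x\<in>W. (\<xi> (g \<otimes> x) - \<xi> x)\<^sup>2) \<le> s\<^sup>2 * q"
    proof -
      have "(\<Sum>x\<in>W. (\<xi> (g \<otimes> x) - \<xi> x)\<^sup>2)
        \<le> (\<Sum>x\<in>W. 2 * (\<xi> (g \<otimes> x) - A x)\<^sup>2 + 2 * (\<xi> (\<one> \<otimes> x) - A x)\<^sup>2)"
      proof (rule sum_mono)
        fix x assume "x \<in> W"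
        then have "\<one> \<otimes> x = x" using W by auto
        moreover have "(a - b)\<^sup>2 \<le> 2 * (a - c)\<^sup>2 + 2 * (b - c)\<^sup>2" for a b c :: real
          using zero_le_power2[of "a + b - 2 * c"] by (simp add: power2_eq_square algebra_simps)
        ultimately show "(\<xi> (g \<otimes> x) - \<xi> x)\<^sup>2 \<le> 2 * (\<xi> (g \<otimes> x) - A x)\<^sup>2 + 2 * (\<xi> (\<one> \<otimes> x) - A x)\<^sup>2"
          by simp
      qed
      also have "\<dots> \<le> 2 * (card E' * d * q) + 2 * (card E' * d * q)"
        unfolding sum.distrib sum_distrib_left[symmetric] using dev[OF g] dev[OF E'(3)] by linarith
      also have "\<dots> = (4 * card E' * d) * q" by simp
      also have "\<dots> \<le> s\<^sup>2 * q" using d(3) q0 by (intro mult_right_mono) auto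
      finally show ?thesis .
    qed
    have "(\<Sum>\<^sub>\<infinity>x\<in>carrier G. \<bar>(\<xi> (g \<otimes> x))\<^sup>2 / q - (\<xi> x)\<^sup>2 / q\<bar>) = (\<Sum>x\<in>W. \<bar>(\<xi> (g \<otimes> x))\<^sup>2 / q - (\<xi> x)\<^sup>2 / q\<bar>)"
      by (rule infsum_finite_support(1)[OF W]) (simp add: shift0 g \<xi>0)
    also have "\<dots> \<le> (\<Sum>x\<in>W. ((\<xi> (g \<otimes> x) - \<xi> x)\<^sup>2 / s + 2 * s * ((\<xi> (g \<otimes> x))\<^sup>2 + (\<xi> x)\<^sup>2)) / q)"
    proof (rule sum_mono)
      fix x
      \<comment> \<open>Factor into (a - b)(a + b) and balance with weight s: the small factor is
        squared and divided by s, the bounded one is squared and multiplied by s.\<close>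
      have "\<bar>a\<^sup>2 - b\<^sup>2\<bar> \<le> (a - b)\<^sup>2 / s + 2 * s * (a\<^sup>2 + b\<^sup>2)" for a b :: real
      proof -
        have 1: "\<bar>a\<^sup>2 - b\<^sup>2\<bar> = \<bar>a - b\<bar> * \<bar>a + b\<bar>"
          by (simp add: power2_eq_square algebra_simps flip: abs_mult)
        have "2 * (\<bar>a - b\<bar> * (s * \<bar>a + b\<bar>)) \<le> (a - b)\<^sup>2 + s\<^sup>2 * (a + b)\<^sup>2"
          using sum_squares_bound[of "\<bar>a - b\<bar>" "s * \<bar>a + b\<bar>"] by (simp add: power_mult_distrib)
        then have "2 * (\<bar>a - b\<bar> * \<bar>a + b\<bar>) \<le> (a - b)\<^sup>2 / s + s * (a + b)\<^sup>2"
          using s by (simp add: field_simps power2_eq_square)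
        moreover have "s * (a + b)\<^sup>2 \<le> s * (2 * (a\<^sup>2 + b\<^sup>2))"
          using s zero_le_power2[of "a - b"] by (intro mult_left_mono) (auto simp: power2_eq_square algebra_simps)
        moreover have "0 \<le> (a - b)\<^sup>2 / s" using s by simp
        moreover have "0 \<le> \<bar>a - b\<bar> * \<bar>a + b\<bar>" by simp
        moreover have "s * (2 * (a\<^sup>2 + b\<^sup>2)) = 2 * s * (a\<^sup>2 + b\<^sup>2)" by simp
        ultimately show ?thesis unfolding 1 by linarith
      qed
      then show "\<bar>(\<xi> (g \<otimes> x))\<^sup>2 / q - (\<xi> x)\<^sup>2 / q\<bar>
          \<le> ((\<xi> (g \<otimes> x) - \<xi> x)\<^sup>2 / s + 2 * s * ((\<xi> (g \<otimes> x))\<^sup>2 + (\<xi> x)\<^sup>2)) / q"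
        using q0 by (simp add: divide_right_mono flip: diff_divide_distrib)
    qed
    also have "\<dots> = ((\<Sum>x\<in>W. (\<xi> (g \<otimes> x) - \<xi> x)\<^sup>2) / s + 2 * s * (q + q)) / q"
      unfolding sum_divide_distrib[symmetric] sum.distrib sum_distrib_left[symmetric] q[symmetric] qshift[OF g] ..
    also have "\<dots> \<le> (s\<^sup>2 * q / s + 2 * s * (q + q)) / q"
      using s q0 dW by (intro divide_right_mono add_mono) auto
    also have "\<dots> = 5 * s" using s q0 by (simp add: field_simps power2_eq_square)
    also have "\<dots> \<le> \<epsilon>" using \<epsilon> by (simp add: s_def)
    finally show "(\<Sum>\<^sub>\<infinity>x\<in>carrier G. \<bar>(\<xi> (g \<otimes> x))\<^sup>2 / q - (\<xi> x)\<^sup>2 / q\<bar>) \<le> \<epsilon>" .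
  qed (use q0 out in auto)
qed

section \<open>Khintchine's inequality\<close>

text \<open>A sign pattern on \<open>J\<close> is encoded by the set \<open>B \<subseteq> J\<close> of indices carrying a plus sign, so
  expectations over random signs are sums over \<open>Pow J\<close> divided by \<open>2 ^ card J\<close>.\<close>

definition signed_sum :: "'i set \<Rightarrow> ('i \<Rightarrow> 'v::ab_group_add) \<Rightarrow> 'i set \<Rightarrow> 'v" where
  "signed_sum J c B = (\<Sum>j\<in>J. if j \<in> B then c j else - c j)"

text \<open>Conditioning on the sign of the new index; this is the induction step for every moment
  of a random signed sum.\<close>

lemma sum_signed_sum_insert:
  fixes f :: "'v::ab_group_add \<Rightarrow> real"
  assumes "finite J" "j \<notin> J"
  shows "(\<Sum>B\<in>Pow (insert j J). f (signed_sum (insert j J) c B)) =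
    (\<Sum>B\<in>Pow J. f (signed_sum J c B - c j) + f (signed_sum J c B + c j))"
proof -
  have cong: "signed_sum J c (insert j B) = signed_sum J c B" for B
    unfolding signed_sum_def by (rule sum.cong) (use assms in auto)
  have "(\<Sum>B\<in>Pow (insert j J). f (signed_sum (insert j J) c B)) =
      (\<Sum>B\<in>Pow J. f (signed_sum (insert j J) c B)) + (\<Sum>B\<in>insert j ` Pow J. f (signed_sum (insert j J) c B))"
    unfolding Pow_insert by (rule sum.union_disjoint) (use assms in auto)
  also have "(\<Sum>B\<in>insert j ` Pow J. f (signed_sum (insert j J) c B)) =
      (\<Sum>B\<in>Pow J. f (signed_sum (insert j J) c (insert j B)))"
    by (subst sum.reindex) (use assms in \<open>auto simp: inj_on_def\<close>)
  also have "\<dots> = (\<Sum>B\<in>Pow J. f (signed_sum J c B + c j))"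
  proof (rule sum.cong[OF refl])
    fix B
    have "signed_sum (insert j J) c (insert j B) = c j + signed_sum J c (insert j B)"
      using assms by (simp add: signed_sum_def)
    then show "f (signed_sum (insert j J) c (insert j B)) = f (signed_sum J c B + c j)"
      by (simp add: cong add.commute)
  qed
  also have "(\<Sum>B\<in>Pow J. f (signed_sum (insert j J) c B)) = (\<Sum>B\<in>Pow J. f (signed_sum J c B - c j))"
  proof (rule sum.cong[OF refl])
    fix B assume "B \<in> Pow J"
    then have "signed_sum (insert j J) c B = - c j + signed_sum J c B"
      using assms by (auto simp: signed_sum_def)
    then show "f (signed_sum (insert j J) c B) = f (signed_sum J c B - c j)" by simp
  qed
  finally show ?thesis by (simp add: sum.distrib)
qed

text \<open>Orthogonality of the signs: the cross terms of (x - c)^2 and (x + c)^2 cancel.\<close>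

lemma sum_signed_sum_square:
  fixes c :: "'i \<Rightarrow> real"
  assumes "finite J"
  shows "(\<Sum>B\<in>Pow J. (signed_sum J c B)\<^sup>2) = 2 ^ card J * (\<Sum>j\<in>J. (c j)\<^sup>2)"
  using assms
proof (induction J rule: finite_induct)
  case empty then show ?case by (simp add: signed_sum_def)
next
  case (insert j J)
  have "(\<Sum>B\<in>Pow (insert j J). (signed_sum (insert j J) c B)\<^sup>2) =
      (\<Sum>B\<in>Pow J. 2 * (signed_sum J c B)\<^sup>2 + 2 * (c j)\<^sup>2)"
    unfolding sum_signed_sum_insert[OF insert.hyps(1,2), of "\<lambda>x. x\<^sup>2"]
    by (rule sum.cong) (auto simp: power2_eq_square algebra_simps)
  also have "\<dots> = 2 * (\<Sum>B\<in>Pow J. (signed_sum J c B)\<^sup>2) + 2 ^ card J * (2 * (c j)\<^sup>2)"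
    using insert.hyps by (simp add: sum.distrib card_Pow flip: sum_distrib_left)
  finally show ?case using insert by (simp add: algebra_simps)
qed

text \<open>A subgaussian bound for a single sign. The sharp exponent is c^2 / 2; with c^2
  elementary estimates suffice, a quadratic bound on the unit interval and c \<le> c^2 beyond
  it.\<close>

lemma exp_plus_exp_minus_le: "exp c + exp (- c) \<le> 2 * exp (c\<^sup>2)" for c :: real
proof -
  have pos: "exp c + exp (- c) \<le> 2 * exp (c\<^sup>2)" if c: "0 \<le> c" for c :: real
  proof (cases "c \<le> 1")
    case True
    have "exp c \<le> 1 + c + c\<^sup>2" using exp_bound[of c] c True by simp
    moreover have "exp (- c) \<le> 1 - c + c\<^sup>2"
    proof -
      have "1 / exp c \<le> 1 / (1 + c)" using c by (intro divide_left_mono) auto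
      also have "\<dots> \<le> 1 - c + c\<^sup>2"
      proof -
        have "(1 - c + c\<^sup>2) * (1 + c) = 1 + c^3" by (simp add: algebra_simps power2_eq_square power3_eq_cube)
        then show ?thesis using c by (simp add: pos_divide_le_eq)
      qed
      finally show ?thesis by (simp add: exp_minus inverse_eq_divide)
    qed
    moreover have "1 + c\<^sup>2 \<le> exp (c\<^sup>2)" by simp
    ultimately show ?thesis by linarith
  next
    case False
    then have "c \<le> c\<^sup>2" by (simp add: power2_eq_square)
    then have "exp c \<le> exp (c\<^sup>2)" by simp
    moreover have "exp (- c) \<le> exp c" using c by simp
    ultimately show ?thesis by linarith
  qed
  show ?thesis using pos[of c] pos[of "- c"] by (cases "0 \<le> c") auto
qed

text \<open>The exponential factorises over independent signs, so the bound for one sign multiplies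
  up.\<close>

lemma sum_signed_sum_exp:
  fixes c :: "'i \<Rightarrow> real"
  assumes "finite J"
  shows "(\<Sum>B\<in>Pow J. exp (signed_sum J c B)) \<le> 2 ^ card J * exp (\<Sum>j\<in>J. (c j)\<^sup>2)"
  using assms
proof (induction J rule: finite_induct)
  case empty then show ?case by (simp add: signed_sum_def)
next
  case (insert j J)
  have "(\<Sum>B\<in>Pow (insert j J). exp (signed_sum (insert j J) c B)) =
      (\<Sum>B\<in>Pow J. exp (signed_sum J c B) * (exp (c j) + exp (- c j)))"
    unfolding sum_signed_sum_insert[OF insert.hyps(1,2)]
    by (rule sum.cong) (auto simp: algebra_simps exp_add exp_diff exp_minus divide_inverse)
  also have "\<dots> = (\<Sum>B\<in>Pow J. exp (signed_sum J c B)) * (exp (c j) + exp (- c j))"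
    by (simp flip: sum_distrib_right)
  also have "\<dots> \<le> (2 ^ card J * exp (\<Sum>j\<in>J. (c j)\<^sup>2)) * (2 * exp ((c j)\<^sup>2))"
    using insert by (intro mult_mono exp_plus_exp_minus_le) (auto intro: add_nonneg_nonneg)
  finally show ?case using insert.hyps by (simp add: exp_add mult_ac)
qed

text \<open>Turns exponential moments into p-th moments; it is z \<le> exp z at z = t / p, raised to
  the power p.\<close>

lemma powr_le_exp:
  fixes p t :: real
  assumes "1 \<le> p" "0 \<le> t"
  shows "t powr p \<le> p powr p * exp t"
proof -
  have "t / p \<le> exp (t / p)" using exp_ge_add_one_self[of "t / p"] by linarith
  then have "(t / p) powr p \<le> exp (t / p) powr p" using assms by (intro powr_mono2) auto
  also have "\<dots> = exp t" using assms by (simp add: powr_def)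
  finally show ?thesis using assms by (simp add: powr_divide field_simps)
qed

context
  fixes J :: "'i set"
  assumes J: "finite J"
begin

text \<open>exp |x| is at most exp x + exp (- x); the constant 6 is twice the bound 3 for exp
  1.\<close>

lemma sum_signed_sum_exp_abs:
  fixes c :: "'i \<Rightarrow> real"
  assumes "(\<Sum>j\<in>J. (c j)\<^sup>2) \<le> 1"
  shows "(\<Sum>B\<in>Pow J. exp \<bar>signed_sum J c B\<bar>) \<le> 6 * 2 ^ card J"
proof -
  have neg: "signed_sum J (\<lambda>j. - c j) B = - signed_sum J c B" for B
    by (auto simp: signed_sum_def simp flip: sum_negf intro!: sum.cong)
  have e: "exp (\<Sum>j\<in>J. (c j)\<^sup>2) \<le> (3::real)"
  proof -
    have "exp (\<Sum>j\<in>J. (c j)\<^sup>2) \<le> exp (1::real)" using assms by simp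
    also have "\<dots> \<le> 3" by (rule exp_le)
    finally show ?thesis .
  qed
  have "(\<Sum>B\<in>Pow J. exp \<bar>signed_sum J c B\<bar>) \<le> (\<Sum>B\<in>Pow J. exp (signed_sum J c B) + exp (signed_sum J (\<lambda>j. - c j) B))"
    unfolding neg by (rule sum_mono) (auto simp: abs_if)
  also have "\<dots> \<le> 2 ^ card J * exp (\<Sum>j\<in>J. (c j)\<^sup>2) + 2 ^ card J * exp (\<Sum>j\<in>J. (c j)\<^sup>2)"
    unfolding sum.distrib using sum_signed_sum_exp[OF J, of c] sum_signed_sum_exp[OF J, of "\<lambda>j. - c j"] by simp
  also have "\<dots> \<le> 2 ^ card J * 3 + 2 ^ card J * 3"
    using e by (intro add_mono mult_left_mono) auto
  finally show ?thesis by simp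
qed

lemma signed_sum_scale:
  fixes d :: "'i \<Rightarrow> real"
  shows "signed_sum J (\<lambda>j. s * d j) B = s * signed_sum J d B"
  by (auto simp: signed_sum_def sum_distrib_left intro!: sum.cong)

text \<open>After scaling to square sum 1 the upper bound is the exponential moment estimate. For
  the lower bound it is enough to bound the first moment from below, which follows from the second
  moment being 1 and the fourth being bounded.\<close>

lemma khintchine_real:
  fixes c :: "'i \<Rightarrow> real"
  assumes p: "1 \<le> p"
  shows "(\<Sum>B\<in>Pow J. \<bar>signed_sum J c B\<bar> powr p) \<le> 2 ^ card J * (6 * p powr p) * L2_set c J powr p"
    and "2 ^ card J * (1/128) powr p * L2_set c J powr p \<le> (\<Sum>B\<in>Pow J. \<bar>signed_sum J c B\<bar> powr p)"
proof -
  define A where "A = L2_set c J"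
  have A0: "0 \<le> A" by (simp add: A_def L2_set_nonneg)
  have "(\<Sum>B\<in>Pow J. \<bar>signed_sum J c B\<bar> powr p) \<le> 2 ^ card J * (6 * p powr p) * A powr p \<and>
     2 ^ card J * (1/128) powr p * A powr p \<le> (\<Sum>B\<in>Pow J. \<bar>signed_sum J c B\<bar> powr p)"
  proof (cases "A = 0")
    case True
    then have "c j = 0" if "j \<in> J" for j using that J by (simp add: A_def L2_set_eq_0_iff)
    then have "signed_sum J c B = 0" for B by (auto simp: signed_sum_def intro!: sum.neutral)
    then show ?thesis using True by simp
  next
    case False
    with A0 have A: "0 < A" by simp
    define d where "d j = c j / A" for j
    have c: "c = (\<lambda>j. A * d j)" using A by (simp add: d_def fun_eq_iff)
    have "(\<Sum>j\<in>J. (c j)\<^sup>2) = A\<^sup>2" by (simp add: A_def L2_set_def sum_nonneg)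
    then have d1: "(\<Sum>j\<in>J. (d j)\<^sup>2) = 1" using A by (simp add: d_def power_divide flip: sum_divide_distrib)
    define X where "X B = \<bar>signed_sum J d B\<bar>" for B
    have X0: "0 \<le> X B" for B by (simp add: X_def)
    have cX: "\<bar>signed_sum J c B\<bar> powr p = A powr p * X B powr p" for B
      using A by (simp add: c signed_sum_scale abs_mult powr_mult X_def)
    have expX: "(\<Sum>B\<in>Pow J. exp (X B)) \<le> 6 * 2 ^ card J"
      using sum_signed_sum_exp_abs[of d] d1 by (simp add: X_def)
    have upper: "(\<Sum>B\<in>Pow J. X B powr q) \<le> 2 ^ card J * (6 * q powr q)" if q: "1 \<le> q" for q
    proof -
      have "(\<Sum>B\<in>Pow J. X B powr q) \<le> (\<Sum>B\<in>Pow J. q powr q * exp (X B))"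
        using q X0 by (intro sum_mono powr_le_exp) auto
      also have "\<dots> \<le> q powr q * (6 * 2 ^ card J)"
        unfolding sum_distrib_left[symmetric] using expX by (intro mult_left_mono) auto
      finally show ?thesis by (simp add: mult_ac)
    qed
    have "2 ^ card J = (\<Sum>B\<in>Pow J. (X B)\<^sup>2)"
      using sum_signed_sum_square[OF J, of d] d1 by (simp add: X_def)
    \<comment> \<open>Beyond the threshold 64, x^2 is at most x^4 / 64^2. The average of X^4 is at
      most 6 * 4^4 = 1536, and 1536 / 4096 = 3/8 leaves 5/8 for 64 times the average of X. Hence
      this average is at least 5/512, which exceeds 1/128.\<close>
    also have "\<dots> \<le> (\<Sum>B\<in>Pow J. 64 * X B + X B powr 4 / 4096)"
    proof (rule sum_mono)
      fix B
      define x where "x = X B"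
      have x: "0 \<le> x" by (simp add: x_def X0)
      have "x\<^sup>2 \<le> 64 * x + x^4 / 4096"
      proof (cases "x \<le> 64")
        case True
        then have "x * x \<le> 64 * x" using x by (intro mult_right_mono) auto
        moreover have "0 \<le> x^4 / 4096" using x by simp
        ultimately show ?thesis unfolding power2_eq_square by linarith
      next
        case False
        then have "64\<^sup>2 \<le> x\<^sup>2" by (intro power_mono) auto
        then have "x\<^sup>2 * 4096 \<le> x\<^sup>2 * x\<^sup>2" by (intro mult_left_mono) auto
        also have "x\<^sup>2 * x\<^sup>2 = x^4" by (simp flip: power_add)
        finally show ?thesis using x by simp
      qed
      then show "(X B)\<^sup>2 \<le> 64 * X B + X B powr 4 / 4096" using x by (simp add: x_def)
    qed
    also have "\<dots> = 64 * (\<Sum>B\<in>Pow J. X B) + (\<Sum>B\<in>Pow J. X B powr 4) / 4096"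
      by (simp add: sum.distrib sum_distrib_left sum_divide_distrib)
    also have "(\<Sum>B\<in>Pow J. X B powr 4) \<le> 2 ^ card J * (6 * 256)"
      using upper[of 4] by simp
    finally have "2 ^ card J \<le> 64 * (\<Sum>B\<in>Pow J. X B) + 2 ^ card J * (6 * 256) / 4096" by simp
    moreover have "(0::real) < 2 ^ card J" by simp
    ultimately have EX: "2 ^ card J * (1/128) \<le> (\<Sum>B\<in>Pow J. X B)" by linarith
    \<comment> \<open>Jensen by the tangent of t^p at 1/128: its slope is nonnegative and the
      average of X is at least 1/128.\<close>
    have "2 ^ card J * (1/128) powr p \<le>
        (\<Sum>B\<in>Pow J. (1/128) powr p + p * (1/128) powr (p - 1) * (X B - 1/128))"
    proof -
      have "(\<Sum>B\<in>Pow J. (1/128) powr p + p * (1/128) powr (p - 1) * (X B - 1/128)) =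
          2 ^ card J * (1/128) powr p + p * (1/128) powr (p - 1) * ((\<Sum>B\<in>Pow J. X B) - 2 ^ card J * (1/128))"
        using J by (simp add: sum.distrib sum_subtractf card_Pow flip: sum_distrib_left)
      then show ?thesis using EX p by simp
    qed
    also have "\<dots> \<le> (\<Sum>B\<in>Pow J. X B powr p)"
      using X0 p by (intro sum_mono powr_tangent) auto
    finally have lower: "2 ^ card J * (1/128) powr p \<le> (\<Sum>B\<in>Pow J. X B powr p)" .
    show ?thesis
      unfolding cX sum_distrib_left[symmetric]
      using mult_left_mono[OF upper[OF p], of "A powr p"] mult_left_mono[OF lower, of "A powr p"]
      by (simp add: mult_ac)
  qed
  then show "(\<Sum>B\<in>Pow J. \<bar>signed_sum J c B\<bar> powr p) \<le> 2 ^ card J * (6 * p powr p) * L2_set c J powr p"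
    and "2 ^ card J * (1/128) powr p * L2_set c J powr p \<le> (\<Sum>B\<in>Pow J. \<bar>signed_sum J c B\<bar> powr p)"
    by (simp_all add: A_def)
qed

end

text \<open>Real and imaginary parts are treated separately. For the lower bound, A^2 = R^2 + I^2
  shows that one of them carries at least half of A, which turns 1/128 into 1/256.\<close>

lemma khintchine_complex:
  fixes c :: "'i \<Rightarrow> complex"
  assumes J: "finite J" and p: "1 \<le> p"
  shows "(\<Sum>B\<in>Pow J. cmod (signed_sum J c B) powr p)
      \<le> 2 ^ card J * (2 * 2 powr p * (6 * p powr p)) * L2_set (\<lambda>j. cmod (c j)) J powr p"
    and "2 ^ card J * (1/256) powr p * L2_set (\<lambda>j. cmod (c j)) J powr p
      \<le> (\<Sum>B\<in>Pow J. cmod (signed_sum J c B) powr p)"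
proof -
  define A where "A = L2_set (\<lambda>j. cmod (c j)) J"
  define R where "R = L2_set (\<lambda>j. Re (c j)) J"
  define I where "I = L2_set (\<lambda>j. Im (c j)) J"
  have nn: "0 \<le> A" "0 \<le> R" "0 \<le> I" by (simp_all add: A_def R_def I_def L2_set_nonneg)
  have Re: "Re (signed_sum J c B) = signed_sum J (\<lambda>j. Re (c j)) B"
    and Im: "Im (signed_sum J c B) = signed_sum J (\<lambda>j. Im (c j)) B" for B
    by (auto simp: signed_sum_def intro!: sum.cong)
  have RA: "R \<le> A" "I \<le> A"
    unfolding R_def I_def A_def L2_set_def
    by (auto intro!: sum_mono simp: cmod_power2)
  note K = khintchine_real[OF J p, of "\<lambda>j. Re (c j)", folded R_def] khintchine_real[OF J p, of "\<lambda>j. Im (c j)", folded I_def]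
  have "(\<Sum>B\<in>Pow J. cmod (signed_sum J c B) powr p)
      \<le> (\<Sum>B\<in>Pow J. 2 powr p * (\<bar>Re (signed_sum J c B)\<bar> powr p + \<bar>Im (signed_sum J c B)\<bar> powr p))"
  proof (rule sum_mono)
    fix B
    have "cmod (signed_sum J c B) powr p \<le> (\<bar>Re (signed_sum J c B)\<bar> + \<bar>Im (signed_sum J c B)\<bar>) powr p"
      using p by (intro powr_mono2 cmod_le) auto
    also have "\<dots> \<le> 2 powr p * (\<bar>Re (signed_sum J c B)\<bar> powr p + \<bar>Im (signed_sum J c B)\<bar> powr p)"
      using p by (intro powr_add_le_double) auto
    finally show "cmod (signed_sum J c B) powr p
        \<le> 2 powr p * (\<bar>Re (signed_sum J c B)\<bar> powr p + \<bar>Im (signed_sum J c B)\<bar> powr p)" .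
  qed
  also have "\<dots> = 2 powr p * ((\<Sum>B\<in>Pow J. \<bar>signed_sum J (\<lambda>j. Re (c j)) B\<bar> powr p)
      + (\<Sum>B\<in>Pow J. \<bar>signed_sum J (\<lambda>j. Im (c j)) B\<bar> powr p))"
    by (simp add: Re Im sum.distrib flip: sum_distrib_left)
  also have "\<dots> \<le> 2 powr p * (2 ^ card J * (6 * p powr p) * A powr p + 2 ^ card J * (6 * p powr p) * A powr p)"
  proof (intro mult_left_mono add_mono)
    show "(\<Sum>B\<in>Pow J. \<bar>signed_sum J (\<lambda>j. Re (c j)) B\<bar> powr p) \<le> 2 ^ card J * (6 * p powr p) * A powr p"
      by (rule order_trans[OF K(1)]) (use p RA nn in \<open>auto intro!: mult_left_mono powr_mono2\<close>)
    show "(\<Sum>B\<in>Pow J. \<bar>signed_sum J (\<lambda>j. Im (c j)) B\<bar> powr p) \<le> 2 ^ card J * (6 * p powr p) * A powr p"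
      by (rule order_trans[OF K(3)]) (use p RA nn in \<open>auto intro!: mult_left_mono powr_mono2\<close>)
  qed auto
  finally show "(\<Sum>B\<in>Pow J. cmod (signed_sum J c B) powr p)
      \<le> 2 ^ card J * (2 * 2 powr p * (6 * p powr p)) * L2_set (\<lambda>j. cmod (c j)) J powr p"
    by (simp add: A_def mult_ac)
  have "A\<^sup>2 = R\<^sup>2 + I\<^sup>2"
    by (simp add: A_def R_def I_def L2_set_def sum_nonneg cmod_power2 sum.distrib)
  then have "A / 2 \<le> R \<or> A / 2 \<le> I"
  proof -
    assume *: "A\<^sup>2 = R\<^sup>2 + I\<^sup>2"
    show ?thesis
    proof (rule ccontr)
      assume "\<not> ?thesis"
      then have "R\<^sup>2 \<le> (A/2)\<^sup>2" "I\<^sup>2 \<le> (A/2)\<^sup>2" "0 < A" using nn by (auto intro!: power_mono)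
      moreover from this have "0 < A\<^sup>2" by simp
      ultimately show False using * by (simp add: power_divide)
    qed
  qed
  moreover have "2 ^ card J * (1/256) powr p * A powr p \<le> (\<Sum>B\<in>Pow J. cmod (signed_sum J c B) powr p)"
    if le: "A / 2 \<le> Q" and h: "\<And>z. \<bar>h z\<bar> \<le> cmod z"
      and Q: "2 ^ card J * (1/128) powr p * Q powr p \<le> (\<Sum>B\<in>Pow J. \<bar>h (signed_sum J c B)\<bar> powr p)" for Q h
  proof -
    have "2 ^ card J * (1/256) powr p * A powr p = 2 ^ card J * (1/128) powr p * (A/2) powr p"
      using nn by (simp add: powr_divide flip: powr_mult)
    also have "\<dots> \<le> 2 ^ card J * (1/128) powr p * Q powr p"
      using le nn p by (intro mult_left_mono powr_mono2) auto
    also note Q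
    also have "(\<Sum>B\<in>Pow J. \<bar>h (signed_sum J c B)\<bar> powr p) \<le> (\<Sum>B\<in>Pow J. cmod (signed_sum J c B) powr p)"
      using p h by (intro sum_mono powr_mono2) auto
    finally show ?thesis .
  qed
  ultimately show "2 ^ card J * (1/256) powr p * L2_set (\<lambda>j. cmod (c j)) J powr p
      \<le> (\<Sum>B\<in>Pow J. cmod (signed_sum J c B) powr p)"
    using K(2,4) abs_Re_le_cmod abs_Im_le_cmod unfolding A_def Re[symmetric] Im[symmetric] by blast
qed

section \<open>Transference\<close>

definition left_shift :: "('a, 'b) monoid_scheme \<Rightarrow> 'a \<Rightarrow> 'a \<Rightarrow> 'a" where
  "left_shift G g h = inv\<^bsub>G\<^esub> g \<otimes>\<^bsub>G\<^esub> h"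

definition right_shift :: "('a, 'b) monoid_scheme \<Rightarrow> 'a \<Rightarrow> 'a \<Rightarrow> 'a" where
  "right_shift G g h = h \<otimes>\<^bsub>G\<^esub> inv\<^bsub>G\<^esub> g"

lemma (in group) permutes_carrier_left: "permutes_carrier G (left_shift G)"
  unfolding permutes_carrier_def
proof
  fix g assume g: "g \<in> carrier G"
  show "bij_betw (left_shift G g) (carrier G) (carrier G)"
    by (rule bij_betw_byWitness[where f'="\<lambda>x. g \<otimes> x"])
      (use g in \<open>auto simp: left_shift_def m_assoc[symmetric]\<close>)
qed

lemma (in group) permutes_carrier_right: "permutes_carrier G (right_shift G)"
  unfolding permutes_carrier_def
proof
  fix g assume g: "g \<in> carrier G"
  show "bij_betw (right_shift G g) (carrier G) (carrier G)"
    by (rule bij_betw_byWitness[where f'="\<lambda>x. x \<otimes> g"])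
      (use g in \<open>auto simp: right_shift_def m_assoc\<close>)
qed

lemma L2_set_sum_le:
  assumes "finite E"
  shows "L2_set (\<lambda>j. \<Sum>g\<in>E. u g j) J \<le> (\<Sum>g\<in>E. L2_set (u g) J)"
  using assms
proof (induction E rule: finite_induct)
  case empty then show ?case by (simp add: L2_set_def)
next
  case (insert g E)
  have "L2_set (\<lambda>j. \<Sum>g\<in>insert g E. u g j) J = L2_set (\<lambda>j. u g j + (\<Sum>g\<in>E. u g j)) J"
    using insert.hyps by simp
  also have "\<dots> \<le> L2_set (u g) J + L2_set (\<lambda>j. \<Sum>g\<in>E. u g j) J" by (rule L2_set_triangle_ineq)
  finally show ?case using insert by simp
qed

text \<open>Every term is at most the maximum. The crude factor ends up in the error term of the
  transference, which tends to 0.\<close>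

lemma sum_powr_le:
  fixes t :: "'i \<Rightarrow> real"
  assumes "finite E" "0 \<le> p" "\<And>g. 0 \<le> t g"
  shows "(\<Sum>g\<in>E. t g) powr p \<le> real (card E) powr p * (\<Sum>g\<in>E. t g powr p)"
proof (cases "E = {}")
  case False
  define M where "M = Max (t ` E)"
  have "M \<in> t ` E" using assms False by (simp add: M_def)
  then obtain g where g: "g \<in> E" "M = t g" by blast
  have "(\<Sum>g\<in>E. t g) \<le> (\<Sum>g\<in>E. M)" using assms by (intro sum_mono) (simp add: M_def)
  then have "(\<Sum>g\<in>E. t g) powr p \<le> (card E * M) powr p"
    using assms by (intro powr_mono2) (auto simp: sum_nonneg)
  also have "\<dots> = real (card E) powr p * t g powr p" using assms g by (simp add: powr_mult)
  also have "t g powr p \<le> (\<Sum>g\<in>E. t g powr p)"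
    using assms g by (intro member_le_sum) auto
  finally show ?thesis by (simp add: mult_left_mono)
qed simp

text \<open>The function t^p is superadditive, so (t - s)^p \<le> t^p - s^p for s \<le> t. This
  passes from l^1 almost invariance of \<phi> to l^p almost invariance of its p-th root.\<close>

lemma powr_inverse_diff_le:
  fixes u v p :: real
  assumes p: "1 \<le> p" and "0 \<le> u" "0 \<le> v"
  shows "\<bar>u powr (1/p) - v powr (1/p)\<bar> powr p \<le> \<bar>u - v\<bar>"
proof -
  have *: "\<bar>u powr (1/p) - v powr (1/p)\<bar> powr p \<le> \<bar>u - v\<bar>" if uv: "0 \<le> u" "u \<le> v" for u v :: real
  proof -
    define s t where "s = u powr (1/p)" and "t = v powr (1/p)"
    have st: "0 \<le> s" "s \<le> t" using uv p by (auto simp: s_def t_def powr_mono2)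
    have "(t - s) powr p + s powr p \<le> t powr p"
    proof (cases "t = 0")
      case False
      then have t: "0 < t" using st by simp
      have le: "x powr p \<le> x * t powr (p - 1)" if "0 \<le> x" "x \<le> t" for x
      proof (cases "x = 0")
        case False
        then have "x powr p = x * x powr (p - 1)" using that by (simp add: powr_diff)
        also have "\<dots> \<le> x * t powr (p - 1)" using that p by (intro mult_left_mono powr_mono2) auto
        finally show ?thesis .
      qed (use p in simp)
      have "(t - s) powr p + s powr p \<le> (t - s) * t powr (p - 1) + s * t powr (p - 1)"
        using st by (intro add_mono le) auto
      also have "\<dots> = t * t powr (p - 1)" by (simp add: algebra_simps)
      also have "\<dots> = t powr p" using t by (simp add: powr_diff)
      finally show ?thesis .
    qed (use st in simp)
    moreover have "s powr p = u" "t powr p = v" using uv p by (simp_all add: s_def t_def powr_powr)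
    ultimately show ?thesis using st uv by (simp add: abs_minus_commute flip: s_def t_def)
  qed
  show ?thesis
  proof (cases "u \<le> v")
    case True then show ?thesis using * assms by blast
  next
    case False then show ?thesis using *[of v u] assms by (simp add: abs_minus_commute)
  qed
qed

text \<open>The p-th root of the quotient of the two complex Khintchine constants, with a further
  2^p from splitting off the error term. It depends on p alone and not on the support of
  \<open>a\<close>, which is what makes the approximation in \<open>transference\<close>
  possible.\<close>

definition transference_const :: "real \<Rightarrow> real" where
  "transference_const p = ((1/256) powr p / (2 powr p * (2 * 2 powr p * (6 * p powr p)))) powr (1/p)"

lemma transference_const_pos: "1 \<le> p \<Longrightarrow> 0 < transference_const p"
  by (simp add: transference_const_def)

context group begin

lemma conv_along_finite:
  assumes "finite E" "E \<subseteq> carrier G" "\<And>g. g \<notin> E \<Longrightarrow> a g = 0" "h \<in> carrier G"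
  shows "conv_along G \<tau> a \<xi> h = (\<Sum>g\<in>E. a g * \<xi> (\<tau> g h))"
proof -
  have "(\<Sum>\<^sub>\<infinity>g\<in>carrier G. a g * \<xi> (\<tau> g h)) = (\<Sum>g\<in>E. a g * \<xi> (\<tau> g h))"
    by (rule infsum_finite_support(1)[OF assms(1,2)]) (simp add: assms(3))
  then show ?thesis using assms(4) by (simp add: conv_along_def)
qed

lemma L2_set_translate_le:
  assumes f: "f \<in> lp G 2" and y: "y \<in> carrier G" and J: "finite J" "J \<subseteq> carrier G"
  shows "L2_set (\<lambda>j. cmod (f (y \<otimes> j))) J \<le> lp_norm G 2 f"
proof -
  have inj: "inj_on (\<lambda>j. y \<otimes> j) J" using y J by (auto simp: inj_on_def subset_iff)
  have "(\<Sum>j\<in>J. (cmod (f (y \<otimes> j)))\<^sup>2) = (\<Sum>k\<in>(\<lambda>j. y \<otimes> j) ` J. (cmod (f k))\<^sup>2)"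
    using inj by (simp add: sum.reindex)
  also have "\<dots> \<le> (lp_norm G 2 f)\<^sup>2"
  proof -
    have "(\<lambda>j. y \<otimes> j) ` J \<subseteq> carrier G" using J y by auto
    from sum_le_lp_norm[OF _ f _ this] show ?thesis using J by simp
  qed
  finally show ?thesis unfolding L2_set_def by (intro real_le_lsqrt) (auto simp: sum_nonneg)
qed

text \<open>Transference in the style of Coifman and Weiss: the vector \<open>f\<close> is spread along an almost invariant weight as
  the family \<open>x j h = \<phi> h powr (1/p) * f (h j)\<close>, to which the \<open>\<ell>\<^sup>p\<close> estimate is applied with random signs.\<close>

lemma transference_finite:
  assumes am: "amenable G" and p: "1 \<le> p"
    and E: "finite E" "E \<subseteq> carrier G" and aE: "\<And>g. g \<notin> E \<Longrightarrow> a g = 0" and c: "0 < c"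
    and below: "\<And>\<xi>. \<xi> \<in> lp G p \<Longrightarrow> c * lp_norm G p \<xi> \<le> lp_norm G p (conv_along G (left_shift G) a \<xi>)"
    and K: "finite K" "K \<subseteq> carrier G" and fK: "\<And>x. x \<notin> K \<Longrightarrow> f x = 0"
  shows "transference_const p * c * lp_norm G 2 f \<le> lp_norm G 2 (conv_along G (left_shift G) a f)"
proof -
  define L where "L = conv_along G (left_shift G) a"
  have a1: "a \<in> lp G 1" by (rule lp_finite_support(1)[OF E aE])
  have f2: "f \<in> lp G 2" by (rule lp_finite_support(1)[OF K fK])
  have Lf2: "L f \<in> lp G 2" unfolding L_def by (rule conv_along_lp[OF _ permutes_carrier_left a1 f2]) simp
  have L: "L \<xi> h = (\<Sum>g\<in>E. a g * \<xi> (inv g \<otimes> h))" if "h \<in> carrier G" for \<xi> h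
    unfolding L_def by (subst conv_along_finite[OF E aE that]) (simp_all add: left_shift_def)
  have Ecar: "g \<in> carrier G" if "g \<in> E" for g using E that by blast
  define N where "N = lp_norm G 2 f"
  define N' where "N' = lp_norm G 2 (L f)"
  have NN: "0 \<le> N" "0 \<le> N'" by (simp_all add: N_def N'_def)
  define kL kU M where "kL = (1/256::real) powr p" and "kU = 2 * 2 powr p * (6 * p powr p)"
    and "M = real (card E) powr p * (\<Sum>g\<in>E. cmod (a g) powr p)"
  have k: "0 < kL" "0 < kU" "0 \<le> M" using p by (auto simp: kL_def kU_def M_def sum_nonneg)
  \<comment> \<open>All dependence on E and on the size of \<open>a\<close> sits in M, next to
    \<epsilon>, and disappears as \<epsilon> tends to 0.\<close>
  have main: "c powr p * kL * N powr p \<le> kU * (2 powr p * (N' powr p + N powr p * (M * \<epsilon>)))"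
    if \<epsilon>: "0 < \<epsilon>" for \<epsilon>
  proof -
    \<comment> \<open>Almost invariance is requested under the inverses, because convolution
      evaluates the weight at inv g \<otimes> h.\<close>
    obtain F \<phi> where F: "finite F" "F \<subseteq> carrier G" and \<phi>0: "\<And>x. (0::real) \<le> \<phi> x" and \<phi>F: "\<And>x. x \<notin> F \<Longrightarrow> \<phi> x = 0"
      and \<phi>1: "(\<Sum>\<^sub>\<infinity>x\<in>carrier G. \<phi> x) = 1"
      and inv: "\<And>g. g \<in> (\<lambda>g. inv g) ` E \<Longrightarrow> (\<Sum>\<^sub>\<infinity>x\<in>carrier G. \<bar>\<phi> (g \<otimes> x) - \<phi> x\<bar>) \<le> \<epsilon>"
      by (rule reiter_finite_support[OF am, of "(\<lambda>g. inv g) ` E" \<epsilon>]) (use E \<epsilon> in auto)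
    define \<psi> where "\<psi> h = \<phi> h powr (1/p)" for h
    have \<psi>0: "0 \<le> \<psi> h" for h by (simp add: \<psi>_def)
    have \<psi>F: "\<psi> h = 0" if "h \<notin> F" for h using \<phi>F[OF that] by (simp add: \<psi>_def)
    have \<psi>p: "\<psi> h powr p = \<phi> h" for h using p \<phi>0 by (simp add: \<psi>_def powr_powr)
    \<comment> \<open>J contains inv h \<otimes> k for all h in F and k in K, so that for such h the
      values f (h \<otimes> j) with j in J carry the full l^2 norm of f.\<close>
    define J where "J = (\<lambda>(h, k). inv h \<otimes> k) ` (F \<times> K)"
    have J: "finite J" "J \<subseteq> carrier G" using F K by (auto simp: J_def)
    define n where "n = card J"
    define W where "W = F \<union> (\<lambda>(g, h). g \<otimes> h) ` (E \<times> F)"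
    have W: "finite W" "W \<subseteq> carrier G" using F E by (auto simp: W_def)
    have FW: "F \<subseteq> W" by (simp add: W_def)
    have shift0: "inv g \<otimes> h \<notin> F" if "g \<in> E" "h \<in> carrier G - W" for g h
    proof
      assume "inv g \<otimes> h \<in> F"
      moreover have "h = g \<otimes> (inv g \<otimes> h)" using Ecar[OF that(1)] that by (simp add: m_assoc[symmetric])
      ultimately have "h \<in> (\<lambda>(g, h). g \<otimes> h) ` (E \<times> F)"
        using that(1) by (intro image_eqI[of _ _ "(g, inv g \<otimes> h)"]) auto
      then show False using that by (simp add: W_def)
    qed
    define x where "x j h = complex_of_real (\<psi> h) * f (h \<otimes> j)" for j h
    define X where "X B h = signed_sum J (\<lambda>j. x j h) B" for B h
    have xF: "x j h = 0" if "h \<notin> F" for j h using \<psi>F[OF that] by (simp add: x_def)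
    have XF: "X B h = 0" if "h \<notin> F" for B h
      by (auto simp: X_def signed_sum_def xF[OF that] intro!: sum.neutral)
    have LX: "L (X B) h = signed_sum J (\<lambda>j. L (x j) h) B" if h: "h \<in> carrier G" for B h
    proof -
      have "L (X B) h = (\<Sum>g\<in>E. \<Sum>j\<in>J. a g * (if j \<in> B then x j (inv g \<otimes> h) else - x j (inv g \<otimes> h)))"
        by (simp add: L[OF h] X_def signed_sum_def sum_distrib_left)
      also have "\<dots> = (\<Sum>j\<in>J. \<Sum>g\<in>E. a g * (if j \<in> B then x j (inv g \<otimes> h) else - x j (inv g \<otimes> h)))"
        by (rule sum.swap)
      also have "\<dots> = signed_sum J (\<lambda>j. L (x j) h) B"
        unfolding signed_sum_def by (rule sum.cong) (auto simp: L[OF h] sum_negf)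
      finally show ?thesis .
    qed
    have LXW: "L (X B) h = 0" if "h \<notin> W" for B h
    proof (cases "h \<in> carrier G")
      case True
      then show ?thesis using shift0[of _ h] that XF by (auto simp: L[OF True] intro!: sum.neutral)
    qed (simp add: L_def conv_along_def)
    \<comment> \<open>The l^p estimate is applied once for each sign pattern B; summing over B later
      produces the square sums.\<close>
    have step: "c powr p * (\<Sum>h\<in>F. cmod (X B h) powr p) \<le> (\<Sum>h\<in>W. cmod (L (X B) h) powr p)" for B
    proof -
      have "(c * lp_norm G p (X B)) powr p \<le> lp_norm G p (L (X B)) powr p"
        using p c below[OF lp_finite_support(1)[OF F XF]] by (intro powr_mono2) (auto simp: L_def)
      then show ?thesis
        using c p by (simp add: powr_mult lp_finite_support(2)[OF F XF] lp_finite_support(2)[OF W LXW])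
    qed
    have N_eq: "L2_set (\<lambda>j. cmod (x j h)) J = \<psi> h * N" if h: "h \<in> F" for h
    proof -
      have hc: "h \<in> carrier G" using h F by blast
      have inj: "inj_on (\<lambda>k. inv h \<otimes> k) K" using hc K by (auto simp: inj_on_def subset_iff)
      have "(\<Sum>j\<in>J. (cmod (f (h \<otimes> j)))\<^sup>2) = (\<Sum>j\<in>(\<lambda>k. inv h \<otimes> k) ` K. (cmod (f (h \<otimes> j)))\<^sup>2)"
      proof (rule sum.mono_neutral_right[OF J(1)])
        show "(\<lambda>k. inv h \<otimes> k) ` K \<subseteq> J" using h by (auto simp: J_def)
        show "\<forall>j\<in>J - (\<lambda>k. inv h \<otimes> k) ` K. (cmod (f (h \<otimes> j)))\<^sup>2 = 0"
        proof
          fix j assume j: "j \<in> J - (\<lambda>k. inv h \<otimes> k) ` K"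
          then have "j \<in> carrier G" using J by blast
          then have "j = inv h \<otimes> (h \<otimes> j)" using hc by (simp add: m_assoc[symmetric])
          then have "h \<otimes> j \<notin> K" using j by blast
          then show "(cmod (f (h \<otimes> j)))\<^sup>2 = 0" by (simp add: fK)
        qed
      qed
      also have "\<dots> = (\<Sum>k\<in>K. (cmod (f (h \<otimes> (inv h \<otimes> k))))\<^sup>2)"
        by (simp add: sum.reindex[OF inj])
      also have "\<dots> = (\<Sum>k\<in>K. (cmod (f k))\<^sup>2)"
        using hc K by (intro sum.cong) (auto simp: m_assoc[symmetric])
      also have "\<dots> = N\<^sup>2"
        using lp_finite_support(2)[OF K fK, where p=2] by (simp add: N_def)
      finally have "L2_set (\<lambda>j. cmod (f (h \<otimes> j))) J = N" using NN by (simp add: L2_set_def)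
      moreover have "L2_set (\<lambda>j. cmod (x j h)) J = \<psi> h * L2_set (\<lambda>j. cmod (f (h \<otimes> j))) J"
        using \<psi>0 by (simp add: x_def norm_mult L2_set_right_distrib)
      ultimately show ?thesis by simp
    qed
    have \<phi>sum: "(\<Sum>h\<in>F. \<phi> h) = 1"
      using infsum_finite_support(1)[OF F, of \<phi>] \<phi>F \<phi>1 by simp
    have \<phi>W: "(\<Sum>h\<in>W. \<phi> h) = 1"
      using \<phi>sum sum.mono_neutral_left[OF W(1) FW, of \<phi>] \<phi>F by simp
    have lower: "2 ^ n * kL * N powr p \<le> (\<Sum>B\<in>Pow J. \<Sum>h\<in>F. cmod (X B h) powr p)"
    proof -
      have "2 ^ n * kL * N powr p = (\<Sum>h\<in>F. \<phi> h * (2 ^ n * kL * N powr p))"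
        by (simp add: \<phi>sum flip: sum_distrib_right)
      also have "\<dots> = (\<Sum>h\<in>F. 2 ^ n * kL * L2_set (\<lambda>j. cmod (x j h)) J powr p)"
        using NN \<psi>0 by (intro sum.cong) (auto simp: N_eq powr_mult \<psi>p)
      also have "\<dots> \<le> (\<Sum>h\<in>F. \<Sum>B\<in>Pow J. cmod (X B h) powr p)"
        unfolding X_def n_def kL_def by (intro sum_mono khintchine_complex(2) J p)
      finally show ?thesis by (subst sum.swap)
    qed
    have upper: "(\<Sum>B\<in>Pow J. \<Sum>h\<in>W. cmod (L (X B) h) powr p)
        \<le> 2 ^ n * kU * (2 powr p * (N' powr p + N powr p * (M * \<epsilon>)))"
    proof -
      define D where "D g h = \<bar>\<psi> (inv g \<otimes> h) - \<psi> h\<bar>" for g h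
      \<comment> \<open>Replace \<psi> (inv g \<otimes> h) by \<psi> h. The main term is then \<psi>
        h times L f at h \<otimes> j, because L commutes with right translations, and the rest is
        controlled by the increments D g h.\<close>
      have ptw: "L2_set (\<lambda>j. cmod (L (x j) h)) J \<le> \<psi> h * N' + N * (\<Sum>g\<in>E. cmod (a g) * D g h)"
        if h: "h \<in> carrier G" for h
      proof -
        have "cmod (L (x j) h) \<le> \<psi> h * cmod (L f (h \<otimes> j)) + (\<Sum>g\<in>E. (cmod (a g) * D g h) * cmod (f ((inv g \<otimes> h) \<otimes> j)))"
          if j: "j \<in> J" for j
        proof -
          have jc: "j \<in> carrier G" using j J by blast
          have "L (x j) h = (\<Sum>g\<in>E. a g * (complex_of_real (\<psi> (inv g \<otimes> h)) * f ((inv g \<otimes> h) \<otimes> j)))"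
            by (simp add: L[OF h] x_def)
          also have "\<dots> = (\<Sum>g\<in>E. complex_of_real (\<psi> h) * (a g * f (inv g \<otimes> (h \<otimes> j)))
              + a g * complex_of_real (\<psi> (inv g \<otimes> h) - \<psi> h) * f ((inv g \<otimes> h) \<otimes> j))"
            using h jc Ecar by (intro sum.cong) (auto simp: m_assoc algebra_simps)
          also have "\<dots> = complex_of_real (\<psi> h) * L f (h \<otimes> j)
              + (\<Sum>g\<in>E. a g * complex_of_real (\<psi> (inv g \<otimes> h) - \<psi> h) * f ((inv g \<otimes> h) \<otimes> j))"
            using h jc by (simp add: L sum.distrib sum_distrib_left)
          finally have "cmod (L (x j) h) \<le> cmod (complex_of_real (\<psi> h) * L f (h \<otimes> j))
              + cmod (\<Sum>g\<in>E. a g * complex_of_real (\<psi> (inv g \<otimes> h) - \<psi> h) * f ((inv g \<otimes> h) \<otimes> j))"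
            by (simp only: norm_triangle_ineq)
          also have "cmod (\<Sum>g\<in>E. a g * complex_of_real (\<psi> (inv g \<otimes> h) - \<psi> h) * f ((inv g \<otimes> h) \<otimes> j))
              \<le> (\<Sum>g\<in>E. cmod (a g * complex_of_real (\<psi> (inv g \<otimes> h) - \<psi> h) * f ((inv g \<otimes> h) \<otimes> j)))"
            by (rule norm_sum)
          also have "\<dots> = (\<Sum>g\<in>E. (cmod (a g) * D g h) * cmod (f ((inv g \<otimes> h) \<otimes> j)))"
            unfolding norm_mult norm_of_real D_def ..
          also have "cmod (complex_of_real (\<psi> h) * L f (h \<otimes> j)) = \<psi> h * cmod (L f (h \<otimes> j))"
            using \<psi>0 by (simp add: norm_mult)
          finally show ?thesis by simp
        qed
        then have "L2_set (\<lambda>j. cmod (L (x j) h)) J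
            \<le> L2_set (\<lambda>j. \<psi> h * cmod (L f (h \<otimes> j)) + (\<Sum>g\<in>E. (cmod (a g) * D g h) * cmod (f ((inv g \<otimes> h) \<otimes> j)))) J"
          by (intro L2_set_mono) auto
        also have "\<dots> \<le> L2_set (\<lambda>j. \<psi> h * cmod (L f (h \<otimes> j))) J
            + L2_set (\<lambda>j. \<Sum>g\<in>E. (cmod (a g) * D g h) * cmod (f ((inv g \<otimes> h) \<otimes> j))) J"
          by (rule L2_set_triangle_ineq)
        also have "\<dots> \<le> L2_set (\<lambda>j. \<psi> h * cmod (L f (h \<otimes> j))) J
            + (\<Sum>g\<in>E. L2_set (\<lambda>j. (cmod (a g) * D g h) * cmod (f ((inv g \<otimes> h) \<otimes> j))) J)"
          by (intro add_left_mono L2_set_sum_le E)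
        also have "\<dots> = \<psi> h * L2_set (\<lambda>j. cmod (L f (h \<otimes> j))) J
            + (\<Sum>g\<in>E. (cmod (a g) * D g h) * L2_set (\<lambda>j. cmod (f ((inv g \<otimes> h) \<otimes> j))) J)"
          using \<psi>0 by (simp add: L2_set_right_distrib D_def)
        also have "\<dots> \<le> \<psi> h * N' + (\<Sum>g\<in>E. (cmod (a g) * D g h) * N)"
          unfolding N_def N'_def using \<psi>0 h Ecar J
          by (intro add_mono sum_mono mult_left_mono L2_set_translate_le f2 Lf2) (auto simp: D_def)
        finally show ?thesis by (simp add: mult_ac flip: sum_distrib_left)
      qed
      have Dsum: "(\<Sum>h\<in>W. D g h powr p) \<le> \<epsilon>" if g: "g \<in> E" for g
      proof -
        have "(\<Sum>h\<in>W. D g h powr p) \<le> (\<Sum>h\<in>W. \<bar>\<phi> (inv g \<otimes> h) - \<phi> h\<bar>)"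
          unfolding D_def \<psi>_def using p \<phi>0 by (intro sum_mono powr_inverse_diff_le) auto
        also have "\<dots> = (\<Sum>\<^sub>\<infinity>h\<in>carrier G. \<bar>\<phi> (inv g \<otimes> h) - \<phi> h\<bar>)"
          by (rule infsum_finite_support(1)[OF W, symmetric]) (use shift0[OF g] \<phi>F FW in auto)
        also have "\<dots> \<le> \<epsilon>" using inv g by blast
        finally show ?thesis .
      qed
      have "(\<Sum>B\<in>Pow J. \<Sum>h\<in>W. cmod (L (X B) h) powr p) = (\<Sum>h\<in>W. \<Sum>B\<in>Pow J. cmod (L (X B) h) powr p)"
        by (rule sum.swap)
      also have "\<dots> \<le> (\<Sum>h\<in>W. 2 ^ n * kU * L2_set (\<lambda>j. cmod (L (x j) h)) J powr p)"
      proof (rule sum_mono)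
        fix h assume "h \<in> W"
        then have "h \<in> carrier G" using W by blast
        then show "(\<Sum>B\<in>Pow J. cmod (L (X B) h) powr p) \<le> 2 ^ n * kU * L2_set (\<lambda>j. cmod (L (x j) h)) J powr p"
          unfolding n_def kU_def by (simp only: LX) (rule khintchine_complex(1)[OF J(1) p])
      qed
      also have "\<dots> = 2 ^ n * kU * (\<Sum>h\<in>W. L2_set (\<lambda>j. cmod (L (x j) h)) J powr p)"
        by (simp add: sum_distrib_left)
      also have "(\<Sum>h\<in>W. L2_set (\<lambda>j. cmod (L (x j) h)) J powr p)
          \<le> (\<Sum>h\<in>W. 2 powr p * (\<phi> h * N' powr p + N powr p * (real (card E) powr p * (\<Sum>g\<in>E. cmod (a g) powr p * D g h powr p))))"
      proof (rule sum_mono)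
        fix h assume "h \<in> W"
        then have h: "h \<in> carrier G" using W by blast
        have s0: "0 \<le> (\<Sum>g\<in>E. cmod (a g) * D g h)" by (simp add: sum_nonneg D_def)
        have "L2_set (\<lambda>j. cmod (L (x j) h)) J powr p \<le> (\<psi> h * N' + N * (\<Sum>g\<in>E. cmod (a g) * D g h)) powr p"
          using p ptw[OF h] by (intro powr_mono2) (auto simp: L2_set_nonneg)
        also have "\<dots> \<le> 2 powr p * ((\<psi> h * N') powr p + (N * (\<Sum>g\<in>E. cmod (a g) * D g h)) powr p)"
          using p NN \<psi>0 s0 by (intro powr_add_le_double) auto
        also have "\<dots> = 2 powr p * (\<phi> h * N' powr p + N powr p * (\<Sum>g\<in>E. cmod (a g) * D g h) powr p)"
          using NN \<psi>0 s0 by (simp add: powr_mult \<psi>p)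
        also have "\<dots> \<le> 2 powr p * (\<phi> h * N' powr p + N powr p * (real (card E) powr p * (\<Sum>g\<in>E. (cmod (a g) * D g h) powr p)))"
          using p by (intro mult_left_mono add_left_mono sum_powr_le E) (auto simp: D_def)
        finally show "L2_set (\<lambda>j. cmod (L (x j) h)) J powr p
            \<le> 2 powr p * (\<phi> h * N' powr p + N powr p * (real (card E) powr p * (\<Sum>g\<in>E. cmod (a g) powr p * D g h powr p)))"
          by (simp add: powr_mult D_def)
      qed
      also have "\<dots> = 2 powr p * (N' powr p * (\<Sum>h\<in>W. \<phi> h) + N powr p * (real (card E) powr p * (\<Sum>g\<in>E. cmod (a g) powr p * (\<Sum>h\<in>W. D g h powr p))))"
      proof -
        have "(\<Sum>h\<in>W. \<Sum>g\<in>E. cmod (a g) powr p * D g h powr p) = (\<Sum>g\<in>E. cmod (a g) powr p * (\<Sum>h\<in>W. D g h powr p))"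
          by (subst sum.swap) (simp add: sum_distrib_left)
        moreover have "(\<Sum>h\<in>W. \<phi> h * N' powr p) = N' powr p * (\<Sum>h\<in>W. \<phi> h)"
          unfolding sum_distrib_left by (simp add: mult.commute)
        ultimately show ?thesis by (simp only: sum.distrib flip: sum_distrib_left)
      qed
      also have "\<dots> \<le> 2 powr p * (N' powr p * 1 + N powr p * (real (card E) powr p * (\<Sum>g\<in>E. cmod (a g) powr p * \<epsilon>)))"
        using Dsum by (intro mult_left_mono add_mono sum_mono) (auto simp: \<phi>W)
      also have "\<dots> = 2 powr p * (N' powr p + N powr p * (M * \<epsilon>))"
        by (simp add: M_def mult_ac flip: sum_distrib_right sum_distrib_left)
      finally show ?thesis using k by (simp add: mult_left_mono)
    qed
    have "c powr p * (2 ^ n * kL * N powr p) \<le> c powr p * (\<Sum>B\<in>Pow J. \<Sum>h\<in>F. cmod (X B h) powr p)"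
      using lower by (intro mult_left_mono) auto
    also have "\<dots> \<le> (\<Sum>B\<in>Pow J. \<Sum>h\<in>W. cmod (L (X B) h) powr p)"
      unfolding sum_distrib_left[of "c powr p" _ "Pow J"] by (intro sum_mono step)
    also note upper
    finally have "2 ^ n * (c powr p * kL * N powr p) \<le> 2 ^ n * (kU * (2 powr p * (N' powr p + N powr p * (M * \<epsilon>))))"
      by (simp only: mult_ac)
    then show ?thesis by simp
  qed
  have "c powr p * kL * N powr p \<le> kU * (2 powr p * N' powr p)"
  proof (rule field_le_epsilon)
    fix e :: real assume e: "0 < e"
    define d where "d = kU * (2 powr p * (N powr p * M))"
    have d0: "0 \<le> d" using k by (simp add: d_def)
    have "c powr p * kL * N powr p \<le> kU * (2 powr p * (N' powr p + N powr p * (M * (e / (d + 1)))))"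
      using e d0 by (intro main) simp
    also have "\<dots> = kU * (2 powr p * N' powr p) + d * (e / (d + 1))"
      by (simp add: d_def algebra_simps)
    also have "d * (e / (d + 1)) \<le> e" using d0 e by (simp add: field_simps)
    finally show "c powr p * kL * N powr p \<le> kU * (2 powr p * N' powr p) + e" by simp
  qed
  then have "kL / (2 powr p * kU) * c powr p * N powr p \<le> N' powr p"
    using k by (simp add: field_simps)
  then have "(kL / (2 powr p * kU) * c powr p * N powr p) powr (1/p) \<le> (N' powr p) powr (1/p)"
    using p k by (intro powr_mono2) auto
  moreover have "(q * c powr p * N powr p) powr (1/p) = q powr (1/p) * c * N" if "0 \<le> q" for q
    using that p c NN by (simp add: powr_mult powr_powr)
  moreover have "transference_const p = (kL / (2 powr p * kU)) powr (1/p)"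
    by (simp only: transference_const_def kL_def kU_def)
  moreover have "(N' powr p) powr (1/p) = N'" "0 \<le> kL / (2 powr p * kU)"
    using p k NN by (simp_all add: powr_powr)
  ultimately have "transference_const p * c * N \<le> N'" by metis
  then show ?thesis by (simp only: N_def N'_def L_def)
qed

end

lemma conv_along_diff_left:
  assumes p: "1 \<le> p" and a: "a \<in> lp G 1" and b: "b \<in> lp G 1" and \<xi>: "\<xi> \<in> lp G p"
  shows "conv_along G \<tau> (\<lambda>g. a g - b g) \<xi> = (\<lambda>x. conv_along G \<tau> a \<xi> x - conv_along G \<tau> b \<xi> x)"
proof
  fix h
  have "(\<lambda>g. a g * \<xi> (\<tau> g h)) summable_on carrier G" "(\<lambda>g. b g * \<xi> (\<tau> g h)) summable_on carrier G"
    by (rule abs_summable_summable[OF l1_mult_bounded_abs_summable(1)[OF a cmod_le_lp_norm[OF p \<xi>]]],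
        rule abs_summable_summable[OF l1_mult_bounded_abs_summable(1)[OF b cmod_le_lp_norm[OF p \<xi>]]])
  then have "((\<lambda>g. a g * \<xi> (\<tau> g h) + (-1) * (b g * \<xi> (\<tau> g h))) has_sum
      ((\<Sum>\<^sub>\<infinity>g\<in>carrier G. a g * \<xi> (\<tau> g h)) + (-1) * (\<Sum>\<^sub>\<infinity>g\<in>carrier G. b g * \<xi> (\<tau> g h)))) (carrier G)"
    by (intro has_sum_add has_sum_cmult_right) simp_all
  from infsumI[OF this]
  show "conv_along G \<tau> (\<lambda>g. a g - b g) \<xi> h = conv_along G \<tau> a \<xi> h - conv_along G \<tau> b \<xi> h"
    by (simp add: conv_along_def left_diff_distrib)
qed

section \<open>Point masses and the Hilbert space l^2\<close>

definition point_mass :: "'a \<Rightarrow> 'a \<Rightarrow> complex" where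
  "point_mass g = (\<lambda>x. if x = g then 1 else 0)"

lemma point_mass_lp:
  assumes "g \<in> carrier G"
  shows "point_mass g \<in> lp G p" and "1 \<le> p \<Longrightarrow> lp_norm G p (point_mass g) = 1"
proof -
  have *: "finite {g}" "{g} \<subseteq> carrier G" "\<And>x. x \<notin> {g} \<Longrightarrow> point_mass g x = 0"
    using assms by (auto simp: point_mass_def)
  show "point_mass g \<in> lp G p" by (rule lp_finite_support(1)[OF *])
  assume p: "1 \<le> p"
  have "lp_norm G p (point_mass g) powr p = 1"
    using lp_finite_support(2)[OF * p] by (simp add: point_mass_def)
  then have "(lp_norm G p (point_mass g) powr p) powr (1/p) = 1" by simp
  then show "lp_norm G p (point_mass g) = 1" using p by (simp add: powr_powr)
qed

lemma infsum_point:
  fixes f :: "'i \<Rightarrow> 'b::{topological_comm_monoid_add, t2_space}"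
  assumes "x \<in> X" "\<And>y. y \<in> X \<Longrightarrow> y \<noteq> x \<Longrightarrow> f y = 0"
  shows "infsum f X = f x"
  using infsum_finite_support(1)[of "{x}" X f] assms by auto

definition l2_inner :: "('a, 'b) monoid_scheme \<Rightarrow> ('a \<Rightarrow> complex) \<Rightarrow> ('a \<Rightarrow> complex) \<Rightarrow> complex" where
  "l2_inner G \<xi> \<eta> = (\<Sum>\<^sub>\<infinity>h\<in>carrier G. \<xi> h * cnj (\<eta> h))"

lemma lp_cnj: "\<xi> \<in> lp G p \<Longrightarrow> (\<lambda>x. cnj (\<xi> x)) \<in> lp G p"
  by (simp add: lp_def)

lemma l2_inner_self:
  assumes "\<xi> \<in> lp G 2"
  shows "l2_inner G \<xi> \<xi> = of_real ((lp_norm G 2 \<xi>)\<^sup>2)"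
proof -
  have "l2_inner G \<xi> \<xi> = (\<Sum>\<^sub>\<infinity>h\<in>carrier G. of_real ((cmod (\<xi> h))\<^sup>2))"
    unfolding l2_inner_def by (simp only: complex_norm_square)
  also have "\<dots> = of_real (\<Sum>\<^sub>\<infinity>h\<in>carrier G. (cmod (\<xi> h))\<^sup>2)"
  proof (rule infsumI)
    show "((\<lambda>h. complex_of_real ((cmod (\<xi> h))\<^sup>2)) has_sum of_real (\<Sum>\<^sub>\<infinity>h\<in>carrier G. (cmod (\<xi> h))\<^sup>2)) (carrier G)"
      by (rule has_sum_of_real, rule has_sum_infsum) (use lp_summable[OF assms] in simp)
  qed
  finally show ?thesis by (simp add: l2_norm_square)
qed

text \<open>Real multiples suffice: in \<open>l2_inverse\<close>, t is either a step size or
  1.\<close>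

lemma l2_norm_diff_square:
  assumes \<xi>: "\<xi> \<in> lp G 2" and \<eta>: "\<eta> \<in> lp G 2"
  shows "(lp_norm G 2 (\<lambda>x. \<xi> x - of_real t * \<eta> x))\<^sup>2
    = (lp_norm G 2 \<xi>)\<^sup>2 - 2 * t * Re (l2_inner G \<xi> \<eta>) + t\<^sup>2 * (lp_norm G 2 \<eta>)\<^sup>2"
proof -
  have hs: "((\<lambda>h. (cmod (\<zeta> h))\<^sup>2) has_sum (lp_norm G 2 \<zeta>)\<^sup>2) (carrier G)" if "\<zeta> \<in> lp G 2" for \<zeta>
    using has_sum_infsum[OF lp_summable[OF that]] by (simp add: l2_norm_square)
  have "(\<lambda>h. \<xi> h * cnj (\<eta> h)) summable_on carrier G"
    by (rule abs_summable_summable[OF l2_mult_abs_summable(1)[OF \<xi> lp_cnj[OF \<eta>]]])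
  then have "((\<lambda>h. Re (\<xi> h * cnj (\<eta> h))) has_sum Re (l2_inner G \<xi> \<eta>)) (carrier G)"
    unfolding l2_inner_def by (intro has_sum_Re) simp
  then have "((\<lambda>h. (cmod (\<xi> h))\<^sup>2 + (- 2 * t) * Re (\<xi> h * cnj (\<eta> h)) + t\<^sup>2 * (cmod (\<eta> h))\<^sup>2) has_sum
      ((lp_norm G 2 \<xi>)\<^sup>2 + (- 2 * t) * Re (l2_inner G \<xi> \<eta>) + t\<^sup>2 * (lp_norm G 2 \<eta>)\<^sup>2)) (carrier G)"
    by (intro has_sum_add has_sum_cmult_right hs \<xi> \<eta>)
  moreover have "(cmod (\<xi> h))\<^sup>2 + (- 2 * t) * Re (\<xi> h * cnj (\<eta> h)) + t\<^sup>2 * (cmod (\<eta> h))\<^sup>2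
      = (cmod (\<xi> h - of_real t * \<eta> h))\<^sup>2" for h
    by (simp only: cmod_power2) (simp add: power2_eq_square algebra_simps)
  ultimately have "((\<lambda>h. (cmod (\<xi> h - of_real t * \<eta> h))\<^sup>2) has_sum
      ((lp_norm G 2 \<xi>)\<^sup>2 + (- 2 * t) * Re (l2_inner G \<xi> \<eta>) + t\<^sup>2 * (lp_norm G 2 \<eta>)\<^sup>2)) (carrier G)"
    by simp
  then show ?thesis unfolding l2_norm_square[of G "\<lambda>x. \<xi> x - of_real t * \<eta> x"] by (simp add: infsumI)
qed

context group begin

abbreviation lconv :: "('a \<Rightarrow> complex) \<Rightarrow> ('a \<Rightarrow> complex) \<Rightarrow> ('a \<Rightarrow> complex)" where
  "lconv \<equiv> conv_along G (left_shift G)"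

abbreviation rconv :: "('a \<Rightarrow> complex) \<Rightarrow> ('a \<Rightarrow> complex) \<Rightarrow> ('a \<Rightarrow> complex)" where
  "rconv \<equiv> conv_along G (right_shift G)"

text \<open>Both \<open>a\<close> and f are approximated by finitely supported functions. The
  cut-off of \<open>a\<close> keeps half of the lower bound on l^p, whence c / 2; it is chosen after
  the cut-off of f, so its error can be made small against the norm of that function.\<close>

lemma transference:
  assumes am: "amenable G" and p: "1 \<le> p" and a: "a \<in> lp G 1" and c: "0 < c"
    and below: "\<And>\<xi>. \<xi> \<in> lp G p \<Longrightarrow> c * lp_norm G p \<xi> \<le> lp_norm G p (lconv a \<xi>)"
    and f: "f \<in> lp G 2"
  shows "transference_const p * (c / 2) * lp_norm G 2 f \<le> lp_norm G 2 (lconv a f)"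
proof -
  define \<kappa> where "\<kappa> = transference_const p * (c / 2)"
  have \<kappa>0: "0 < \<kappa>" using transference_const_pos[OF p] c by (simp add: \<kappa>_def)
  note bound = conv_along_lp[OF _ permutes_carrier_left]
  have fin: "\<kappa> * lp_norm G 2 f \<le> lp_norm G 2 (lconv a f)"
    if K: "finite K" "K \<subseteq> carrier G" "\<And>x. x \<notin> K \<Longrightarrow> f x = 0" for K f
  proof (rule field_le_epsilon)
    fix e :: real assume e: "0 < e"
    have f: "f \<in> lp G 2" by (rule lp_finite_support(1)[OF K])
    define N where "N = lp_norm G 2 f"
    \<comment> \<open>The first bound preserves the lower estimate c / 2 on l^p; the second keeps
      the l^2 error \<eta> * N below e.\<close>
    define \<eta> where "\<eta> = min (c / 2) (e / (N + 1))"
    have N0: "0 \<le> N" by (simp add: N_def)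
    have \<eta>: "0 < \<eta>" "\<eta> \<le> c / 2"
      using c e N0 by (simp add: \<eta>_def) (simp only: \<eta>_def min.cobounded1)
    have \<eta>N: "\<eta> * N \<le> e"
    proof -
      have "\<eta> * N \<le> (e / (N + 1)) * (N + 1)" using N0 e by (intro mult_mono) (auto simp: \<eta>_def)
      then show ?thesis using N0 by simp
    qed
    obtain E where E: "finite E" "E \<subseteq> carrier G"
      and near: "lp_norm G 1 (\<lambda>x. a x - (if x \<in> E then a x else 0)) \<le> \<eta>"
      by (rule lp_restrict_approx[OF _ a \<eta>(1)]) auto
    define b where "b x = (if x \<in> E then a x else 0)" for x
    have bE: "b g = 0" if "g \<notin> E" for g using that by (simp add: b_def)
    have b: "b \<in> lp G 1" by (rule lp_finite_support(1)[OF E bE])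
    have ab: "(\<lambda>x. a x - b x) \<in> lp G 1" by (rule lp_diff(1)[OF _ a b]) simp
    have near: "lp_norm G 1 (\<lambda>x. a x - b x) \<le> \<eta>" using near by (simp add: b_def)
    have close: "lp_norm G q (\<lambda>x. lconv a \<xi> x - lconv b \<xi> x) \<le> \<eta> * lp_norm G q \<xi>"
      if q: "1 \<le> q" and \<xi>: "\<xi> \<in> lp G q" for q \<xi>
    proof -
      have "lp_norm G q (lconv (\<lambda>x. a x - b x) \<xi>) \<le> lp_norm G 1 (\<lambda>x. a x - b x) * lp_norm G q \<xi>"
        by (rule bound(2)[OF q ab \<xi>])
      also have "\<dots> \<le> \<eta> * lp_norm G q \<xi>" using near by (intro mult_right_mono) auto
      finally show ?thesis by (simp add: conv_along_diff_left[OF q a b \<xi>])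
    qed
    have belowb: "c / 2 * lp_norm G p \<xi> \<le> lp_norm G p (lconv b \<xi>)" if \<xi>: "\<xi> \<in> lp G p" for \<xi>
    proof -
      have "c * lp_norm G p \<xi> \<le> lp_norm G p (lconv b \<xi>) + \<eta> * lp_norm G p \<xi>"
        using below[OF \<xi>] lp_norm_le_diff[OF p bound(1)[OF p a \<xi>] bound(1)[OF p b \<xi>]] close[OF p \<xi>] by linarith
      moreover have "\<eta> * lp_norm G p \<xi> \<le> c / 2 * lp_norm G p \<xi>" using \<eta> by (intro mult_right_mono) auto
      ultimately show ?thesis by simp
    qed
    have "\<kappa> * N \<le> lp_norm G 2 (lconv b f)"
      unfolding \<kappa>_def N_def by (rule transference_finite[OF am p E bE _ belowb K]) (use c in auto)
    also have "\<dots> \<le> lp_norm G 2 (lconv a f) + \<eta> * N"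
      using lp_norm_le_diff[OF _ bound(1)[OF _ b f] bound(1)[OF _ a f]] close[OF _ f]
        lp_norm_commute[of G 2 "lconv b f" "lconv a f"] by (simp add: N_def)
    finally show "\<kappa> * lp_norm G 2 f \<le> lp_norm G 2 (lconv a f) + e" using \<eta>N by (simp add: N_def)
  qed
  have "\<kappa> * lp_norm G 2 f \<le> lp_norm G 2 (lconv a f)"
  proof (rule field_le_epsilon)
    fix e :: real assume e: "0 < e"
    define A where "A = lp_norm G 1 a"
    \<comment> \<open>The error \<delta> enters twice: times \<kappa> through the norm of f, and
      times A through the norm of its image.\<close>
    define \<delta> where "\<delta> = e / (\<kappa> + A + 1)"
    have A0: "0 \<le> A" by (simp add: A_def)
    have \<delta>: "0 < \<delta>" "(\<kappa> + A) * \<delta> \<le> e" using A0 \<kappa>0 e by (auto simp: \<delta>_def field_simps)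
    obtain K where K: "finite K" "K \<subseteq> carrier G"
      and near: "lp_norm G 2 (\<lambda>x. f x - (if x \<in> K then f x else 0)) \<le> \<delta>"
      by (rule lp_restrict_approx[OF _ f \<delta>(1)]) auto
    define h where "h x = (if x \<in> K then f x else 0)" for x
    have hK: "h x = 0" if "x \<notin> K" for x using that by (simp add: h_def)
    have h: "h \<in> lp G 2" by (rule lp_finite_support(1)[OF K hK])
    have near: "lp_norm G 2 (\<lambda>x. f x - h x) \<le> \<delta>" using near by (simp add: h_def)
    have fh: "(\<lambda>x. f x - h x) \<in> lp G 2" by (rule lp_diff(1)[OF _ f h]) simp
    have "\<kappa> * lp_norm G 2 f \<le> \<kappa> * (lp_norm G 2 h + \<delta>)"
      using \<kappa>0 near lp_norm_le_diff[OF _ f h] by (intro mult_left_mono) auto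
    also have "\<dots> \<le> lp_norm G 2 (lconv a h) + \<kappa> * \<delta>"
      using fin[OF K hK] by (simp add: algebra_simps)
    also have "lp_norm G 2 (lconv a h) \<le> lp_norm G 2 (lconv a f) + lp_norm G 2 (lconv a (\<lambda>x. f x - h x))"
      using lp_norm_le_diff[OF _ bound(1)[OF _ a h] bound(1)[OF _ a f]]
        lp_norm_commute[of G 2 "lconv a h" "lconv a f"] conv_along_diff[OF _ permutes_carrier_left a f h] by simp
    also have "lp_norm G 2 (lconv a (\<lambda>x. f x - h x)) \<le> A * \<delta>"
      using bound(2)[OF _ a fh] mult_left_mono[OF near A0] by (simp add: A_def)
    finally show "\<kappa> * lp_norm G 2 f \<le> lp_norm G 2 (lconv a f) + e" using \<delta>(2) by (simp add: algebra_simps)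
  qed
  then show ?thesis by (simp add: \<kappa>_def)
qed

section \<open>The adjoint and inversion on l^2\<close>

definition l1_star :: "('a \<Rightarrow> complex) \<Rightarrow> ('a \<Rightarrow> complex)" where
  "l1_star a = (\<lambda>g. if g \<in> carrier G then cnj (a (inv g)) else 0)"

lemma bij_betw_inv_carrier: "bij_betw (\<lambda>g. inv g) (carrier G) (carrier G)"
  by (rule bij_betw_byWitness[where f'="\<lambda>g. inv g"]) auto

lemma l1_star:
  assumes a: "a \<in> lp G 1"
  shows "l1_star a \<in> lp G 1" "lp_norm G 1 (l1_star a) = lp_norm G 1 a"
proof -
  have norm: "lp_norm G 1 (\<lambda>x. cnj (a x)) = lp_norm G 1 a" by (simp add: lp_norm_def)
  show "l1_star a \<in> lp G 1" "lp_norm G 1 (l1_star a) = lp_norm G 1 a"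
    using lp_reindex[OF _ bij_betw_inv_carrier lp_cnj[OF a]] by (simp_all add: l1_star_def norm)
qed

text \<open>Transpose against the conjugate of \<eta>, then reindex by inversion, which turns g
  \<otimes> h into inv g \<otimes> h and \<open>a\<close> into \<open>l1_star a\<close>.\<close>

lemma l2_inner_lconv:
  assumes a: "a \<in> lp G 1" and \<xi>: "\<xi> \<in> lp G 2" and \<eta>: "\<eta> \<in> lp G 2"
  shows "l2_inner G (lconv a \<xi>) \<eta> = l2_inner G \<xi> (lconv (l1_star a) \<eta>)"
proof -
  have "l2_inner G (lconv a \<xi>) \<eta> = (\<Sum>\<^sub>\<infinity>h\<in>carrier G. \<xi> h * conv_along G (\<lambda>g h. g \<otimes> h) a (\<lambda>x. cnj (\<eta> x)) h)"
    unfolding l2_inner_def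
    by (rule conv_along_transpose[OF permutes_carrier_left a \<xi> lp_cnj[OF \<eta>]])
      (auto simp: left_shift_def m_assoc[symmetric])
  also have "\<dots> = l2_inner G \<xi> (lconv (l1_star a) \<eta>)"
    unfolding l2_inner_def
  proof (rule infsum_cong)
    fix h assume h: "h \<in> carrier G"
    have "lconv (l1_star a) \<eta> h = (\<Sum>\<^sub>\<infinity>g\<in>carrier G. l1_star a g * \<eta> (inv g \<otimes> h))"
      using h by (simp add: conv_along_def left_shift_def)
    also have "\<dots> = (\<Sum>\<^sub>\<infinity>g\<in>carrier G. l1_star a (inv g) * \<eta> (inv (inv g) \<otimes> h))"
      by (rule infsum_reindex_bij_betw[OF bij_betw_inv_carrier, symmetric])
    also have "\<dots> = (\<Sum>\<^sub>\<infinity>g\<in>carrier G. cnj (a g * cnj (\<eta> (g \<otimes> h))))"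
      by (rule infsum_cong) (simp add: l1_star_def)
    also have "\<dots> = cnj (conv_along G (\<lambda>g h. g \<otimes> h) a (\<lambda>x. cnj (\<eta> x)) h)"
      unfolding infsum_cnj using h by (simp add: conv_along_def)
    finally show "\<xi> h * conv_along G (\<lambda>g h. g \<otimes> h) a (\<lambda>x. cnj (\<eta> x)) h = \<xi> h * cnj (lconv (l1_star a) \<eta> h)"
      by simp
  qed
  finally show ?thesis .
qed

lemma lconv_point_mass_one:
  assumes "a \<in> lp G p"
  shows "lconv a (point_mass \<one>) = a"
proof
  fix h show "lconv a (point_mass \<one>) h = a h"
  proof (cases "h \<in> carrier G")
    case True
    have "(\<Sum>\<^sub>\<infinity>g\<in>carrier G. a g * point_mass \<one> (inv g \<otimes> h)) = a h * point_mass \<one> (inv h \<otimes> h)"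
    proof (rule infsum_point[OF True])
      fix g assume "g \<in> carrier G" "g \<noteq> h"
      then have "inv g \<otimes> h \<noteq> \<one>" using True by (metis inv_closed inv_comm inv_equality inv_inv)
      then show "a g * point_mass \<one> (inv g \<otimes> h) = 0" by (simp add: point_mass_def)
    qed
    then show ?thesis using True by (simp add: conv_along_def left_shift_def point_mass_def)
  qed (use lp_outside[OF assms] in \<open>simp add: conv_along_def\<close>)
qed

lemma rconv_point_mass_one:
  assumes "a \<in> lp G p"
  shows "rconv a (point_mass \<one>) = a"
proof
  fix h show "rconv a (point_mass \<one>) h = a h"
  proof (cases "h \<in> carrier G")
    case True
    have "(\<Sum>\<^sub>\<infinity>g\<in>carrier G. a g * point_mass \<one> (h \<otimes> inv g)) = a h * point_mass \<one> (h \<otimes> inv h)"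
    proof (rule infsum_point[OF True])
      fix g assume "g \<in> carrier G" "g \<noteq> h"
      then have "h \<otimes> inv g \<noteq> \<one>" using True by (metis inv_closed inv_equality inv_inv)
      then show "a g * point_mass \<one> (h \<otimes> inv g) = 0" by (simp add: point_mass_def)
    qed
    then show ?thesis using True by (simp add: conv_along_def right_shift_def point_mass_def)
  qed (use lp_outside[OF assms] in \<open>simp add: conv_along_def\<close>)
qed

lemma lconv_rconv_commute:
  assumes p: "1 \<le> p" and a: "a \<in> lp G 1" and b: "b \<in> lp G 1" and \<xi>: "\<xi> \<in> lp G p"
  shows "lconv a (rconv b \<xi>) = rconv b (lconv a \<xi>)"
  by (rule conv_along_commute[OF p permutes_carrier_left a permutes_carrier_right b \<xi>])
    (simp add: left_shift_def right_shift_def m_assoc)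

text \<open>The solution \<open>s\<close> of the normal equation \<open>a\<^sup>* * a * s = a\<^sup>*\<close> satisfies \<open>s * a = \<delta>\<close> by injectivity of
  \<open>a\<^sup>* * a\<close>. Traciality gives \<open>(a * s)(1) = (s * a)(1) = 1\<close>, and since \<open>a * s\<close> is the orthogonal projection of
  \<open>\<delta>\<close> to the range, this forces \<open>a * s = \<delta>\<close>.\<close>

lemma l2_inverse:
  assumes a: "a \<in> lp G 1" and c: "0 < c"
    and below: "\<And>f. f \<in> lp G 2 \<Longrightarrow> c * lp_norm G 2 f \<le> lp_norm G 2 (lconv a f)"
  obtains s where "s \<in> lp G 2" "lconv a s = point_mass \<one>"
proof -
  define A where "A = lconv a"
  define A' where "A' = lconv (l1_star a)"
  define \<delta> where "\<delta> = point_mass \<one>"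
  define N where "N = lp_norm G 2"
  have \<delta>: "\<delta> \<in> lp G 2" "N \<delta> = 1" using point_mass_lp[of \<one> G 2] by (auto simp: \<delta>_def N_def)
  note a' = l1_star[OF a]
  have two: "(1::real) \<le> 2" by simp
  have A: "A \<xi> \<in> lp G 2" and A': "A' \<xi> \<in> lp G 2" "N (A' \<xi>) \<le> lp_norm G 1 a * N \<xi>" if "\<xi> \<in> lp G 2" for \<xi>
    using conv_along_lp[OF two permutes_carrier_left a that] conv_along_lp[OF two permutes_carrier_left a'(1) that] a'(2)
    by (auto simp: A_def A'_def N_def)
  have A_diff: "A (\<lambda>x. \<xi> x - \<eta> x) = (\<lambda>x. A \<xi> x - A \<eta> x)"
    and A'_diff: "A' (\<lambda>x. \<xi> x - \<eta> x) = (\<lambda>x. A' \<xi> x - A' \<eta> x)" if "\<xi> \<in> lp G 2" "\<eta> \<in> lp G 2" for \<xi> \<eta>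
    unfolding A_def A'_def using that
    by (rule conv_along_diff[OF two permutes_carrier_left a], rule conv_along_diff[OF two permutes_carrier_left a'(1)])
  have adj: "l2_inner G (A \<xi>) \<eta> = l2_inner G \<xi> (A' \<eta>)" if "\<xi> \<in> lp G 2" "\<eta> \<in> lp G 2" for \<xi> \<eta>
    unfolding A_def A'_def by (rule l2_inner_lconv[OF a that])
  have form: "l2_inner G \<xi> (A' (A \<xi>)) = of_real ((N (A \<xi>))\<^sup>2)" if "\<xi> \<in> lp G 2" for \<xi>
    using adj[OF that A[OF that]] by (simp add: l2_inner_self[OF A[OF that]] N_def)
  have A'\<delta>: "A' \<delta> = l1_star a" unfolding A'_def \<delta>_def by (rule lconv_point_mass_one[OF a'(1)])
  have star2: "l1_star a \<in> lp G 2" by (rule lp_mono[OF _ _ a'(1)]) auto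
  define \<alpha> where "\<alpha> = lp_norm G 1 a"
  \<comment> \<open>The step size of the iteration below: t times the squared operator bound
    \<alpha>^2 is at most 1. The summand 1 covers \<alpha> = 0.\<close>
  define t where "t = 1 / (\<alpha>\<^sup>2 + 1)"
  have t: "0 < t" "t * \<alpha>\<^sup>2 \<le> 1" by (auto simp: t_def field_simps add_pos_nonneg intro!: add_nonneg_pos)
  \<comment> \<open>The maximum keeps the argument of the root nonnegative without a comparison of c
    and \<alpha>.\<close>
  define k where "k = sqrt (max 0 (1 - t * c\<^sup>2))"
  have k: "0 \<le> k" "k < 1" using t c by (auto simp: k_def)
  \<comment> \<open>In the expansion of the square the quadratic term consumes at most half of the
    linear term 2 * t * x^2, by the choice of t; the other half is bounded below through
    \<open>below\<close>.\<close>
  have contr: "N (\<lambda>x. \<xi> x - of_real t * A' (A \<xi>) x) \<le> k * N \<xi>" if \<xi>: "\<xi> \<in> lp G 2" for \<xi>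
  proof -
    define x where "x = N (A \<xi>)"
    have "c * N \<xi> \<le> x" using below[OF \<xi>] by (simp add: x_def A_def N_def)
    then have x: "c\<^sup>2 * (N \<xi>)\<^sup>2 \<le> x\<^sup>2"
      unfolding power_mult_distrib[symmetric] using c by (intro power_mono) (auto simp: N_def)
    have "(N (A' (A \<xi>)))\<^sup>2 \<le> (\<alpha> * x)\<^sup>2"
      using A'(2)[OF A[OF \<xi>]] by (intro power_mono) (auto simp: \<alpha>_def x_def N_def)
    then have "t\<^sup>2 * (N (A' (A \<xi>)))\<^sup>2 \<le> t\<^sup>2 * (\<alpha> * x)\<^sup>2" by (intro mult_left_mono) auto
    also have "\<dots> = (t * \<alpha>\<^sup>2) * (t * x\<^sup>2)" by (simp add: power2_eq_square)
    also have "\<dots> \<le> 1 * (t * x\<^sup>2)" using t by (intro mult_right_mono) auto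
    finally have 1: "t\<^sup>2 * (N (A' (A \<xi>)))\<^sup>2 \<le> t * x\<^sup>2" by simp
    have "(N (\<lambda>x. \<xi> x - of_real t * A' (A \<xi>) x))\<^sup>2 = (N \<xi>)\<^sup>2 - 2 * t * x\<^sup>2 + t\<^sup>2 * (N (A' (A \<xi>)))\<^sup>2"
      unfolding N_def using l2_norm_diff_square[OF \<xi> A'(1)[OF A[OF \<xi>]], of t] form[OF \<xi>] by (simp add: x_def N_def)
    also have "\<dots> \<le> (N \<xi>)\<^sup>2 - t * x\<^sup>2" using 1 by simp
    also have "\<dots> \<le> (N \<xi>)\<^sup>2 - t * (c\<^sup>2 * (N \<xi>)\<^sup>2)" using t x by (intro diff_mono mult_left_mono) auto
    also have "\<dots> = (1 - t * c\<^sup>2) * (N \<xi>)\<^sup>2" by (simp add: algebra_simps)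
    also have "\<dots> \<le> max 0 (1 - t * c\<^sup>2) * (N \<xi>)\<^sup>2" by (intro mult_right_mono) auto
    also have "\<dots> = (k * N \<xi>)\<^sup>2" by (simp add: k_def power_mult_distrib)
    finally show ?thesis by (rule power2_le_imp_le) (use k in \<open>simp add: N_def\<close>)
  qed
  interpret M: Metric_space "lp G 2" "\<lambda>\<xi> \<eta>. lp_norm G 2 (\<lambda>x. \<xi> x - \<eta> x)"
    by (rule Metric_space_lp[OF two])
  \<comment> \<open>Gradient iteration for the normal equation. The contraction principle replaces
    the inversion of the positive operator A' A.\<close>
  define \<Phi> where "\<Phi> \<xi> x = \<xi> x - of_real t * (A' (A \<xi>) x - l1_star a x)" for \<xi> x
  obtain s where s: "s \<in> lp G 2" "\<Phi> s = s"
  proof (rule M.Banach_fixedpoint_thm[OF mcomplete_lp[OF two] _ _ k(2), of \<Phi>])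
    show "lp G 2 \<noteq> {}" using \<delta> by blast
    show "\<Phi> \<in> lp G 2 \<rightarrow> lp G 2"
    proof
      fix \<xi> assume \<xi>: "\<xi> \<in> lp G 2"
      show "\<Phi> \<xi> \<in> lp G 2"
        unfolding \<Phi>_def by (intro lp_diff(1)[OF two] lp_scale \<xi> A' A star2)
    qed
    fix \<xi> \<eta> assume \<xi>\<eta>: "\<xi> \<in> lp G 2" "\<eta> \<in> lp G 2"
    have "A' (A (\<lambda>x. \<xi> x - \<eta> x)) = (\<lambda>x. A' (A \<xi>) x - A' (A \<eta>) x)"
      using \<xi>\<eta> by (simp add: A_diff A'_diff A)
    then have "(\<lambda>x. \<Phi> \<xi> x - \<Phi> \<eta> x) = (\<lambda>x. (\<xi> x - \<eta> x) - of_real t * A' (A (\<lambda>x. \<xi> x - \<eta> x)) x)"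
      by (simp add: \<Phi>_def algebra_simps)
    then show "lp_norm G 2 (\<lambda>x. \<Phi> \<xi> x - \<Phi> \<eta> x) \<le> k * lp_norm G 2 (\<lambda>x. \<xi> x - \<eta> x)"
      using contr[OF lp_diff(1)[OF two \<xi>\<eta>]] by (simp add: N_def)
  qed blast
  have normal: "A' (A s) = l1_star a"
  proof
    fix x
    have "\<Phi> s x = s x" using s(2) by simp
    then show "A' (A s) x = l1_star a x" using t unfolding \<Phi>_def by simp
  qed
  \<comment> \<open>The product s * a. Right convolution by \<open>a\<close> commutes with A and A',
    so the normal equation gives A' (A w) = A' (A \<delta>).\<close>
  define w where "w = rconv a s"
  have w: "w \<in> lp G 2" unfolding w_def by (rule conv_along_lp(1)[OF two permutes_carrier_right a s(1)])
  have "A' (A w) = rconv a (A' (A s))"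
    unfolding w_def A_def A'_def using s(1) A[OF s(1)]
    by (simp add: lconv_rconv_commute[OF two a a] lconv_rconv_commute[OF two a'(1) a] A_def)
  also have "\<dots> = rconv a (A' \<delta>)" by (simp add: normal A'\<delta>)
  also have "\<dots> = A' (rconv a \<delta>)"
    unfolding A'_def by (rule lconv_rconv_commute[OF two a'(1) a \<delta>(1), symmetric])
  also have "rconv a \<delta> = A \<delta>"
    unfolding A_def \<delta>_def by (simp add: rconv_point_mass_one[OF a] lconv_point_mass_one[OF a])
  finally have eq: "A' (A w) = A' (A \<delta>)" .
  define u where "u = (\<lambda>x. w x - \<delta> x)"
  have u: "u \<in> lp G 2" unfolding u_def by (rule lp_diff(1)[OF two w \<delta>(1)])
  have "A' (A u) = (\<lambda>x. 0)" using eq w \<delta> A by (simp add: u_def A_diff A'_diff)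
  then have "N (A u) = 0" using form[OF u] by (simp add: l2_inner_def)
  then have "N u = 0" using below[OF u] c by (simp add: A_def N_def mult_le_0_iff antisym)
  then have "u = (\<lambda>x. 0)" unfolding N_def by (rule lp_norm_eq_0[OF two u])
  then have w_eq: "w = \<delta>" by (simp add: u_def fun_eq_iff)
  \<comment> \<open>The trace property in its barest form: both sides are the sum of a g * s (inv
    g).\<close>
  have "A s \<one> = w \<one>"
    unfolding A_def w_def by (simp add: conv_along_def left_shift_def right_shift_def cong: infsum_cong)
  then have As1: "A s \<one> = 1" by (simp add: w_eq \<delta>_def point_mass_def)
  have As\<delta>: "l2_inner G (A s) \<delta> = 1"
  proof -
    have "l2_inner G (A s) \<delta> = A s \<one> * cnj (\<delta> \<one>)"
      unfolding l2_inner_def by (rule infsum_point) (auto simp: \<delta>_def point_mass_def)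
    then show ?thesis by (simp add: As1 \<delta>_def point_mass_def)
  qed
  \<comment> \<open>The squared norm of A s is the inner product of s with A' (A s) = A' \<delta>,
    that is, of A s with \<delta>, which is 1. The squared distance from A s to \<delta> is then 1 -
    2 + 1 = 0.\<close>
  have "of_real ((N (A s))\<^sup>2) = l2_inner G s (A' \<delta>)"
    using form[OF s(1)] by (simp add: normal A'\<delta>)
  also have "\<dots> = 1" using adj[OF s(1) \<delta>(1)] As\<delta> by simp
  finally have "(N (A s))\<^sup>2 = 1" by (simp only: of_real_eq_1_iff)
  then have "(N (\<lambda>x. A s x - of_real 1 * \<delta> x))\<^sup>2 = 0"
    using l2_norm_diff_square[OF A[OF s(1)] \<delta>(1), of 1] As\<delta> \<delta>(2) by (simp add: N_def)
  then have "N (\<lambda>x. A s x - \<delta> x) = 0" by simp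
  then have "(\<lambda>x. A s x - \<delta> x) = (\<lambda>x. 0)"
    unfolding N_def by (rule lp_norm_eq_0[OF two lp_diff(1)[OF two A[OF s(1)] \<delta>(1)]])
  then have "A s = \<delta>" by (simp add: fun_eq_iff)
  with s(1) show ?thesis by (intro that[of s]) (simp_all add: A_def \<delta>_def)
qed

text \<open>Associativity (s * a) * b = s * (a * b) with both outer factors in l^2, evaluated at x:
  pair s * a with \<eta> y = b (inv y \<otimes> x) and transpose the convolution by
  \<open>a\<close>.\<close>

lemma left_right_inverse_eq:
  assumes a: "a \<in> lp G 1" and s: "s \<in> lp G 2" "rconv a s = point_mass \<one>"
    and b: "b \<in> lp G 2" "lconv a b = point_mass \<one>"
  shows "s = b"
proof
  fix x show "s x = b x"
  proof (cases "x \<in> carrier G")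
    case x: True
    define \<eta> where "\<eta> = (\<lambda>y. if y \<in> carrier G then b (inv y \<otimes> x) else 0)"
    have "bij_betw (\<lambda>y. inv y \<otimes> x) (carrier G) (carrier G)"
      by (rule bij_betw_byWitness[where f'="\<lambda>y. x \<otimes> inv y"])
        (use x in \<open>auto simp: inv_mult_group m_assoc[symmetric], auto simp: m_assoc\<close>)
    then have \<eta>: "\<eta> \<in> lp G 2" unfolding \<eta>_def by (intro lp_reindex(1) b) auto
    have "(\<Sum>\<^sub>\<infinity>h\<in>carrier G. rconv a s h * \<eta> h) = (\<Sum>\<^sub>\<infinity>h\<in>carrier G. s h * conv_along G (\<lambda>g h. h \<otimes> g) a \<eta> h)"
      by (rule conv_along_transpose[OF permutes_carrier_right a s(1) \<eta>])
        (auto simp: right_shift_def m_assoc)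
    moreover have "(\<Sum>\<^sub>\<infinity>h\<in>carrier G. rconv a s h * \<eta> h) = rconv a s \<one> * \<eta> \<one>"
      by (rule infsum_point) (auto simp: s(2) point_mass_def)
    moreover have "rconv a s \<one> * \<eta> \<one> = b x" using x by (simp add: s(2) point_mass_def \<eta>_def)
    moreover have "conv_along G (\<lambda>g h. h \<otimes> g) a \<eta> h = point_mass x h" if h: "h \<in> carrier G" for h
    proof -
      have "conv_along G (\<lambda>g h. h \<otimes> g) a \<eta> h = lconv a b (inv h \<otimes> x)"
        using h x by (auto simp: conv_along_def \<eta>_def left_shift_def inv_mult_group m_assoc intro!: infsum_cong)
      also have "\<dots> = point_mass x h"
      proof -
        have "inv h \<otimes> x = \<one> \<longleftrightarrow> h = x" using h x by (metis inv_closed inv_comm inv_equality inv_inv l_inv)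
        then show ?thesis by (simp add: b(2) point_mass_def)
      qed
      finally show ?thesis .
    qed
    then have "(\<Sum>\<^sub>\<infinity>h\<in>carrier G. s h * conv_along G (\<lambda>g h. h \<otimes> g) a \<eta> h) = s x * conv_along G (\<lambda>g h. h \<otimes> g) a \<eta> x"
      by (intro infsum_point x) (simp add: point_mass_def)
    moreover have "conv_along G (\<lambda>g h. h \<otimes> g) a \<eta> x = 1"
      using \<open>\<And>h. h \<in> carrier G \<Longrightarrow> conv_along G (\<lambda>g h. h \<otimes> g) a \<eta> h = point_mass x h\<close>[OF x] by (simp add: point_mass_def)
    ultimately show ?thesis by simp
  qed (simp add: lp_outside[OF s(1)] lp_outside[OF b(1)])
qed

end

section \<open>Averaging operators over the group\<close>

text \<open>Jensen's inequality for a vector of means, by tangents at |m (f y)|. The mean is applied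
  to the linear minorant, so the powers |f y|^p never have to be averaged themselves. Finite index
  sets fit a finitely additive mean and are enough for \<open>lpI\<close>.\<close>

lemma mean_sum_powr_le:
  assumes m: "left_invariant_mean G m" and p: "1 \<le> p" and F: "finite F"
    and f: "\<And>y. y \<in> F \<Longrightarrow> f y \<in> linf_real G"
    and le: "\<And>g. g \<in> carrier G \<Longrightarrow> (\<Sum>y\<in>F. \<bar>f y g\<bar> powr p) \<le> B"
  shows "(\<Sum>y\<in>F. \<bar>m (f y)\<bar> powr p) \<le> B"
proof -
  define t where "t y = \<bar>m (f y)\<bar>" for y
  define k where "k y = p * t y powr (p - 1)" for y
  have k0: "0 \<le> k y" for y using p by (simp add: k_def)
  define S where "S = (\<Sum>y\<in>F. t y powr p)"
  have "m (\<lambda>g. \<Sum>y\<in>F. (k y * sgn (m (f y))) * f y g) \<le> B - S + (\<Sum>y\<in>F. k y * t y)"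
  proof (rule mean_le_const[OF m linf_real_sum[OF F linf_real_scale[OF f]]])
    fix g assume g: "g \<in> carrier G"
    have "(\<Sum>y\<in>F. t y powr p + k y * (sgn (m (f y)) * f y g - t y)) \<le> (\<Sum>y\<in>F. \<bar>f y g\<bar> powr p)"
    proof (rule sum_mono)
      fix y
      have "sgn (m (f y)) * f y g \<le> \<bar>f y g\<bar>" by (auto simp: sgn_if)
      then have "t y powr p + k y * (sgn (m (f y)) * f y g - t y) \<le> t y powr p + k y * (\<bar>f y g\<bar> - t y)"
        using k0 by (intro add_left_mono mult_left_mono) auto
      also have "\<dots> \<le> \<bar>f y g\<bar> powr p"
        unfolding k_def by (intro powr_tangent p) (auto simp: t_def)
      finally show "t y powr p + k y * (sgn (m (f y)) * f y g - t y) \<le> \<bar>f y g\<bar> powr p" .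
    qed
    also have "\<dots> \<le> B" by (rule le[OF g])
    finally show "(\<Sum>y\<in>F. (k y * sgn (m (f y))) * f y g) \<le> B - S + (\<Sum>y\<in>F. k y * t y)"
      by (simp add: S_def sum.distrib sum_subtractf right_diff_distrib mult.assoc)
  qed
  also have "m (\<lambda>g. \<Sum>y\<in>F. (k y * sgn (m (f y))) * f y g) = (\<Sum>y\<in>F. (k y * sgn (m (f y))) * m (f y))"
    using mean_sum[OF m F linf_real_scale[OF f]] mean_scale[OF m f] by simp
  also have "\<dots> = (\<Sum>y\<in>F. k y * t y)"
    by (intro sum.cong) (auto simp: t_def abs_sgn mult_ac)
  finally show ?thesis by (simp add: S_def t_def)
qed

text \<open>The given mean acts on real functions that vanish off the carrier; the cut-off puts real
  and imaginary parts into that form, whatever f is outside the group.\<close>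

definition complex_mean :: "('a, 'b) monoid_scheme \<Rightarrow> (('a \<Rightarrow> real) \<Rightarrow> real) \<Rightarrow> ('a \<Rightarrow> complex) \<Rightarrow> complex" where
  "complex_mean G m f = Complex (m (\<lambda>x. if x \<in> carrier G then Re (f x) else 0)) (m (\<lambda>x. if x \<in> carrier G then Im (f x) else 0))"

definition bounded_on_carrier :: "('a, 'b) monoid_scheme \<Rightarrow> ('a \<Rightarrow> complex) \<Rightarrow> bool" where
  "bounded_on_carrier G f \<longleftrightarrow> (\<exists>B. \<forall>x\<in>carrier G. cmod (f x) \<le> B)"

lemma bounded_on_carrier_linf:
  assumes "bounded_on_carrier G f"
  shows "(\<lambda>x. if x \<in> carrier G then Re (f x) else 0) \<in> linf_real G"
    and "(\<lambda>x. if x \<in> carrier G then Im (f x) else 0) \<in> linf_real G"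
proof -
  obtain B where B: "\<And>x. x \<in> carrier G \<Longrightarrow> cmod (f x) \<le> B" using assms by (auto simp: bounded_on_carrier_def)
  show "(\<lambda>x. if x \<in> carrier G then Re (f x) else 0) \<in> linf_real G"
    by (rule linf_realI[where C=B]) (use B abs_Re_le_cmod order_trans in \<open>auto, blast\<close>)
  show "(\<lambda>x. if x \<in> carrier G then Im (f x) else 0) \<in> linf_real G"
    by (rule linf_realI[where C=B]) (use B abs_Im_le_cmod order_trans in \<open>auto, blast\<close>)
qed

lemma bounded_on_carrier_add:
  assumes "bounded_on_carrier G f" "bounded_on_carrier G h"
  shows "bounded_on_carrier G (\<lambda>x. f x + h x)"
proof -
  obtain B where B: "\<And>x. x \<in> carrier G \<Longrightarrow> cmod (f x) \<le> B" using assms(1) by (auto simp: bounded_on_carrier_def)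
  obtain D where D: "\<And>x. x \<in> carrier G \<Longrightarrow> cmod (h x) \<le> D" using assms(2) by (auto simp: bounded_on_carrier_def)
  have "cmod (f x + h x) \<le> B + D" if "x \<in> carrier G" for x
    using B[OF that] D[OF that] norm_triangle_ineq[of "f x" "h x"] by linarith
  then show ?thesis by (auto simp: bounded_on_carrier_def)
qed

lemma bounded_on_carrier_scale:
  assumes "bounded_on_carrier G f"
  shows "bounded_on_carrier G (\<lambda>x. c * f x)"
proof -
  obtain B where B: "\<And>x. x \<in> carrier G \<Longrightarrow> cmod (f x) \<le> B" using assms(1) by (auto simp: bounded_on_carrier_def)
  have "cmod (c * f x) \<le> cmod c * B" if "x \<in> carrier G" for x
    using B[OF that] by (simp add: norm_mult mult_left_mono)
  then show ?thesis by (auto simp: bounded_on_carrier_def)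
qed

context
  fixes G :: "('a, 'b) monoid_scheme" and m :: "('a \<Rightarrow> real) \<Rightarrow> real"
  assumes m: "left_invariant_mean G m"
begin

lemma complex_mean_cong:
  assumes "\<And>x. x \<in> carrier G \<Longrightarrow> f x = h x"
  shows "complex_mean G m f = complex_mean G m h"
proof -
  have "(\<lambda>x. if x \<in> carrier G then Re (f x) else 0) = (\<lambda>x. if x \<in> carrier G then Re (h x) else 0)"
    "(\<lambda>x. if x \<in> carrier G then Im (f x) else 0) = (\<lambda>x. if x \<in> carrier G then Im (h x) else 0)"
    using assms by (auto simp: fun_eq_iff)
  then show ?thesis by (simp only: complex_mean_def)
qed

lemma complex_mean_add:
  assumes f: "bounded_on_carrier G f" and h: "bounded_on_carrier G h"
  shows "complex_mean G m (\<lambda>x. f x + h x) = complex_mean G m f + complex_mean G m h"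
proof -
  have "(\<lambda>x. if x \<in> carrier G then Re (f x + h x) else 0) = (\<lambda>x. (if x \<in> carrier G then Re (f x) else 0) + (if x \<in> carrier G then Re (h x) else 0))"
    "(\<lambda>x. if x \<in> carrier G then Im (f x + h x) else 0) = (\<lambda>x. (if x \<in> carrier G then Im (f x) else 0) + (if x \<in> carrier G then Im (h x) else 0))"
    by (auto simp: fun_eq_iff)
  then show ?thesis
    unfolding complex_mean_def
    by (simp only: mean_add[OF m bounded_on_carrier_linf(1)[OF f] bounded_on_carrier_linf(1)[OF h]]
        mean_add[OF m bounded_on_carrier_linf(2)[OF f] bounded_on_carrier_linf(2)[OF h]] complex_add)
qed

lemma complex_mean_scale:
  assumes f: "bounded_on_carrier G f"
  shows "complex_mean G m (\<lambda>x. c * f x) = c * complex_mean G m f"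
proof -
  let ?R = "\<lambda>x. if x \<in> carrier G then Re (f x) else 0" and ?I = "\<lambda>x. if x \<in> carrier G then Im (f x) else 0"
  note lin = bounded_on_carrier_linf[OF f]
  have "(\<lambda>x. if x \<in> carrier G then Re (c * f x) else 0) = (\<lambda>x. Re c * ?R x + (- Im c) * ?I x)"
    "(\<lambda>x. if x \<in> carrier G then Im (c * f x) else 0) = (\<lambda>x. Re c * ?I x + Im c * ?R x)"
    by (auto simp: fun_eq_iff)
  moreover have "m (\<lambda>x. Re c * ?R x + (- Im c) * ?I x) = Re c * m ?R + (- Im c) * m ?I"
    by (simp only: mean_add[OF m linf_real_scale[OF lin(1)] linf_real_scale[OF lin(2)]] mean_scale[OF m lin(1)] mean_scale[OF m lin(2)])
  moreover have "m (\<lambda>x. Re c * ?I x + Im c * ?R x) = Re c * m ?I + Im c * m ?R"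
    by (simp only: mean_add[OF m linf_real_scale[OF lin(2)] linf_real_scale[OF lin(1)]] mean_scale[OF m lin(1)] mean_scale[OF m lin(2)])
  ultimately show ?thesis by (simp add: complex_mean_def complex_eq_iff)
qed

lemma complex_mean_const: "complex_mean G m (\<lambda>x. c) = c"
proof -
  have "(\<lambda>x. if x \<in> carrier G then r else 0) = (\<lambda>x. r * indicator (carrier G) x)" for r :: real
    by (auto simp: indicator_def fun_eq_iff)
  then show ?thesis by (simp add: complex_mean_def mean_const[OF m])
qed

lemma complex_mean_sum:
  assumes "finite I" "\<And>i. i \<in> I \<Longrightarrow> bounded_on_carrier G (f i)"
  shows "bounded_on_carrier G (\<lambda>x. \<Sum>i\<in>I. f i x)"
    and "complex_mean G m (\<lambda>x. \<Sum>i\<in>I. f i x) = (\<Sum>i\<in>I. complex_mean G m (f i))"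
proof -
  have "bounded_on_carrier G (\<lambda>x. \<Sum>i\<in>I. f i x) \<and>
      complex_mean G m (\<lambda>x. \<Sum>i\<in>I. f i x) = (\<Sum>i\<in>I. complex_mean G m (f i))"
    using assms
  proof (induction I rule: finite_induct)
    case empty
    then show ?case using complex_mean_const[of 0] by (auto simp: bounded_on_carrier_def)
  next
    case (insert i I)
    then show ?case by (simp add: bounded_on_carrier_add complex_mean_add)
  qed
  then show "bounded_on_carrier G (\<lambda>x. \<Sum>i\<in>I. f i x)"
    and "complex_mean G m (\<lambda>x. \<Sum>i\<in>I. f i x) = (\<Sum>i\<in>I. complex_mean G m (f i))" by auto
qed

text \<open>The factor 2 comes from bounding real and imaginary parts separately; the later
  estimates leave room for it.\<close>

lemma complex_mean_bound:
  assumes B: "\<And>x. x \<in> carrier G \<Longrightarrow> cmod (f x) \<le> B"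
  shows "cmod (complex_mean G m f) \<le> 2 * B"
proof -
  have bdd: "bounded_on_carrier G f" using B by (auto simp: bounded_on_carrier_def)
  note lin = bounded_on_carrier_linf[OF bdd]
  have "- B \<le> Re (f x) \<and> Re (f x) \<le> B \<and> - B \<le> Im (f x) \<and> Im (f x) \<le> B" if "x \<in> carrier G" for x
    using B[OF that] abs_Re_le_cmod[of "f x"] abs_Im_le_cmod[of "f x"] by linarith
  then have "\<bar>m (\<lambda>x. if x \<in> carrier G then Re (f x) else 0)\<bar> \<le> B" "\<bar>m (\<lambda>x. if x \<in> carrier G then Im (f x) else 0)\<bar> \<le> B"
    using mean_le_const[OF m lin(1), of B] mean_ge_const[OF m lin(1), of "- B"]
      mean_le_const[OF m lin(2), of B] mean_ge_const[OF m lin(2), of "- B"] by (auto simp: abs_le_iff)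
  then show ?thesis using cmod_le[of "complex_mean G m f"] by (simp add: complex_mean_def)
qed

lemma complex_mean_shift:
  assumes G: "group G" and f: "bounded_on_carrier G f" and g: "g \<in> carrier G"
  shows "complex_mean G m (\<lambda>x. f (inv\<^bsub>G\<^esub> g \<otimes>\<^bsub>G\<^esub> x)) = complex_mean G m f"
proof -
  interpret group G by fact
  let ?R = "\<lambda>x. if x \<in> carrier G then Re (f x) else 0" and ?I = "\<lambda>x. if x \<in> carrier G then Im (f x) else 0"
  have "(\<lambda>x. if x \<in> carrier G then Re (f (inv\<^bsub>G\<^esub> g \<otimes>\<^bsub>G\<^esub> x)) else 0) = (\<lambda>x. if x \<in> carrier G then ?R (inv\<^bsub>G\<^esub> g \<otimes>\<^bsub>G\<^esub> x) else 0)"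
    "(\<lambda>x. if x \<in> carrier G then Im (f (inv\<^bsub>G\<^esub> g \<otimes>\<^bsub>G\<^esub> x)) else 0) = (\<lambda>x. if x \<in> carrier G then ?I (inv\<^bsub>G\<^esub> g \<otimes>\<^bsub>G\<^esub> x) else 0)"
    using g by (auto simp: fun_eq_iff)
  then show ?thesis
    unfolding complex_mean_def
    by (simp only: mean_shift[OF m g bounded_on_carrier_linf(1)[OF f]] mean_shift[OF m g bounded_on_carrier_linf(2)[OF f]])
qed

end

context group begin

text \<open>\<open>s\<close> is \<open>V \<delta>\<close> averaged over the conjugates of \<open>V\<close> by right translations, evaluated pointwise. Boundedness of
  the conjugates makes it \<open>p\<close>-summable, and invariance of the mean turns \<open>s * a\<close> into the average of \<open>V L\<^sub>a = 1\<close>.\<close>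

lemma averaged_left_inverse:
  assumes am: "amenable G" and p: "1 \<le> p" and a: "a \<in> lp G 1"
    and V: "\<And>\<xi>. \<xi> \<in> lp G p \<Longrightarrow> V \<xi> \<in> lp G p"
    and V_bound: "\<And>\<xi>. \<xi> \<in> lp G p \<Longrightarrow> lp_norm G p (V \<xi>) \<le> C * lp_norm G p \<xi>"
    and V_add: "\<And>\<xi> \<eta>. \<xi> \<in> lp G p \<Longrightarrow> \<eta> \<in> lp G p \<Longrightarrow> V (\<lambda>x. \<xi> x + \<eta> x) = (\<lambda>x. V \<xi> x + V \<eta> x)"
    and V_scale: "\<And>c \<xi>. \<xi> \<in> lp G p \<Longrightarrow> V (\<lambda>x. c * \<xi> x) = (\<lambda>x. c * V \<xi> x)"
    and left_inv: "\<And>\<xi>. \<xi> \<in> lp G p \<Longrightarrow> V (lconv a \<xi>) = \<xi>"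
  obtains s where "s \<in> lp G p" "rconv a s = point_mass \<one>"
proof -
  obtain m where m: "left_invariant_mean G m" using am by (auto simp: amenable_def)
  \<comment> \<open>The value at y of the conjugate of V by right translation, applied to the point
    mass at the unit: translating that mass by inv g gives \<open>point_mass g\<close>, and
    translating the image back evaluates it at y \<otimes> g.\<close>
  define u where "u y g = V (point_mass g) (y \<otimes> g)" for y g
  define s where "s y = (if y \<in> carrier G then complex_mean G m (u y) else 0)" for y
  have C0: "0 \<le> C"
  proof -
    have "0 \<le> lp_norm G p (V (point_mass \<one>))" by simp
    also have "\<dots> \<le> C * 1"
      using V_bound[OF point_mass_lp(1)[OF one_closed]] by (simp only: point_mass_lp(2)[OF one_closed p])
    finally show ?thesis by simp
  qed
  have V_pm: "V (point_mass g) \<in> lp G p" "lp_norm G p (V (point_mass g)) \<le> C" if "g \<in> carrier G" for g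
    using V[OF point_mass_lp(1)[OF that]] V_bound[OF point_mass_lp(1)[OF that]] point_mass_lp(2)[OF that p] by auto
  have u_le: "cmod (u y g) \<le> C" if "g \<in> carrier G" for y g
    unfolding u_def using cmod_le_lp_norm[OF p V_pm(1)[OF that]] V_pm(2)[OF that] by (rule order_trans)
  have u_bdd: "bounded_on_carrier G (u y)" for y
    using u_le by (auto simp: bounded_on_carrier_def)
  have s_le: "cmod (s y) \<le> 2 * C" for y
    using complex_mean_bound[OF m, of "u y" C] u_le C0 by (simp add: s_def)
  have u_sum: "(\<Sum>y\<in>F. cmod (u y g) powr p) \<le> C powr p" if F: "finite F" "F \<subseteq> carrier G" and g: "g \<in> carrier G" for F g
  proof -
    have inj: "inj_on (\<lambda>y. y \<otimes> g) F" using F g by (auto simp: inj_on_def subset_iff)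
    have "(\<Sum>y\<in>F. cmod (u y g) powr p) = (\<Sum>x\<in>(\<lambda>y. y \<otimes> g) ` F. cmod (V (point_mass g) x) powr p)"
      by (simp add: u_def sum.reindex[OF inj])
    also have "\<dots> \<le> lp_norm G p (V (point_mass g)) powr p"
      by (rule sum_le_lp_norm[OF p V_pm(1)[OF g]]) (use F g in auto)
    also have "\<dots> \<le> C powr p" using p V_pm(2)[OF g] by (intro powr_mono2) auto
    finally show ?thesis .
  qed
  have s_lp: "s \<in> lp G p"
  proof (rule lpI(1)[OF p])
    show "s x = 0" if "x \<notin> carrier G" for x using that by (simp add: s_def)
    \<comment> \<open>Real and imaginary part contribute C^p each, with a factor 2^p for their sum;
      and 2 * 2^p \<le> 4^p since 1 \<le> p.\<close>
    show "0 \<le> 4 * C" using C0 by simp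
    fix F assume F: "finite F" "F \<subseteq> carrier G"
    let ?R = "\<lambda>y x. if x \<in> carrier G then Re (u y x) else 0" and ?I = "\<lambda>y x. if x \<in> carrier G then Im (u y x) else 0"
    have part: "(\<Sum>y\<in>F. \<bar>m (\<lambda>x. if x \<in> carrier G then h (u y x) else 0)\<bar> powr p) \<le> C powr p"
      if h: "\<And>z. \<bar>h z\<bar> \<le> cmod z" and lin: "\<And>y. (\<lambda>x. if x \<in> carrier G then h (u y x) else 0) \<in> linf_real G" for h
    proof (rule mean_sum_powr_le[OF m p F(1) lin])
      fix g assume g: "g \<in> carrier G"
      have "(\<Sum>y\<in>F. \<bar>if g \<in> carrier G then h (u y g) else 0\<bar> powr p) \<le> (\<Sum>y\<in>F. cmod (u y g) powr p)"
        using g p h by (intro sum_mono powr_mono2) auto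
      then show "(\<Sum>y\<in>F. \<bar>if g \<in> carrier G then h (u y g) else 0\<bar> powr p) \<le> C powr p"
        using u_sum[OF F g] by (rule order_trans)
    qed
    note R = part[of Re, OF abs_Re_le_cmod bounded_on_carrier_linf(1)[OF u_bdd]]
      and I = part[of Im, OF abs_Im_le_cmod bounded_on_carrier_linf(2)[OF u_bdd]]
    have "(\<Sum>y\<in>F. cmod (s y) powr p) \<le> (\<Sum>y\<in>F. 2 powr p * (\<bar>m (?R y)\<bar> powr p + \<bar>m (?I y)\<bar> powr p))"
    proof (rule sum_mono)
      fix y assume "y \<in> F"
      then have "s y = Complex (m (?R y)) (m (?I y))" using F by (auto simp: s_def complex_mean_def)
      then have "cmod (s y) \<le> \<bar>m (?R y)\<bar> + \<bar>m (?I y)\<bar>" using cmod_le[of "s y"] by simp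
      then have "cmod (s y) powr p \<le> (\<bar>m (?R y)\<bar> + \<bar>m (?I y)\<bar>) powr p"
        using p by (intro powr_mono2) auto
      also have "\<dots> \<le> 2 powr p * (\<bar>m (?R y)\<bar> powr p + \<bar>m (?I y)\<bar> powr p)"
        using p by (intro powr_add_le_double) auto
      finally show "cmod (s y) powr p \<le> 2 powr p * (\<bar>m (?R y)\<bar> powr p + \<bar>m (?I y)\<bar> powr p)" .
    qed
    also have "\<dots> \<le> 2 powr p * (C powr p + C powr p)"
      unfolding sum_distrib_left[symmetric] sum.distrib using R I by (intro mult_left_mono add_mono) auto
    also have "\<dots> = 2 * (2 powr p * C powr p)" by simp
    also have "\<dots> \<le> 2 powr p * (2 powr p * C powr p)"
      using p powr_mono[of 1 p "2::real"] by (intro mult_right_mono) auto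
    also have "\<dots> = (4 * C) powr p"
      using C0 powr_mult[of "2::real" "2::real" p] by (simp add: powr_mult mult.assoc[symmetric])
    finally show "(\<Sum>y\<in>F. cmod (s y) powr p) \<le> (4 * C) powr p" .
  qed
  have V_sum: "(\<lambda>x. \<Sum>k\<in>E. \<xi> k x) \<in> lp G p \<and> V (\<lambda>x. \<Sum>k\<in>E. \<xi> k x) = (\<lambda>x. \<Sum>k\<in>E. V (\<xi> k) x)"
    if "finite E" "\<And>k. k \<in> E \<Longrightarrow> \<xi> k \<in> lp G p" for E \<xi>
    using that
  proof (induction E rule: finite_induct)
    case empty
    then show ?case using V_scale[of "\<lambda>x. 0" 0] by simp
  next
    case (insert k E)
    then show ?case using V_add[of "\<xi> k" "\<lambda>x. \<Sum>k\<in>E. \<xi> k x"] by (simp add: lp_add(1)[OF p])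
  qed
  have "rconv a s y = point_mass \<one> y" if y: "y \<in> carrier G" for y
  proof -
    have le: "cmod (rconv a s y - point_mass \<one> y) \<le> e" if e: "0 < e" for e
    proof -
      \<comment> \<open>The mean need not commute with infinite sums, so \<open>a\<close> is
        replaced by a finite cut-off. This costs 2 * C * \<eta> in s * a, and the mean of an error
        bounded by C * \<eta> costs 2 * C * \<eta> once more.\<close>
      define \<eta> where "\<eta> = e / (4 * C + 1)"
      have \<eta>: "0 < \<eta>" "\<eta> * (4 * C) \<le> e" using e C0 by (auto simp: \<eta>_def field_simps)
      obtain E where E: "finite E" "E \<subseteq> carrier G"
        and near: "lp_norm G 1 (\<lambda>x. a x - (if x \<in> E then a x else 0)) \<le> \<eta>"
        by (rule lp_restrict_approx[OF _ a \<eta>(1)]) auto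
      define b where "b x = (if x \<in> E then a x else 0)" for x
      have bE: "b g = 0" if "g \<notin> E" for g using that by (simp add: b_def)
      have b: "b \<in> lp G 1" by (rule lp_finite_support(1)[OF E bE])
      have ab: "(\<lambda>x. a x - b x) \<in> lp G 1" by (rule lp_diff(1)[OF _ a b]) simp
      have near: "lp_norm G 1 (\<lambda>x. a x - b x) \<le> \<eta>" using near by (simp add: b_def)
      have "cmod (rconv a s y - rconv b s y) = cmod (\<Sum>\<^sub>\<infinity>g\<in>carrier G. (a g - b g) * s (right_shift G g y))"
        using y conv_along_diff_left[OF p a b s_lp, of "right_shift G", THEN fun_cong, of y]
        by (simp add: conv_along_def)
      also have "\<dots> \<le> lp_norm G 1 (\<lambda>x. a x - b x) * (2 * C)"
        using norm_infsum_bound[OF l1_mult_bounded_abs_summable(1)[OF ab s_le]] l1_mult_bounded_abs_summable(2)[OF ab s_le]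
        by (rule order_trans)
      also have "\<dots> \<le> \<eta> * (2 * C)" using near C0 by (intro mult_right_mono) auto
      finally have 1: "cmod (rconv a s y - rconv b s y) \<le> \<eta> * (2 * C)" .
      have Ecar: "k \<in> carrier G" if "k \<in> E" for k using that E by blast
      \<comment> \<open>Left invariance, with inv k \<otimes> g in place of g, moves the factor inv
        k from the argument of s into the point mass.\<close>
      have shift: "s (y \<otimes> inv k) = complex_mean G m (\<lambda>g. V (point_mass (k \<otimes> g)) (y \<otimes> g))" if k: "k \<in> E" for k
      proof -
        define f where "f g = V (point_mass (k \<otimes> g)) (y \<otimes> g)" for g
        have "cmod (f g) \<le> C" if "g \<in> carrier G" for g
          unfolding f_def using cmod_le_lp_norm[OF p V_pm(1)[of "k \<otimes> g"]] V_pm(2)[of "k \<otimes> g"] Ecar[OF k] that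
          by (meson m_closed order_trans)
        then have "bounded_on_carrier G f" by (auto simp: bounded_on_carrier_def)
        from complex_mean_shift[OF m is_group this Ecar[OF k]]
        have "complex_mean G m (\<lambda>g. f (inv k \<otimes> g)) = complex_mean G m f" .
        moreover have "complex_mean G m (\<lambda>g. f (inv k \<otimes> g)) = complex_mean G m (u (y \<otimes> inv k))"
        proof (rule complex_mean_cong[OF m])
          fix g assume g: "g \<in> carrier G"
          have "k \<otimes> (inv k \<otimes> g) = g" "y \<otimes> (inv k \<otimes> g) = y \<otimes> inv k \<otimes> g"
            using g y Ecar[OF k] by (simp_all add: m_assoc[symmetric])
          then show "f (inv k \<otimes> g) = u (y \<otimes> inv k) g" by (simp add: f_def u_def)
        qed
        ultimately show ?thesis using y Ecar[OF k] by (simp add: s_def f_def[abs_def])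
      qed
      have fb: "bounded_on_carrier G (\<lambda>g. b k * V (point_mass (k \<otimes> g)) (y \<otimes> g))"
        and fb': "bounded_on_carrier G (\<lambda>g. V (point_mass (k \<otimes> g)) (y \<otimes> g))" if k: "k \<in> E" for k
      proof -
        have "cmod (V (point_mass (k \<otimes> g)) (y \<otimes> g)) \<le> C" if "g \<in> carrier G" for g
          using cmod_le_lp_norm[OF p V_pm(1)[of "k \<otimes> g"]] V_pm(2)[of "k \<otimes> g"] Ecar[OF k] that
          by (meson m_closed order_trans)
        then show "bounded_on_carrier G (\<lambda>g. V (point_mass (k \<otimes> g)) (y \<otimes> g))" by (auto simp: bounded_on_carrier_def)
        then show "bounded_on_carrier G (\<lambda>g. b k * V (point_mass (k \<otimes> g)) (y \<otimes> g))" by (rule bounded_on_carrier_scale)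
      qed
      define q where "q g = (\<Sum>k\<in>E. b k * V (point_mass (k \<otimes> g)) (y \<otimes> g))" for g
      have "rconv b s y = (\<Sum>k\<in>E. b k * s (y \<otimes> inv k))"
        by (subst conv_along_finite[OF E bE y]) (simp_all add: right_shift_def)
      also have "\<dots> = (\<Sum>k\<in>E. complex_mean G m (\<lambda>g. b k * V (point_mass (k \<otimes> g)) (y \<otimes> g)))"
        by (intro sum.cong refl) (simp add: shift complex_mean_scale[OF m fb'])
      also have "\<dots> = complex_mean G m q"
        unfolding q_def by (rule complex_mean_sum(2)[OF m E(1) fb, symmetric])
      finally have rq: "rconv b s y = complex_mean G m q" .
      have q_bdd: "bounded_on_carrier G q"
        unfolding q_def by (rule complex_mean_sum(1)[OF m E(1) fb])
      \<comment> \<open>For fixed g, q g is the value at y \<otimes> g of V applied to b *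
        \<open>point_mass g\<close>. Here b is close to \<open>a\<close>, and V sends a *
        \<open>point_mass g\<close> back to \<open>point_mass g\<close>.\<close>
      have q_near: "cmod (q g + (-1) * point_mass \<one> y) \<le> C * \<eta>" if g: "g \<in> carrier G" for g
      proof -
        define v where "v x = (\<Sum>k\<in>E. b k * point_mass (k \<otimes> g) x)" for x
        have pm: "(\<lambda>x. b k * point_mass (k \<otimes> g) x) \<in> lp G p" if "k \<in> E" for k
          by (intro lp_scale point_mass_lp m_closed Ecar that g)
        have v_lp: "v \<in> lp G p" and Vv: "V v = (\<lambda>x. \<Sum>k\<in>E. V (\<lambda>x. b k * point_mass (k \<otimes> g) x) x)"
          using V_sum[OF E(1), of "\<lambda>k x. b k * point_mass (k \<otimes> g) x"] pm by (auto simp: v_def[abs_def])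
        have Vv': "V v (y \<otimes> g) = q g"
          unfolding Vv q_def
          by (intro sum.cong refl) (simp add: V_scale[OF point_mass_lp(1)] Ecar g)
        have pmg: "point_mass g \<in> lp G p" by (rule point_mass_lp(1)[OF g])
        have v_eq: "v = lconv b (point_mass g)"
        proof
          fix x show "v x = lconv b (point_mass g) x"
          proof (cases "x \<in> carrier G")
            case True
            have "point_mass (k \<otimes> g) x = point_mass g (inv k \<otimes> x)" if "k \<in> E" for k
              using Ecar[OF that] g True by (auto simp: point_mass_def m_assoc[symmetric])
            then show ?thesis
              by (subst conv_along_finite[OF E bE True]) (auto simp: v_def left_shift_def intro!: sum.cong)
          qed (simp add: lp_outside[OF v_lp] conv_along_def)
        qed
        have La: "lconv a (point_mass g) \<in> lp G p" by (rule conv_along_lp(1)[OF p permutes_carrier_left a pmg])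
        define z where "z = (\<lambda>x. v x + (-1) * lconv a (point_mass g) x)"
        have z: "z \<in> lp G p" unfolding z_def by (intro lp_add(1)[OF p] lp_scale v_lp La)
        have "z = (\<lambda>x. (-1) * lconv (\<lambda>x. a x - b x) (point_mass g) x)"
          unfolding z_def v_eq conv_along_diff_left[OF p a b pmg] by simp
        then have "lp_norm G p z = lp_norm G p (lconv (\<lambda>x. a x - b x) (point_mass g))"
          by (simp only: lp_norm_scale[OF p]) simp
        also have "\<dots> \<le> lp_norm G 1 (\<lambda>x. a x - b x) * lp_norm G p (point_mass g)"
          by (rule conv_along_lp(2)[OF p permutes_carrier_left ab pmg])
        also have "\<dots> \<le> \<eta>" using near point_mass_lp(2)[OF g p] by simp
        finally have "lp_norm G p (V z) \<le> C * \<eta>"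
          using V_bound[OF z] C0 by (meson mult_left_mono order_trans)
        then have "cmod (V z (y \<otimes> g)) \<le> C * \<eta>" using cmod_le_lp_norm[OF p V[OF z]] order_trans by blast
        moreover have "V z = (\<lambda>x. V v x + (-1) * point_mass g x)"
          unfolding z_def by (simp only: V_add[OF v_lp lp_scale[OF La]] V_scale[OF La] left_inv[OF pmg])
        moreover have "point_mass g (y \<otimes> g) = point_mass \<one> y"
          using y g by (auto simp: point_mass_def)
        ultimately show ?thesis by (simp only: Vv')
      qed
      have "cmod (complex_mean G m (\<lambda>g. q g + (-1) * point_mass \<one> y)) \<le> 2 * (C * \<eta>)"
        by (rule complex_mean_bound[OF m q_near])
      also have "complex_mean G m (\<lambda>g. q g + (-1) * point_mass \<one> y) = complex_mean G m q + (-1) * point_mass \<one> y"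
        by (subst complex_mean_add[OF m q_bdd]) (auto simp: complex_mean_const[OF m] bounded_on_carrier_def)
      finally have 2: "cmod (rconv b s y - point_mass \<one> y) \<le> 2 * (C * \<eta>)" by (simp add: rq)
      have "cmod (rconv a s y - point_mass \<one> y) \<le> cmod (rconv a s y - rconv b s y) + cmod (rconv b s y - point_mass \<one> y)"
        using norm_triangle_ineq[of "rconv a s y - rconv b s y" "rconv b s y - point_mass \<one> y"] by simp
      then show ?thesis using 1 2 \<eta>(2) by (simp add: algebra_simps)
    qed
    have "cmod (rconv a s y - point_mass \<one> y) \<le> 0"
      by (rule field_le_epsilon) (use le in simp)
    then show ?thesis by simp
  qed
  moreover have "rconv a s y = point_mass \<one> y" if "y \<notin> carrier G" for y
    using that by (auto simp: conv_along_def point_mass_def)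
  ultimately have "rconv a s = point_mass \<one>" by blast
  with s_lp show ?thesis by (rule that)
qed

end

section \<open>Invertibility\<close>

context group begin

text \<open>\<open>right_translation\<close> without the restriction to \<open>lp G p\<close>, so
  that \<open>lconv_translate\<close> holds for arbitrary functions.\<close>

definition translate :: "'a \<Rightarrow> ('a \<Rightarrow> complex) \<Rightarrow> ('a \<Rightarrow> complex)" where
  "translate g \<xi> = (\<lambda>x. if x \<in> carrier G then \<xi> (x \<otimes> g) else 0)"

lemma translate_lp:
  assumes p: "1 \<le> p" and g: "g \<in> carrier G" and \<xi>: "\<xi> \<in> lp G p"
  shows "translate g \<xi> \<in> lp G p"
proof -
  have "bij_betw (\<lambda>x. x \<otimes> g) (carrier G) (carrier G)"
    by (rule bij_betw_byWitness[where f'="\<lambda>x. x \<otimes> inv g"]) (use g in \<open>auto simp: m_assoc\<close>)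
  then show ?thesis unfolding translate_def by (rule lp_reindex(1)[OF p _ \<xi>])
qed

lemma lconv_translate:
  assumes g: "g \<in> carrier G"
  shows "lconv a (translate g \<xi>) = translate g (lconv a \<xi>)"
  using g by (auto simp: fun_eq_iff conv_along_def translate_def left_shift_def m_assoc intro!: infsum_cong)

lemma translate_point_mass:
  assumes g: "g \<in> carrier G"
  shows "translate (inv g) (point_mass \<one>) = point_mass g"
proof
  fix x
  have "x \<otimes> inv g = \<one> \<longleftrightarrow> x = g" if "x \<in> carrier G"
    using that g by (metis inv_closed inv_equality inv_inv r_inv)
  then show "translate (inv g) (point_mass \<one>) x = point_mass g x"
    using g by (auto simp: translate_def point_mass_def)
qed

text \<open>The translates of the point mass at the unit are all the point masses, and these span a
  dense subspace.\<close>

lemma closed_translation_invariant_eq_lp: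
  assumes p: "1 \<le> p" and M: "closed_subspace G p M" and one: "point_mass \<one> \<in> M"
    and inv: "\<And>g \<xi>. g \<in> carrier G \<Longrightarrow> \<xi> \<in> M \<Longrightarrow> translate g \<xi> \<in> M"
  shows "M = lp G p"
proof
  show "M \<subseteq> lp G p" using M by (simp add: closed_subspace_def)
  have add: "(\<lambda>x. \<xi> x + \<eta> x) \<in> M" if "\<xi> \<in> M" "\<eta> \<in> M" for \<xi> \<eta>
    using M that by (simp add: closed_subspace_def)
  have scale: "(\<lambda>x. c * \<xi> x) \<in> M" if "\<xi> \<in> M" for c \<xi>
    using M that by (simp add: closed_subspace_def)
  have pm: "point_mass g \<in> M" if "g \<in> carrier G" for g
    using inv[OF inv_closed[OF that] one] by (simp only: translate_point_mass[OF that])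
  have fin: "(\<lambda>x. if x \<in> F then \<xi> x else 0) \<in> M" if "finite F" "F \<subseteq> carrier G" for F \<xi>
    using that
  proof (induction F rule: finite_induct)
    case empty
    then show ?case using M by (simp add: closed_subspace_def)
  next
    case (insert g F)
    have "(\<lambda>x. (if x \<in> F then \<xi> x else 0) + \<xi> g * point_mass g x) \<in> M"
      using insert by (intro add scale pm) auto
    moreover have "(\<lambda>x. (if x \<in> F then \<xi> x else 0) + \<xi> g * point_mass g x) = (\<lambda>x. if x \<in> insert g F then \<xi> x else 0)"
      using insert.hyps by (auto simp: fun_eq_iff point_mass_def)
    ultimately show ?case by simp
  qed
  show "lp G p \<subseteq> M"
  proof
    fix \<xi> assume \<xi>: "\<xi> \<in> lp G p"
    have "\<exists>F. finite F \<and> F \<subseteq> carrier G \<and>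
        lp_norm G p (\<lambda>x. \<xi> x - (if x \<in> F then \<xi> x else 0)) \<le> 1 / real (Suc n)" for n
      using lp_restrict_approx[OF p \<xi>, of "1 / real (Suc n)"] by (metis divide_pos_pos of_nat_0_less_iff zero_less_Suc zero_less_one)
    then obtain F where F: "\<And>n. finite (F n)" "\<And>n. F n \<subseteq> carrier G"
      "\<And>n. lp_norm G p (\<lambda>x. \<xi> x - (if x \<in> F n then \<xi> x else 0)) \<le> 1 / real (Suc n)" by metis
    define s where "s n = (\<lambda>x. if x \<in> F n then \<xi> x else 0)" for n
    have "s n \<in> M" for n unfolding s_def by (rule fin[OF F(1,2)])
    moreover have "(\<lambda>n. lp_norm G p (\<lambda>x. s n x - \<xi> x)) \<longlonglongrightarrow> 0"
    proof (rule tendsto_sandwich[OF _ _ tendsto_const])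
      show "(\<lambda>n. 1 / real (Suc n)) \<longlonglongrightarrow> 0" by (rule LIMSEQ_Suc[OF lim_1_over_n])
      show "\<forall>\<^sub>F n in sequentially. 0 \<le> lp_norm G p (\<lambda>x. s n x - \<xi> x)" by simp
      have "lp_norm G p (\<lambda>x. s n x - \<xi> x) \<le> 1 / real (Suc n)" for n
        using F(3)[of n] lp_norm_commute[of G p "s n" \<xi>] by (simp only: s_def)
      then show "\<forall>\<^sub>F n in sequentially. lp_norm G p (\<lambda>x. s n x - \<xi> x) \<le> 1 / real (Suc n)" by simp
    qed
    ultimately show "\<xi> \<in> M" using M \<xi> unfolding closed_subspace_def by blast
  qed
qed

lemma CV_memI:
  assumes p: "1 \<le> p" and T: "T \<in> lp G p \<rightarrow>\<^sub>E lp G p"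
    and "\<And>\<xi> \<eta>. \<xi> \<in> lp G p \<Longrightarrow> \<eta> \<in> lp G p \<Longrightarrow> T (\<lambda>x. \<xi> x + \<eta> x) = (\<lambda>x. T \<xi> x + T \<eta> x)"
    and "\<And>c \<xi>. \<xi> \<in> lp G p \<Longrightarrow> T (\<lambda>x. c * \<xi> x) = (\<lambda>x. c * T \<xi> x)"
    and "\<And>\<xi>. \<xi> \<in> lp G p \<Longrightarrow> lp_norm G p (T \<xi>) \<le> C * lp_norm G p \<xi>"
    and comm: "\<And>g \<xi>. g \<in> carrier G \<Longrightarrow> \<xi> \<in> lp G p \<Longrightarrow> T (translate g \<xi>) = translate g (T \<xi>)"
  shows "T \<in> carrier (CV G p)"
proof -
  have "compose (lp G p) T (right_translation G p g) = compose (lp G p) (right_translation G p g) T"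
    if g: "g \<in> carrier G" for g
  proof
    fix \<xi>
    show "compose (lp G p) T (right_translation G p g) \<xi> = compose (lp G p) (right_translation G p g) T \<xi>"
    proof (cases "\<xi> \<in> lp G p")
      case True
      then have "T \<xi> \<in> lp G p" using T by auto
      then show ?thesis
        using True comm[OF g True] by (simp add: compose_def right_translation_def translate_def)
    qed (simp add: compose_def)
  qed
  moreover have "\<exists>C. \<forall>\<xi>\<in>lp G p. lp_norm G p (T \<xi>) \<le> C * lp_norm G p \<xi>"
    using assms(5) by blast
  ultimately show ?thesis using assms(2,3,4) by (simp add: CV_def bounded_ops_def)
qed

end

theorem theorem3:
  fixes G :: "('a, 'b) monoid_scheme" and p :: real and a :: "'a \<Rightarrow> complex"
  assumes "group G" and "amenable G"
    and "1 \<le> p"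
    and "a \<in> lp G 1"
    and "inj_on (left_conv G p a) (lp G p)"
    and "complemented G p (left_conv G p a ` lp G p)"
  shows "left_conv G p a \<in> Units (CV G p) \<and> left_conv G p a ` lp G p = lp G p"
proof -
  interpret group G by fact
  note am = assms(2) and p = assms(3) and a = assms(4)
  define T where "T = left_conv G p a"
  define X where "X = lp G p"
  define N where "N = lp_norm G p"
  have T: "T \<xi> = lconv a \<xi>" if "\<xi> \<in> X" for \<xi>
    using that unfolding T_def X_def left_conv_def conv_along_def left_shift_def by simp
  have X_add: "(\<lambda>x. \<xi> x + \<eta> x) \<in> X" if "\<xi> \<in> X" "\<eta> \<in> X" for \<xi> \<eta>
    using lp_add(1)[OF p] that by (simp add: X_def)
  have X_scale: "(\<lambda>x. c * \<xi> x) \<in> X" if "\<xi> \<in> X" for c \<xi>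
    using lp_scale that by (simp add: X_def)
  have X_trans: "translate g \<xi> \<in> X" if "g \<in> carrier G" "\<xi> \<in> X" for g \<xi>
    using translate_lp[OF p] that by (simp add: X_def)
  have T_X: "T \<xi> \<in> X" and T_bound: "N (T \<xi>) \<le> lp_norm G 1 a * N \<xi>" if "\<xi> \<in> X" for \<xi>
    using conv_along_lp[OF p permutes_carrier_left a, of \<xi>] that by (auto simp: T X_def N_def)
  have T_add: "T (\<lambda>x. \<xi> x + \<eta> x) = (\<lambda>x. T \<xi> x + T \<eta> x)" if "\<xi> \<in> X" "\<eta> \<in> X" for \<xi> \<eta>
    using conv_along_add[OF p permutes_carrier_left a, of \<xi> \<eta>] that X_add by (simp add: T X_def)
  have T_scale: "T (\<lambda>x. c * \<xi> x) = (\<lambda>x. c * T \<xi> x)" if "\<xi> \<in> X" for c \<xi>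
    using conv_along_scale[OF p permutes_carrier_left a, of c \<xi>] that X_scale by (simp add: T)
  have T_trans: "T (translate g \<xi>) = translate g (T \<xi>)" if "g \<in> carrier G" "\<xi> \<in> X" for g \<xi>
    using lconv_translate[OF that(1)] that X_trans by (simp add: T)
  have inj: "inj_on T X" using assms(5) by (simp add: T_def X_def)
  have closed: "closed_subspace G p (T ` X)"
    using assms(6) by (simp add: complemented_def T_def X_def)
  obtain c where c: "0 < c" and below: "\<And>\<xi>. \<xi> \<in> X \<Longrightarrow> c * N \<xi> \<le> N (T \<xi>)"
  proof (rule lp_bounded_below[OF p T_X[unfolded X_def] T_bound[unfolded X_def N_def] T_add[unfolded X_def]
        T_scale[unfolded X_def] inj[unfolded X_def] closed[unfolded X_def]])
    fix c :: real
    assume "0 < c" and *: "\<And>\<xi>. \<xi> \<in> lp G p \<Longrightarrow> c * lp_norm G p \<xi> \<le> lp_norm G p (T \<xi>)"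
    show thesis
      by (rule that[OF \<open>0 < c\<close>], unfold X_def N_def, rule *)
  qed
  have belowL: "c * lp_norm G p \<xi> \<le> lp_norm G p (lconv a \<xi>)" if "\<xi> \<in> lp G p" for \<xi>
    using below[of \<xi>] that by (simp add: X_def N_def T)
  define \<kappa> where "\<kappa> = transference_const p * (c / 2)"
  have \<kappa>: "0 < \<kappa>" using transference_const_pos[OF p] c by (simp add: \<kappa>_def)
  have below2: "\<kappa> * lp_norm G 2 f \<le> lp_norm G 2 (lconv a f)" if "f \<in> lp G 2" for f
    unfolding \<kappa>_def by (rule transference[OF am p a c belowL that])
  obtain b where b: "b \<in> lp G 2" "lconv a b = point_mass \<one>\<^bsub>G\<^esub>"
    by (rule l2_inverse[OF a \<kappa> below2])
  have bX: "b \<in> X"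
  proof (cases "2 \<le> p")
    case True
    then show ?thesis using lp_mono[OF _ _ b(1), of p] by (simp add: X_def)
  next
    case False
    obtain P where P: "P \<in> carrier (bounded_ops G p)" "compose X P P = P" "P ` X = T ` X"
      using assms(6) by (auto simp: complemented_def X_def T_def bounded_ops_def)
    have P_X: "P \<xi> \<in> X" if "\<xi> \<in> X" for \<xi> using P(1) that by (auto simp: bounded_ops_def X_def)
    have P_add: "P (\<lambda>x. \<xi> x + \<eta> x) = (\<lambda>x. P \<xi> x + P \<eta> x)" if "\<xi> \<in> X" "\<eta> \<in> X" for \<xi> \<eta>
      using P(1) that by (simp add: bounded_ops_def X_def)
    have P_scale: "P (\<lambda>x. c * \<xi> x) = (\<lambda>x. c * P \<xi> x)" if "\<xi> \<in> X" for c \<xi>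
      using P(1) that by (simp add: bounded_ops_def X_def)
    have "\<exists>C. \<forall>\<xi>\<in>X. N (P \<xi>) \<le> C * N \<xi>"
      using P(1) by (simp add: bounded_ops_def X_def N_def)
    then obtain C where C: "\<forall>\<xi>\<in>X. N (P \<xi>) \<le> C * N \<xi>" ..
    have P_T: "P (T \<xi>) = T \<xi>" if "\<xi> \<in> X" for \<xi>
    proof -
      have "T \<xi> \<in> P ` X" unfolding P(3) using that by (rule imageI)
      then obtain \<zeta> where \<zeta>: "T \<xi> = P \<zeta>" "\<zeta> \<in> X" ..
      have "P (P \<zeta>) = compose X P P \<zeta>" by (rule compose_eq[OF \<zeta>(2), symmetric])
      then show ?thesis by (simp only: P(2) \<zeta>(1))
    qed
    \<comment> \<open>Project onto the range, then undo T. The bound C / c combines that of P with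
      the lower bound for T.\<close>
    define V where "V \<xi> = inv_into X T (P \<xi>)" for \<xi>
    have V: "V \<xi> \<in> X" "T (V \<xi>) = P \<xi>" if "\<xi> \<in> X" for \<xi>
    proof -
      have "P \<xi> \<in> T ` X" using P(3) that by blast
      then show "V \<xi> \<in> X" "T (V \<xi>) = P \<xi>" unfolding V_def by (rule inv_into_into, rule f_inv_into_f)
    qed
    obtain s where s: "s \<in> lp G p" "rconv a s = point_mass \<one>\<^bsub>G\<^esub>"
    proof (rule averaged_left_inverse[OF am p a, of V "C / c"])
      fix \<xi> assume "\<xi> \<in> lp G p"
      then have \<xi>: "\<xi> \<in> X" by (simp add: X_def)
      show "V \<xi> \<in> lp G p" using V(1)[OF \<xi>] by (simp add: X_def)
      have "c * N (V \<xi>) \<le> C * N \<xi>" using below[OF V(1)[OF \<xi>]] V(2)[OF \<xi>] bspec[OF C \<xi>] by simp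
      then show "lp_norm G p (V \<xi>) \<le> C / c * lp_norm G p \<xi>" using c by (simp add: N_def field_simps)
      show "V (\<lambda>x. k * \<xi> x) = (\<lambda>x. k * V \<xi> x)" for k
        by (rule inj_onD[OF inj]) (use V \<xi> X_scale T_scale P_scale in simp_all)
      show "V (lconv a \<xi>) = \<xi>"
        using inj \<xi> P_T[OF \<xi>] by (simp add: V_def flip: T[OF \<xi>])
      fix \<eta> assume "\<eta> \<in> lp G p"
      then have \<eta>: "\<eta> \<in> X" by (simp add: X_def)
      show "V (\<lambda>x. \<xi> x + \<eta> x) = (\<lambda>x. V \<xi> x + V \<eta> x)"
        by (rule inj_onD[OF inj]) (use V \<xi> \<eta> X_add T_add P_add in simp_all)
    qed blast
    have "s \<in> lp G 2" by (rule lp_mono[OF p _ s(1)]) (use False in simp)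
    then have "s = b" by (rule left_right_inverse_eq[OF a _ s(2) b])
    then show ?thesis using s(1) by (simp add: X_def)
  qed
  have surj: "T ` X = X"
    unfolding X_def
  proof (rule closed_translation_invariant_eq_lp[OF p])
    show "closed_subspace G p (T ` lp G p)" using closed by (simp add: X_def)
    show "point_mass \<one>\<^bsub>G\<^esub> \<in> T ` lp G p"
      by (rule image_eqI[of _ T b]) (use bX b(2) T[OF bX] in \<open>simp_all add: X_def\<close>)
    fix g \<xi> assume g: "g \<in> carrier G" and "\<xi> \<in> T ` lp G p"
    then obtain \<eta> where \<eta>: "\<eta> \<in> X" "\<xi> = T \<eta>" by (auto simp: X_def)
    show "translate g \<xi> \<in> T ` lp G p"
      by (rule image_eqI[of _ T "translate g \<eta>"]) (use \<eta>(2) T_trans[OF g \<eta>(1)] X_trans[OF g \<eta>(1)] in \<open>simp_all add: X_def\<close>)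
  qed
  \<comment> \<open>Operators in \<open>CV G p\<close> are extensional, hence the restriction to X.
    Linearity and commutation with translations are pulled back through the injective T.\<close>
  define Y where "Y = (\<lambda>\<xi>\<in>X. inv_into X T \<xi>)"
  have Y: "Y \<xi> \<in> X" "T (Y \<xi>) = \<xi>" if "\<xi> \<in> X" for \<xi>
  proof -
    have \<xi>: "\<xi> \<in> T ` X" using that surj by simp
    show "Y \<xi> \<in> X" "T (Y \<xi>) = \<xi>"
      using inv_into_into[OF \<xi>] f_inv_into_f[OF \<xi>] that by (simp_all add: Y_def)
  qed
  have YT: "Y (T \<xi>) = \<xi>" if "\<xi> \<in> X" for \<xi>
    using inj that T_X[OF that] by (simp add: Y_def)
  have T_CV: "T \<in> carrier (CV G p)"
  proof (rule CV_memI[OF p])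
    show "T \<in> lp G p \<rightarrow>\<^sub>E lp G p" using T_X by (auto simp: X_def T_def left_conv_def)
  qed (use T_add T_scale T_bound T_trans in \<open>simp_all add: X_def N_def\<close>)
  have Y_CV: "Y \<in> carrier (CV G p)"
  proof (rule CV_memI[OF p, of _ "1 / c"])
    show "Y \<in> lp G p \<rightarrow>\<^sub>E lp G p" using Y(1) by (auto simp: X_def Y_def)
    fix \<xi> assume "\<xi> \<in> lp G p"
    then have \<xi>: "\<xi> \<in> X" by (simp add: X_def)
    show "Y (\<lambda>x. k * \<xi> x) = (\<lambda>x. k * Y \<xi> x)" for k
      by (rule inj_onD[OF inj]) (use Y \<xi> X_scale T_scale in simp_all)
    show "lp_norm G p (Y \<xi>) \<le> 1 / c * lp_norm G p \<xi>"
      using below[OF Y(1)[OF \<xi>]] Y(2)[OF \<xi>] c by (simp add: N_def field_simps)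
    show "Y (translate g \<xi>) = translate g (Y \<xi>)" if "g \<in> carrier G" for g
      by (rule inj_onD[OF inj]) (use Y \<xi> X_trans T_trans that in simp_all)
    fix \<eta> assume "\<eta> \<in> lp G p"
    then have \<eta>: "\<eta> \<in> X" by (simp add: X_def)
    show "Y (\<lambda>x. \<xi> x + \<eta> x) = (\<lambda>x. Y \<xi> x + Y \<eta> x)"
      by (rule inj_onD[OF inj]) (use Y \<xi> \<eta> X_add T_add in simp_all)
  qed
  have "compose X Y T = (\<lambda>\<xi>\<in>X. \<xi>)" "compose X T Y = (\<lambda>\<xi>\<in>X. \<xi>)"
    using Y YT by (auto simp: compose_def fun_eq_iff restrict_def)
  then have "T \<in> Units (CV G p)"
    using T_CV Y_CV by (auto simp: Units_def CV_def bounded_ops_def X_def)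
  then show ?thesis using surj by (simp add: T_def X_def)
qed

end
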